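(* Let $p\in q^{\mathbb{Z}}$ and $x=\mu(\lambda)$ where $\lambda\in-q^{2\mathbb{Z}+1}p\cup q^{2\mathbb{Z}+1}p$ and $|\lambda|>1$. Let $j,l\in\mathbb{Z}$ be such that $|\lambda|=q^{1-2j}p^{-1}=q^{1+2l}p$ (so $l<j$). Then $(p,x)$ determines a discrete series corepresentation of $(M,\Delta)$, i.e. $\mathcal{L}_{p,x}\ne\{0\}$, in the following 3 cases, and these are the only cases: (i) $x>0$, in which case $\{e_m^{++}(p,x): m\in\mathbb{Z}\}\cup\{e_m^{-+}(p,x): m\in\mathbb{Z},\,m\le l\}\cup\{e_m^{+-}(p,x): m\in\mathbb{Z},\,m\ge j\}$ is an orthonormal basis for $\mathcal{L}_{p,x}$. (ii) $x<0$, $l\ge0$ and $j>0$, in which case $\{e_m^{-+}(p,x): m\in\mathbb{Z}\}\cup\{e_m^{++}(p,x): m\in\mathbb{Z},\,m\le l\}\cup\{e_m^{--}(p,x): m\in\mathbb{Z},\,m\ge j\}$ is an orthonormal basis for $\mathcal{L}_{p,x}$. (iii) $x<0$, $l<0$ and $j\le0$, in which case $\{e_m^{+-}(p,x): m\in\mathbb{Z}\}\cup\{e_m^{--}(p,x): m\in\mathbb{Z},\,m\le l\}\cup\{e_m^{++}(p,x): m\in\mathbb{Z},\,m\ge j\}$ is an orthonormal basis for $\mathcal{L}_{p,x}$.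
   Context: Fix $0<q<1$; $\mathbb{N}=\{1,2,\dots\}$, $I_q=-q^{\mathbb{N}}\cup q^{\mathbb{Z}}$, $\kappa(x)=\mathrm{sgn}(x)x^2$, $\mu(y)=\frac12(y+y^{-1})$. $\mathcal{K}=L^2(\mathbb{T})\otimes\ell^2(I_q)\otimes\ell^2(I_q)$ with orthonormal basis $f_{mpt}=\zeta^m\otimes\delta_p\otimes\delta_t$ ($m\in\mathbb{Z}$, $p,t\in I_q$), $\zeta$ the identity function on the unit circle $\mathbb{T}$. On the linear span $\mathcal{K}_0$ of the $f_{mpt}$ define $K_0f_{mpt}=q^{-m/2}|p/t|^{1/2}f_{mpt}$ and $$(q-q^{-1})E_0f_{mpt}=\mathrm{sgn}(t)\,q^{-\frac{m-1}{2}}|p/t|^{1/2}\sqrt{1+\kappa(q^{-1}t)}\,f_{m-1,p,q^{-1}t}-\mathrm{sgn}(p)\,q^{\frac{m-1}{2}}|t/p|^{1/2}\sqrt{1+\kappa(p)}\,f_{m-1,qp,t}$$ (terms with label outside $I_q$ have zero coefficient and are read as $0$). $K$, $E$ are the closures of $K_0,E_0$, and the Casimir operator $\Omega$ is the (self-adjoint) closure of $\frac12((q-q^{-1})^2E^*E-qK^2-q^{-1}K^{-2})$. For $p\in q^{\mathbb{Z}}$, $m\in\mathbb{Z}$, $\epsilon,\eta\in\{-,+\}$, $\mathcal{K}(p,m,\epsilon,\eta)$ is the closed span of the $f_{-m,\epsilon\eta q^mpz,z}$ with $z\in I_q$, $\mathrm{sgn}(z)=\epsilon$ and $\epsilon\eta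 q^mpz\in I_q$; $\Omega$ restricts to a self-adjoint operator on each of these spaces, all of whose eigenspaces are at most one-dimensional. For $x=\mu(\lambda)$ with $\lambda\in-q^{-\mathbb{N}}\cup q^{-\mathbb{N}}$, $e_m^{\epsilon,\eta}(p,x)\in\mathcal{K}(p,m,\epsilon,\eta)$ (also written $e_m^{\epsilon\eta}(p,x)$) is a unit eigenvector of $\Omega|_{\mathcal{K}(p,m,\epsilon,\eta)}$ for the eigenvalue $\epsilon\eta x$ (determined up to a phase, which is fixed arbitrarily), and $e_m^{\epsilon,\eta}(p,x)=0$ if $\epsilon\eta x$ is not an eigenvalue there. $\mathcal{L}_{p,x}$ is the closed span of $\{e_m^{\epsilon,\eta}(p,x): m\in\mathbb{Z},\ \epsilon,\eta\in\{-,+\}\}$. It is an invariant subspace for the left regular corepresentation $W$ of the quantum group $(M,\Delta)$, the quantum group analogue of the normalizer of $SU(1,1)$ in $SL(2,\mathbb{C})$. If $\mathcal{L}_{p,x}\neq\{0\}$ one says that $(p,x)$ determines a discrete series corepresentation of $(M,\Delta)$ (namely the restriction of $W$ to $\mathcal{K}\otimes\mathcal{L}_{p,x}$). *)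

theory Defs
  imports "HOL-Analysis.Analysis" "HOL-Library.Function_Algebras"
begin

section \<open>The index set and scalar functions\<close>

definition q_ints :: "real \<Rightarrow> real set" where
  "q_ints q = {q powi k | k :: int. True}"

definition I_q :: "real \<Rightarrow> real set" where
  "I_q q = {- (q ^ n) | n :: nat. n \<ge> 1} \<union> q_ints q"

definition kappa :: "real \<Rightarrow> real" where
  "kappa x = sgn x * x\<^sup>2"

definition mu :: "real \<Rightarrow> real" where
  "mu y = (y + inverse y) / 2"


section \<open>The Hilbert space\<close>

text \<open>The Hilbert space \<open>L\<^sup>2(T) \<otimes> \<ell>\<^sup>2(I\<^sub>q) \<otimes> \<ell>\<^sup>2(I\<^sub>q)\<close> (\<open>T\<close> the unit circle) is written in coordinates
  with respect to its orthonormal basis \<open>\<zeta>\<^sup>m \<otimes> \<delta>\<^sub>p \<otimes> \<delta>\<^sub>t\<close>, that is, as the space of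
  square-summable families indexed by \<open>\<int> \<times> I\<^sub>q \<times> I\<^sub>q\<close>. A family is represented by a total
  function that vanishes outside the index set.\<close>

type_synonym hvec = "int \<times> real \<times> real \<Rightarrow> complex"

definition hscale :: "complex \<Rightarrow> hvec \<Rightarrow> hvec" where
  "hscale c v = (\<lambda>i. c * v i)"

interpretation hvec: vector_space hscale
  by unfold_locales (simp_all add: hscale_def fun_eq_iff algebra_simps)

definition hspace :: "real \<Rightarrow> hvec set" where
  "hspace q = {v. (\<forall>m p t. v (m, p, t) \<noteq> 0 \<longrightarrow> p \<in> I_q q \<and> t \<in> I_q q) \<and>
                  (\<lambda>i. (cmod (v i))\<^sup>2) summable_on UNIV}"

definition hinner :: "hvec \<Rightarrow> hvec \<Rightarrow> complex" where
  "hinner v w = (\<Sum>\<^sub>\<infinity>i. v i * cnj (w i))"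

definition hnorm :: "hvec \<Rightarrow> real" where
  "hnorm v = sqrt (\<Sum>\<^sub>\<infinity>i. (cmod (v i))\<^sup>2)"

definition hclosure :: "real \<Rightarrow> hvec set \<Rightarrow> hvec set" where
  "hclosure q S = {v \<in> hspace q. \<forall>r>0. \<exists>w\<in>S. hnorm (v - w) < r}"

definition closed_span :: "real \<Rightarrow> hvec set \<Rightarrow> hvec set" where
  "closed_span q S = hclosure q (hvec.span S)"

definition orthonormal_basis :: "real \<Rightarrow> hvec set \<Rightarrow> hvec set \<Rightarrow> bool" where
  "orthonormal_basis q B L \<longleftrightarrow>
     B \<subseteq> hspace q \<and>
     (\<forall>v\<in>B. hnorm v = 1) \<and>
     (\<forall>v\<in>B. \<forall>w\<in>B. v \<noteq> w \<longrightarrow> hinner v w = 0) \<and>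
     closed_span q B = L"

text \<open>The basis vectors; a vector with a label outside \<open>I\<^sub>q\<close> is read as zero.\<close>

definition f_vec :: "real \<Rightarrow> int \<Rightarrow> real \<Rightarrow> real \<Rightarrow> hvec" where
  "f_vec q m p t = (\<lambda>i. if i = (m, p, t) \<and> p \<in> I_q q \<and> t \<in> I_q q then 1 else 0)"

definition hspace0 :: "real \<Rightarrow> hvec set" where
  "hspace0 q = hvec.span {f_vec q m p t | m p t. p \<in> I_q q \<and> t \<in> I_q q}"


section \<open>Unbounded operators, represented by their graphs\<close>

type_synonym hop = "(hvec \<times> hvec) set"

definition op_closure :: "real \<Rightarrow> hop \<Rightarrow> hop" where
  "op_closure q T = {(v, w). v \<in> hspace q \<and> w \<in> hspace q \<and>
     (\<forall>r>0. \<exists>(v', w')\<in>T. hnorm (v - v') < r \<and> hnorm (w - w') < r)}"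

definition op_adjoint :: "real \<Rightarrow> hop \<Rightarrow> hop" where
  "op_adjoint q T = {(w, z). w \<in> hspace q \<and> z \<in> hspace q \<and>
     (\<forall>(u, v)\<in>T. hinner v w = hinner u z)}"

definition op_comp :: "hop \<Rightarrow> hop \<Rightarrow> hop" where
  "op_comp S T = T O S"

definition op_scale :: "complex \<Rightarrow> hop \<Rightarrow> hop" where
  "op_scale c T = {(v, hscale c w) | v w. (v, w) \<in> T}"

text \<open>As usual, the difference is defined on the intersection of the two domains.\<close>

definition op_diff :: "hop \<Rightarrow> hop \<Rightarrow> hop" where
  "op_diff S T = {(v, w - w') | v w w'. (v, w) \<in> S \<and> (v, w') \<in> T}"

definition op_restrict :: "hop \<Rightarrow> hvec set \<Rightarrow> hop" where
  "op_restrict T S = T \<inter> (S \<times> S)"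

definition is_eigenvector :: "hop \<Rightarrow> complex \<Rightarrow> hvec \<Rightarrow> bool" where
  "is_eigenvector T c v \<longleftrightarrow> v \<noteq> 0 \<and> (v, hscale c v) \<in> T"

definition is_eigenvalue :: "hop \<Rightarrow> complex \<Rightarrow> bool" where
  "is_eigenvalue T c \<longleftrightarrow> (\<exists>v. is_eigenvector T c v)"

text \<open>The graph of the linear operator on the span of the basis vectors that maps
  \<open>f\<^sub>m\<^sub>p\<^sub>t\<close> to \<open>F (m, p, t)\<close>.\<close>

definition op_of_basis :: "real \<Rightarrow> (int \<times> real \<times> real \<Rightarrow> hvec) \<Rightarrow> hop" where
  "op_of_basis q F = {(v, \<Sum>i | v i \<noteq> 0. hscale (v i) (F i)) | v. v \<in> hspace0 q}"


section \<open>The operators $K$, $E$ and the Casimir operator\<close>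

definition K0_op :: "real \<Rightarrow> hop" where
  "K0_op q = op_of_basis q (\<lambda>(m, p, t).
     hscale (of_real (q powr (- of_int m / 2) * \<bar>p / t\<bar> powr (1/2))) (f_vec q m p t))"

definition E0_op :: "real \<Rightarrow> hop" where
  "E0_op q = op_of_basis q (\<lambda>(m, p, t). hscale (of_real (inverse (q - inverse q)))
     (hscale (of_real (sgn t * q powr (- (of_int m - 1) / 2) * \<bar>p / t\<bar> powr (1/2)
                         * sqrt (1 + kappa (inverse q * t))))
             (f_vec q (m - 1) p (inverse q * t))
      - hscale (of_real (sgn p * q powr ((of_int m - 1) / 2) * \<bar>t / p\<bar> powr (1/2)
                         * sqrt (1 + kappa p)))
             (f_vec q (m - 1) (q * p) t)))"

definition K_op :: "real \<Rightarrow> hop" where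
  "K_op q = op_closure q (K0_op q)"

definition E_op :: "real \<Rightarrow> hop" where
  "E_op q = op_closure q (E0_op q)"

definition Casimir :: "real \<Rightarrow> hop" where
  "Casimir q = op_closure q (op_scale (1/2)
     (op_diff
       (op_diff
         (op_scale (of_real ((q - inverse q)\<^sup>2)) (op_comp (op_adjoint q (E_op q)) (E_op q)))
         (op_scale (of_real q) (op_comp (K_op q) (K_op q))))
       (op_scale (of_real (inverse q)) (op_comp ((K_op q)\<inverse>) ((K_op q)\<inverse>)))))"


section \<open>Discrete series\<close>

text \<open>Signs are represented by the reals \<open>1\<close> and \<open>-1\<close>.\<close>

definition K_sub :: "real \<Rightarrow> real \<Rightarrow> int \<Rightarrow> real \<Rightarrow> real \<Rightarrow> hvec set" where
  "K_sub q p m \<epsilon> \<eta> = closed_span q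
     {f_vec q (- m) (\<epsilon> * \<eta> * q powi m * p * z) z | z.
        z \<in> I_q q \<and> sgn z = \<epsilon> \<and> \<epsilon> * \<eta> * q powi m * p * z \<in> I_q q}"

text \<open>The vectors \<open>e m \<epsilon> \<eta>\<close> are only determined up to a phase, so an arbitrary choice of
  them is described by a predicate.\<close>

definition is_e_family ::
  "real \<Rightarrow> real \<Rightarrow> real \<Rightarrow> (int \<Rightarrow> real \<Rightarrow> real \<Rightarrow> hvec) \<Rightarrow> bool" where
  "is_e_family q p x e \<longleftrightarrow> (\<forall>m. \<forall>\<epsilon>\<in>{-1, 1}. \<forall>\<eta>\<in>{-1, 1}.
     let \<Omega> = op_restrict (Casimir q) (K_sub q p m \<epsilon> \<eta>); c = of_real (\<epsilon> * \<eta> * x) in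
     if is_eigenvalue \<Omega> c
     then is_eigenvector \<Omega> c (e m \<epsilon> \<eta>) \<and> hnorm (e m \<epsilon> \<eta>) = 1
     else e m \<epsilon> \<eta> = 0)"

text \<open>The space $\mathcal{L}_{p,x}$, given the vectors for $(p,x)$.\<close>

definition L_space :: "real \<Rightarrow> (int \<Rightarrow> real \<Rightarrow> real \<Rightarrow> hvec) \<Rightarrow> hvec set" where
  "L_space q e = closed_span q {e m \<epsilon> \<eta> | m \<epsilon> \<eta>. \<epsilon> \<in> {-1, 1} \<and> \<eta> \<in> {-1, 1}}"

definition determines_discrete_series ::
  "real \<Rightarrow> (int \<Rightarrow> real \<Rightarrow> real \<Rightarrow> hvec) \<Rightarrow> bool" where
  "determines_discrete_series q e \<longleftrightarrow> L_space q e \<noteq> {0}"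

end

theory Submission
  imports Defs
begin

text \<open>
  Writing $z = \epsilon q^k$ turns the Casimir operator on $\mathcal{K}(p,m,\epsilon,\eta)$ into a
  Jacobi operator in the index $k$. Its recurrence has, up to scalars, exactly one solution decaying
  at $k \to \infty$, an explicit basic hypergeometric series of base $q^2$. On a half line this
  solution satisfies the boundary condition iff the series terminates (otherwise a Wronskian argument
  excludes eigenvectors). On the full line ($\epsilon = \eta = +$) it must also decay at
  $k \to -\infty$: for $\lambda < 0$ either the series terminates and its degree decides, or
  $\|E v\|^2 \ge 0$ excludes an eigenvector; for $\lambda > 0$ a Heine transform decays at both ends.
  Eigenvectors of the closed operator satisfy the recurrence pointwise; conversely, cutting a
  decaying solution $v$ off with the weights $1 - |k|/L$ puts $(v, Ev)$ in the closure of $E_0$.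
\<close>

text \<open>Put p = q^a, s = m + a and lambda = delta q^(-d) with delta = 1 or -1. The two
  expressions for |lambda| give a = -(l + j) and d = j - l - 1, so a + d is odd. This parity is what
  lets numerator factors of the series vanish; it turns the spectral question for each block into
  inequalities between s, m and d, which finally read m <= l, m >= j, l >= 0, j <= 0. The obstacle
  is that \<open>Casimir\<close> is the closure of a product: an eigenvector is only a limit of
  vectors to which E and then its adjoint can be applied. For single coordinates this is harmless,
  and the energy argument is run on the approximants. To produce an eigenvector one must reach the
  domain of E, which is a closure from finitely supported families and hence minimal, whereas its
  adjoint is maximal and asks only for square-summable coordinates. For lambda > 0 and eps = eta = 1
  the series never terminates and diverges for very negative k; Heine's formula moves q^(2k) from
  the argument into the parameters, where every k is admissible.\<close>

locale unit_q =
  fixes q :: real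
  assumes q_pos: "0 < q" and q_less_1: "q < 1"
begin

section \<open>Integer powers of q\<close>

lemma q_nz [simp]: "q \<noteq> 0"
  using q_pos by simp

lemma sgn_q [simp]: "sgn q = 1"
  using q_pos by simp

lemma powi_pos [simp]: "0 < q powi k"
  using q_pos by simp

lemma powi_nz [simp]: "q powi k \<noteq> 0"
  using powi_pos[of k] by linarith

lemma powi_nonneg [simp]: "0 \<le> q powi k"
  using powi_pos[of k] by linarith

lemma abs_powi [simp]: "\<bar>q powi k\<bar> = q powi k"
  using powi_pos[of k] by linarith

lemma powi_double: "q powi (2 * k) = (q powi k)\<^sup>2"
  using power_int_mult[of q k 2] by (simp add: mult.commute)

lemma powi_add: "q powi (j + k) = q powi j * q powi k"
  by (simp add: power_int_add)

lemma powi_diff: "q powi (j - k) = q powi j / q powi k"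
  by (simp add: power_int_diff)

lemma powi_uminus: "q powi (- k) = 1 / q powi k"
  by (simp add: power_int_minus field_simps)

lemmas powi_expand = powi_add powi_diff powi_uminus powi_double

lemma powi_less: "k < j \<Longrightarrow> q powi j < q powi k"
  using q_pos q_less_1 by (intro power_int_strict_decreasing) auto

lemma powi_less_iff: "q powi j < q powi k \<longleftrightarrow> k < j"
  using powi_less[of j k] powi_less[of k j] by (cases j k rule: linorder_cases) auto

lemma powi_le_iff: "q powi j \<le> q powi k \<longleftrightarrow> k \<le> j"
  using powi_less_iff[of k j] by linarith

lemma powi_eq_iff: "q powi j = q powi k \<longleftrightarrow> k = j"
  using powi_less_iff[of k j] powi_less_iff[of j k] by (cases j k rule: linorder_cases) auto

lemma powi_less_1_iff: "q powi j < 1 \<longleftrightarrow> 0 < j"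
  using powi_less_iff[of j 0] by simp

lemma powi_le_1_iff: "q powi j \<le> 1 \<longleftrightarrow> 0 \<le> j"
  using powi_le_iff[of j 0] by simp

lemma q_sq_less_1: "q\<^sup>2 < 1"
  using q_pos q_less_1 by (simp add: power_less_one_iff)

section \<open>Infinite q-Pochhammer symbols in base q^2\<close>

definition qpoch :: "real \<Rightarrow> nat \<Rightarrow> real" where
  "qpoch x n = (\<Prod>i<n. 1 - x * q ^ (2 * i))"

definition qpoch_inf :: "real \<Rightarrow> real" where
  "qpoch_inf x = (\<Prod>i. 1 - x * q ^ (2 * i))"

lemma qpoch_0 [simp]: "qpoch x 0 = 1"
  by (simp add: qpoch_def)

lemma qpoch_Suc: "qpoch x (Suc n) = qpoch x n * (1 - x * q ^ (2 * n))"
  by (simp add: qpoch_def)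

lemma summable_geo: "summable (\<lambda>i. norm (x * q ^ (2 * i)))"
proof -
  have "summable (\<lambda>i. \<bar>x\<bar> * (q\<^sup>2) ^ i)"
    using q_sq_less_1 by (intro summable_mult summable_geometric) simp
  then show ?thesis
    by (simp add: power_mult abs_mult)
qed

lemma convergent_qp: "convergent_prod (\<lambda>i. 1 - x * q ^ (2 * i))"
proof -
  have "abs_convergent_prod (\<lambda>i. 1 + (- (x * q ^ (2 * i))))"
    by (rule summable_imp_abs_convergent_prod) (use summable_geo[of x] in simp)
  then show ?thesis
    using abs_convergent_prod_imp_convergent_prod by simp
qed

lemma qpoch_tendsto: "qpoch x \<longlonglongrightarrow> qpoch_inf x"
  unfolding qpoch_def[abs_def] qpoch_inf_def
  using has_prod_imp_tendsto'[OF convergent_prod_has_prod[OF convergent_qp[of x]]] by simp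

lemma qpoch_inf_eq_0_iff: "qpoch_inf x = 0 \<longleftrightarrow> (\<exists>i. x * q ^ (2 * i) = 1)"
proof -
  have "(\<Prod>i. 1 - x * q ^ (2 * i)) = 0 \<longleftrightarrow> (\<exists>i. 1 - x * q ^ (2 * i) = 0)"
    using has_prod_eq_0_iff[OF convergent_prod_has_prod[OF convergent_qp[of x]]] by auto
  then show ?thesis unfolding qpoch_inf_def by auto
qed

lemma qpoch_inf_split: "qpoch_inf x = qpoch x n * qpoch_inf (x * q ^ (2 * n))"
proof -
  have "qpoch_inf x = (\<Prod>i<n. 1 - x * q ^ (2 * i)) * (\<Prod>i. 1 - x * q ^ (2 * (i + n)))"
  \<comment> \<open>Splitting off an initial segment presupposes nonzero initial factors; if one of
    them vanishes, both sides are 0.\<close>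
  proof (cases "\<exists>i<n. 1 - x * q ^ (2 * i) = 0")
    case True
    then have "qpoch_inf x = 0" "(\<Prod>i<n. 1 - x * q ^ (2 * i)) = 0"
      by (auto simp: qpoch_inf_eq_0_iff)
    then show ?thesis by simp
  next
    case False
    then show ?thesis
      unfolding qpoch_inf_def by (subst prodinf_split_initial_segment[OF convergent_qp, of n]) auto
  qed
  then show ?thesis
    by (simp add: qpoch_def qpoch_inf_def power_add distrib_left mult_ac)
qed

lemma qpoch_inf_step: "qpoch_inf x = (1 - x) * qpoch_inf (x * q\<^sup>2)"
  using qpoch_inf_split[of x 1] by (simp add: qpoch_def)

lemma qpoch_nz: "qpoch_inf x \<noteq> 0 \<Longrightarrow> qpoch x n \<noteq> 0"
  using qpoch_inf_split[of x n] by auto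

lemma qpoch_inf_pos: "x < 1 \<Longrightarrow> qpoch_inf x > 0"
proof -
  assume x: "x < 1"
  have "x * q ^ (2 * i) < 1" for i
  proof (cases "x \<le> 0")
    case True
    then have "x * q ^ (2 * i) \<le> 0" using q_pos by (simp add: mult_nonpos_nonneg)
    then show ?thesis by linarith
  next
    case False
    have "q ^ (2 * i) \<le> 1" using q_pos q_less_1 by (simp add: power_le_one)
    then have "x * q ^ (2 * i) \<le> x" using False by (simp add: mult_left_le)
    then show ?thesis using x by linarith
  qed
  then show ?thesis
    unfolding qpoch_inf_def by (intro less_0_prodinf convergent_qp) auto
qed

text \<open>The tail is (y)_inf / (y)_n, a quotient with limit 1. The preliminary shift by
  \<open>n0\<close> only serves to make y < 1, so that (y)_inf is positive and can be divided
  by.\<close>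

lemma qpoch_inf_tendsto_1: "(\<lambda>n. qpoch_inf (x * q ^ (2 * n))) \<longlonglongrightarrow> 1"
proof -
  have "(\<lambda>n. \<bar>x\<bar> * (q\<^sup>2) ^ n) \<longlonglongrightarrow> \<bar>x\<bar> * 0"
    using q_sq_less_1 by (intro tendsto_intros LIMSEQ_power_zero) simp
  then have "eventually (\<lambda>n. \<bar>x\<bar> * (q\<^sup>2) ^ n < 1) sequentially"
    by (rule order_tendstoD) simp
  then obtain n0 where n0: "\<bar>x\<bar> * q ^ (2 * n0) < 1"
    by (auto simp: eventually_sequentially power_mult)
  define y where "y = x * q ^ (2 * n0)"
  have "y < 1"
    unfolding y_def by (rule le_less_trans[OF mult_right_mono n0]) (use q_pos in auto)
  then have nz: "qpoch_inf y > 0" by (rule qpoch_inf_pos)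
  have "(\<lambda>n. qpoch_inf y / qpoch y n) \<longlonglongrightarrow> qpoch_inf y / qpoch_inf y"
    using nz by (intro tendsto_intros qpoch_tendsto) simp
  moreover have "qpoch_inf y / qpoch y n = qpoch_inf (y * q ^ (2 * n))" for n
    using qpoch_inf_split[of y n] qpoch_nz[of y n] nz by auto
  ultimately have "(\<lambda>n. qpoch_inf (y * q ^ (2 * n))) \<longlonglongrightarrow> 1"
    using nz by simp
  then have "(\<lambda>n. qpoch_inf (x * q ^ (2 * (n + n0)))) \<longlonglongrightarrow> 1"
    unfolding y_def by (simp add: power_add distrib_left mult_ac)
  then show ?thesis
    using LIMSEQ_offset[of "\<lambda>n. qpoch_inf (x * q ^ (2 * n))" n0 1] by simp
qed

section \<open>The basic hypergeometric series and its recurrence\<close>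

lemma powi_of_nat: "q powi (2 * int n) = q ^ (2 * n)"
  using power_int_of_nat[of q "2 * n"] by simp

text \<open>These are the coefficients in y of 2phi1(-q^(1+m-s)/L, -eps eta q^(1-m-s)/L; q^2/L^2;
  q^2, -eta q^(2s) y), which will be evaluated at y = q^(2k). The parameter L stands for lambda: the
  recurrence carries X = 2x = L + 1/L.\<close>

definition ser_coeff :: "real \<Rightarrow> real \<Rightarrow> int \<Rightarrow> int \<Rightarrow> real \<Rightarrow> nat \<Rightarrow> real" where
  "ser_coeff \<epsilon> \<eta> s m L n = (- \<eta> * (q powi s)\<^sup>2) ^ n *
     (qpoch (- (q * q powi m / (q powi s * L))) n * qpoch (- (\<epsilon> * \<eta> * q / (q powi s * q powi m * L))) n) /
     (qpoch (q\<^sup>2) n * qpoch (q\<^sup>2 / L\<^sup>2) n)"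

text \<open>The factor that the n-th coefficient contributes to the power y^(n+1) when the power
  series is inserted into the recurrence. It factors as eta L q^(2s-2n-2) times (1 + q^(1+m-s+2n)/L)
  (1 + eps eta q^(1-m-s+2n)/L), and this is where the two numerator parameters of the series come
  from.\<close>

definition ser_bracket :: "real \<Rightarrow> real \<Rightarrow> int \<Rightarrow> int \<Rightarrow> real \<Rightarrow> nat \<Rightarrow> real" where
  "ser_bracket \<epsilon> \<eta> s m L n = \<epsilon> * q ^ (2 * n) / L + \<eta> * L * (q powi s)\<^sup>2 / (q ^ (2 * n) * q\<^sup>2)
     + q powi s / q * (\<eta> * q powi m + \<epsilon> / q powi m)"

lemma ser_coeff_0 [simp]: "ser_coeff \<epsilon> \<eta> s m L 0 = 1"
  by (simp add: ser_coeff_def)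

text \<open>For |L| >= 1 the lower parameter is below 1, so no denominator of the series vanishes; L
  = 1 also covers the symbol (q^2; q^2)_n.\<close>

lemma qpoch_q2_nz: "\<bar>L\<bar> \<ge> 1 \<Longrightarrow> qpoch (q\<^sup>2 / L\<^sup>2) n \<noteq> 0"
proof -
  assume L: "\<bar>L\<bar> \<ge> 1"
  then have "1 \<le> L\<^sup>2" by (metis abs_1 abs_le_square_iff one_power2)
  then have "q\<^sup>2 / L\<^sup>2 \<le> q\<^sup>2" by (simp add: divide_le_eq mult_left_mono)
  then have "q\<^sup>2 / L\<^sup>2 < 1" using q_sq_less_1 by linarith
  then show ?thesis using qpoch_nz qpoch_inf_pos by (metis less_irrefl)
qed

lemma qpoch_q2_nz': "qpoch (q\<^sup>2) n \<noteq> 0"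
  using qpoch_q2_nz[of 1] by simp

text \<open>The factor on the left is L + 1/L - q^(2n+2)/L - L/q^(2n+2), which the coefficient with
  index n+1 collects from the three terms of the recurrence. In product form it cancels the two
  denominator factors that are new in that coefficient.\<close>

lemma ser_coeff_Suc:
  assumes "\<epsilon>\<^sup>2 = 1" "\<eta>\<^sup>2 = 1" "\<bar>L\<bar> > 1"
  shows "ser_coeff \<epsilon> \<eta> s m L (Suc n) * ((1 - 1 / (q ^ (2 * n) * q\<^sup>2)) * (L - q ^ (2 * n) * q\<^sup>2 / L)) =
    ser_coeff \<epsilon> \<eta> s m L n * ser_bracket \<epsilon> \<eta> s m L n"
proof -
  define S M Y where "S = q powi s" and "M = q powi m" and "Y = q ^ (2 * n)"
  have nz: "S \<noteq> 0" "M \<noteq> 0" "Y \<noteq> 0" "L \<noteq> 0" using assms by (auto simp: S_def M_def Y_def)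
  have d: "1 - q\<^sup>2 * Y \<noteq> 0" "1 - q\<^sup>2 / L\<^sup>2 * Y \<noteq> 0"
    using qpoch_q2_nz'[of "Suc n"] qpoch_q2_nz[of L "Suc n"] assms(3) by (auto simp: qpoch_Suc Y_def)
  have LY: "L\<^sup>2 - q\<^sup>2 * Y \<noteq> 0" using d(2) nz by (simp add: field_simps)
  have e: "ser_coeff \<epsilon> \<eta> s m L (Suc n) = ser_coeff \<epsilon> \<eta> s m L n * ((- \<eta> * S\<^sup>2) *
      ((1 + q * M / (S * L) * Y) * (1 + \<epsilon> * \<eta> * q / (S * M * L) * Y)) / ((1 - q\<^sup>2 * Y) * (1 - q\<^sup>2 / L\<^sup>2 * Y)))"
    by (simp add: ser_coeff_def qpoch_Suc S_def M_def Y_def mult_ac)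
  have "((- \<eta> * S\<^sup>2) * ((1 + q * M / (S * L) * Y) * (1 + \<epsilon> * \<eta> * q / (S * M * L) * Y)) /
       ((1 - q\<^sup>2 * Y) * (1 - q\<^sup>2 / L\<^sup>2 * Y))) * ((1 - 1 / (Y * q\<^sup>2)) * (L - Y * q\<^sup>2 / L))
     = (- \<eta> * S\<^sup>2) * ((1 + q * M / (S * L) * Y) * (1 + \<epsilon> * \<eta> * q / (S * M * L) * Y)) * (- L / (Y * q\<^sup>2))"
  proof -
    have "(1 - 1 / (Y * q\<^sup>2)) * (L - Y * q\<^sup>2 / L) = (- L / (Y * q\<^sup>2)) * ((1 - q\<^sup>2 * Y) * (1 - q\<^sup>2 / L\<^sup>2 * Y))"
      using nz by (simp add: field_simps power2_eq_square)
    moreover have "x / z * (t * z) = x * t" if "z \<noteq> 0" for x z t :: real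
      using that by simp
    moreover have "(1 - q\<^sup>2 * Y) * (1 - q\<^sup>2 / L\<^sup>2 * Y) \<noteq> 0"
      using d by simp
    ultimately show ?thesis by presburger
  qed
  also have "\<dots> = \<eta> * L * S\<^sup>2 / (Y * q\<^sup>2) + \<eta> * S * M / q + \<eta>\<^sup>2 * \<epsilon> * (S / (q * M) + Y / L)"
    using nz by (simp add: field_simps power2_eq_square)
  also have "\<dots> = ser_bracket \<epsilon> \<eta> s m L n"
    using nz assms(2) by (simp add: ser_bracket_def S_def M_def Y_def field_simps)
  finally show ?thesis
    unfolding e Y_def[symmetric] by (simp only: mult.assoc)
qed

definition ser_partial :: "real \<Rightarrow> real \<Rightarrow> int \<Rightarrow> int \<Rightarrow> real \<Rightarrow> nat \<Rightarrow> real \<Rightarrow> real" where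
  "ser_partial \<epsilon> \<eta> s m L N y = (\<Sum>n\<le>N. ser_coeff \<epsilon> \<eta> s m L n * y ^ n)"

text \<open>Truncation costs a single monomial: all lower powers cancel by
  \<open>ser_coeff_Suc\<close>, and only the top contribution, which the next coefficient would have
  absorbed, remains. This remainder is 0 for a terminating series, and its limit gives the boundary
  defect of a non-terminating one.\<close>

lemma ser_partial_rec:
  assumes "\<epsilon>\<^sup>2 = 1" "\<eta>\<^sup>2 = 1" "\<bar>L\<bar> > 1"
  shows "- (1 / L) * (1 + \<epsilon> * y) * ser_partial \<epsilon> \<eta> s m L N (y * q\<^sup>2)
      - L * (1 + \<eta> * (q powi s)\<^sup>2 * y / q\<^sup>2) * ser_partial \<epsilon> \<eta> s m L N (y / q\<^sup>2)
      - (y * q powi s / q * (\<eta> * q powi m + \<epsilon> / q powi m) - L - 1 / L) * ser_partial \<epsilon> \<eta> s m L N y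
    = - ser_coeff \<epsilon> \<eta> s m L N * ser_bracket \<epsilon> \<eta> s m L N * y ^ Suc N"
proof (induction N)
  case 0
  show ?case using assms by (simp add: ser_partial_def ser_bracket_def field_simps)
next
  case (Suc N)
  define S D Y c Z where "S = (q powi s)\<^sup>2" and "D = q powi s / q * (\<eta> * q powi m + \<epsilon> / q powi m)"
    and "Y = q ^ (2 * N)" and "c = ser_coeff \<epsilon> \<eta> s m L (Suc N)" and "Z = y ^ Suc N"
  have nz: "Y \<noteq> 0" "L \<noteq> 0" "q \<noteq> 0" using assms by (auto simp: Y_def)
  have Yp: "(q\<^sup>2) ^ N = Y"
    by (simp add: Y_def power_mult)
  have p: "ser_partial \<epsilon> \<eta> s m L (Suc N) (y * q\<^sup>2) = ser_partial \<epsilon> \<eta> s m L N (y * q\<^sup>2) + c * (Z * (Y * q\<^sup>2))"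
    "ser_partial \<epsilon> \<eta> s m L (Suc N) (y / q\<^sup>2) = ser_partial \<epsilon> \<eta> s m L N (y / q\<^sup>2) + c * (Z / (Y * q\<^sup>2))"
    "ser_partial \<epsilon> \<eta> s m L (Suc N) y = ser_partial \<epsilon> \<eta> s m L N y + c * Z"
    using Yp by (simp_all add: ser_partial_def c_def Z_def power_mult_distrib power_divide mult_ac)
  have b: "ser_bracket \<epsilon> \<eta> s m L (Suc N) = \<epsilon> * (Y * q\<^sup>2) / L + \<eta> * L * S / (Y * q\<^sup>2 * q\<^sup>2) + D"
    by (simp add: ser_bracket_def Y_def S_def D_def power_add power2_eq_square mult_ac)
  have r: "ser_coeff \<epsilon> \<eta> s m L N * ser_bracket \<epsilon> \<eta> s m L N = c * ((1 - 1 / (Y * q\<^sup>2)) * (L - Y * q\<^sup>2 / L))"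
    using ser_coeff_Suc[OF assms, of s m N] by (simp add: c_def Y_def)
  have IH: "- (1 / L) * (1 + \<epsilon> * y) * ser_partial \<epsilon> \<eta> s m L N (y * q\<^sup>2)
      - L * (1 + \<eta> * S * y / q\<^sup>2) * ser_partial \<epsilon> \<eta> s m L N (y / q\<^sup>2)
      - (y * D - L - 1 / L) * ser_partial \<epsilon> \<eta> s m L N y
    = - (c * ((1 - 1 / (Y * q\<^sup>2)) * (L - Y * q\<^sup>2 / L))) * Z"
    using Suc r by (simp add: S_def D_def Z_def mult.assoc)
  have step: "- (1 / L) * (1 + \<epsilon> * y) * (c * (Z * (Y * q\<^sup>2)))
      - L * (1 + \<eta> * S * y / q\<^sup>2) * (c * (Z / (Y * q\<^sup>2)))
      - (y * D - L - 1 / L) * (c * Z) =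
      (c * ((1 - 1 / (Y * q\<^sup>2)) * (L - Y * q\<^sup>2 / L))) * Z - c * (\<epsilon> * (Y * q\<^sup>2) / L + \<eta> * L * S / (Y * q\<^sup>2 * q\<^sup>2) + D) * (y * Z)"
    using nz by (simp add: field_simps power2_eq_square)
  have "- (1 / L) * (1 + \<epsilon> * y) * ser_partial \<epsilon> \<eta> s m L (Suc N) (y * q\<^sup>2)
      - L * (1 + \<eta> * S * y / q\<^sup>2) * ser_partial \<epsilon> \<eta> s m L (Suc N) (y / q\<^sup>2)
      - (y * D - L - 1 / L) * ser_partial \<epsilon> \<eta> s m L (Suc N) y
     = - c * (\<epsilon> * (Y * q\<^sup>2) / L + \<eta> * L * S / (Y * q\<^sup>2 * q\<^sup>2) + D) * (y * Z)"
  proof -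
    have "a1 * (p1 + u1) - a2 * (p2 + u2) - a3 * (p3 + u3) = (a1 * p1 - a2 * p2 - a3 * p3) + (a1 * u1 - a2 * u2 - a3 * u3)"
      for a1 a2 a3 p1 p2 p3 u1 u2 u3 :: real
      by (simp add: algebra_simps)
    moreover have "- r * z + (r * z - c * t * u) = - c * t * u" for r z t u :: real
      by simp
    ultimately show ?thesis unfolding p using IH step by presburger
  qed
  then show ?case
    unfolding b by (simp add: S_def D_def c_def Z_def mult.assoc)
qed

end

section \<open>Uniqueness of decaying solutions\<close>

text \<open>The discrete Wronskian \<open>W\<close> does not depend on n and tends to 0, because
  both sequences decay and \<open>A\<close> is bounded; so it vanishes. At n = 0 this makes the
  initial data proportional. As \<open>a\<close> satisfies the boundary equation and
  \<open>\<phi>\<close> violates it, a 0 = 0, and the recurrence propagates the zero.\<close>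

lemma half_line_uniqueness:
  fixes A E a \<phi> :: "nat \<Rightarrow> real"
  assumes a0: "A 0 * a 1 = E 0 * a 0"
    and aS: "\<And>n. A (Suc n) * a (Suc (Suc n)) + A n * a n = E (Suc n) * a (Suc n)"
    and \<phi>0: "A 0 * \<phi> 1 \<noteq> E 0 * \<phi> 0"
    and \<phi>S: "\<And>n. A (Suc n) * \<phi> (Suc (Suc n)) + A n * \<phi> n = E (Suc n) * \<phi> (Suc n)"
    and A: "\<And>n. A n \<noteq> 0" "\<And>n. \<bar>A n\<bar> \<le> B"
    and lim: "a \<longlonglongrightarrow> 0" "\<phi> \<longlonglongrightarrow> 0"
  shows "a n = 0"
proof -
  define W where "W n = A n * (a n * \<phi> (Suc n) - a (Suc n) * \<phi> n)" for n
  have "W (Suc n) = W n" for n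
  proof -
    have "W (Suc n) = a (Suc n) * (A (Suc n) * \<phi> (Suc (Suc n))) - (A (Suc n) * a (Suc (Suc n))) * \<phi> (Suc n)"
      by (simp add: W_def algebra_simps)
    also have "\<dots> = a (Suc n) * (E (Suc n) * \<phi> (Suc n) - A n * \<phi> n) - (E (Suc n) * a (Suc n) - A n * a n) * \<phi> (Suc n)"
      unfolding eq_diff_eq[THEN iffD2, OF aS[of n]] eq_diff_eq[THEN iffD2, OF \<phi>S[of n]] ..
    also have "\<dots> = W n" by (simp add: W_def algebra_simps)
    finally show ?thesis .
  qed
  then have Wc: "W n = W 0" for n by (induction n) auto
  have "(\<lambda>n. a n * \<phi> (Suc n) - a (Suc n) * \<phi> n) \<longlonglongrightarrow> 0 * 0 - 0 * 0"
    by (intro tendsto_intros lim LIMSEQ_Suc)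
  then have "(\<lambda>n. a n * \<phi> (Suc n) - a (Suc n) * \<phi> n) \<longlonglongrightarrow> 0" by simp
  then have 1: "(\<lambda>n. B * \<bar>a n * \<phi> (Suc n) - a (Suc n) * \<phi> n\<bar>) \<longlonglongrightarrow> 0"
    by (intro tendsto_mult_right_zero tendsto_rabs_zero)
  have "\<bar>W n\<bar> \<le> B * \<bar>a n * \<phi> (Suc n) - a (Suc n) * \<phi> n\<bar>" for n
    unfolding W_def abs_mult by (intro mult_right_mono A) auto
  then have "(\<lambda>n. W n) \<longlonglongrightarrow> 0"
    by (intro Lim_null_comparison[OF always_eventually 1]) simp
  moreover have "W = (\<lambda>n. W 0)"
    using Wc by (intro ext)
  ultimately have "W 0 = 0"
    by (metis LIMSEQ_const_iff)
  then have "a 0 * \<phi> 1 = a 1 * \<phi> 0" using A(1)[of 0] by (simp add: W_def)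
  then have "a 0 * (A 0 * \<phi> 1) = (A 0 * a 1) * \<phi> 0" by (simp add: algebra_simps)
  then have "a 0 * (A 0 * \<phi> 1 - E 0 * \<phi> 0) = 0" unfolding a0 by (simp add: algebra_simps)
  then have z0: "a 0 = 0" using \<phi>0 by simp
  then have z1: "a 1 = 0" using a0 A(1)[of 0] by simp
  have "a n = 0 \<and> a (Suc n) = 0"
  proof (induction n)
    case 0
    then show ?case using z0 z1 by simp
  next
    case (Suc n)
    then show ?case using aS[of n] A(1)[of "Suc n"] by simp
  qed
  then show ?thesis by simp
qed

text \<open>A bound for \<open>A\<close> on k >= 0 suffices because the Wronskian is constant along
  the whole line and its limit at +infinity alone makes it vanish; in the application
  \<open>A\<close> grows at -infinity. Far to the left \<open>a\<close> is then t times
  \<open>\<phi>\<close>, and since \<open>\<phi>\<close> stays away from 0 there while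
  \<open>a\<close> decays, t = 0.\<close>

lemma whole_line_uniqueness:
  fixes A E a \<phi> :: "int \<Rightarrow> real"
  assumes a: "\<And>k. A k * a (k + 1) + A (k - 1) * a (k - 1) = E k * a k"
    and \<phi>: "\<And>k. A k * \<phi> (k + 1) + A (k - 1) * \<phi> (k - 1) = E k * \<phi> k"
    and A: "\<And>k. A k \<noteq> 0" "\<And>k. k \<ge> 0 \<Longrightarrow> \<bar>A k\<bar> \<le> B"
    and lim: "(\<lambda>n. a (int n)) \<longlonglongrightarrow> 0" "(\<lambda>n. \<phi> (int n)) \<longlonglongrightarrow> 0" "(\<lambda>n. a (- int n)) \<longlonglongrightarrow> 0"
    and \<phi>c: "c > 0" "\<And>n. n \<ge> M \<Longrightarrow> \<bar>\<phi> (- int n)\<bar> \<ge> c"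
  shows "a k = 0"
proof -
  define W where "W k = A k * (a k * \<phi> (k + 1) - a (k + 1) * \<phi> k)" for k
  have Wm: "W k = W (k - 1)" for k
  proof -
    have "W k = a k * (A k * \<phi> (k + 1)) - (A k * a (k + 1)) * \<phi> k"
      by (simp add: W_def algebra_simps)
    also have "\<dots> = a k * (E k * \<phi> k - A (k - 1) * \<phi> (k - 1)) - (E k * a k - A (k - 1) * a (k - 1)) * \<phi> k"
      unfolding eq_diff_eq[THEN iffD2, OF a[of k]] eq_diff_eq[THEN iffD2, OF \<phi>[of k]] ..
    also have "\<dots> = W (k - 1)" by (simp add: W_def algebra_simps)
    finally show ?thesis .
  qed
  have Wc: "W k = W 0" for k
  proof (induction k rule: int_induct[where k = 0])
    case (step1 i)
    then show ?case using Wm[of "i + 1"] by simp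
  next
    case (step2 i)
    then show ?case using Wm[of i] by simp
  qed simp
  have lim': "(\<lambda>n. a (int n + 1)) \<longlonglongrightarrow> 0" "(\<lambda>n. \<phi> (int n + 1)) \<longlonglongrightarrow> 0"
    using LIMSEQ_Suc[OF lim(1)] LIMSEQ_Suc[OF lim(2)] by (simp_all add: add.commute)
  have "(\<lambda>n. a (int n) * \<phi> (int n + 1) - a (int n + 1) * \<phi> (int n)) \<longlonglongrightarrow> 0 * 0 - 0 * 0"
    by (intro tendsto_intros lim lim')
  then have 1: "(\<lambda>n. B * \<bar>a (int n) * \<phi> (int n + 1) - a (int n + 1) * \<phi> (int n)\<bar>) \<longlonglongrightarrow> 0"
    by (intro tendsto_mult_right_zero tendsto_rabs_zero) simp
  have "\<bar>W (int n)\<bar> \<le> B * \<bar>a (int n) * \<phi> (int n + 1) - a (int n + 1) * \<phi> (int n)\<bar>" for n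
    unfolding W_def abs_mult by (intro mult_right_mono A) auto
  then have "(\<lambda>n. W (int n)) \<longlonglongrightarrow> 0"
    by (intro Lim_null_comparison[OF always_eventually 1]) simp
  moreover have "(\<lambda>n. W (int n)) = (\<lambda>n. W 0)"
    using Wc by (intro ext)
  ultimately have "W 0 = 0"
    by (metis LIMSEQ_const_iff)
  then have "W k = 0" for k using Wc[of k] by simp
  then have par: "a k * \<phi> (k + 1) = a (k + 1) * \<phi> k" for k
    using A(1)[of k] unfolding W_def by auto
  define t where "t = a (- int M) / \<phi> (- int M)"
  have \<phi>nz: "\<phi> (- int n) \<noteq> 0" if "n \<ge> M" for n
    using \<phi>c(1) \<phi>c(2)[OF that] by auto
  have at: "a (- int n) = t * \<phi> (- int n)" if "n \<ge> M" for n
    using that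
  proof (induction n rule: dec_induct)
    case base
    then show ?case using \<phi>nz[of M] by (simp add: t_def)
  next
    case (step n)
    have "a (- int (Suc n)) * \<phi> (- int n) = a (- int n) * \<phi> (- int (Suc n))"
      using par[of "- int (Suc n)"] by simp
    then show ?case using step \<phi>nz[of n] by simp
  qed
  have "t = 0"
  proof (rule ccontr)
    assume t: "t \<noteq> 0"
    have "eventually (\<lambda>n. \<bar>a (- int n)\<bar> < \<bar>t\<bar> * c) sequentially"
      using lim(3) t \<phi>c(1) by (intro order_tendstoD(2)[of _ 0]) (auto intro: tendsto_rabs_zero)
    then obtain n1 where n1: "\<And>n. n \<ge> n1 \<Longrightarrow> \<bar>a (- int n)\<bar> < \<bar>t\<bar> * c"
      by (auto simp: eventually_sequentially)
    define n where "n = max M n1"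
    have "\<bar>t\<bar> * c \<le> \<bar>a (- int n)\<bar>"
      using at[of n] \<phi>c(2)[of n] by (simp add: n_def abs_mult mult_left_mono)
    then show False using n1[of n] by (simp add: n_def)
  qed
  then have z: "a (- int n) = 0" if "n \<ge> M" for n using at[OF that] by simp
  have up: "a (- int M - 1 + int n) = 0 \<and> a (- int M + int n) = 0" for n
  proof (induction n)
    case 0
    have "- int M - 1 = - int (Suc M)" by simp
    then show ?case using z[of M] z[of "Suc M"] by (simp only: of_nat_0 add_0_right)
  next
    case (Suc n)
    then show ?case
      using a[of "- int M + int n"] A(1)[of "- int M + int n"] by (simp add: algebra_simps)
  qed
  show ?thesis
  proof (cases "k \<ge> - int M")
    case True
    then show ?thesis using up[of "nat (k + int M)"] by simp
  next
    case False
    then show ?thesis using z[of "nat (- k)"] by simp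
  qed
qed

context unit_q begin

section \<open>The Jacobi recurrence and its series solution\<close>

definition jac_off :: "real \<Rightarrow> real \<Rightarrow> int \<Rightarrow> int \<Rightarrow> real" where
  "jac_off \<epsilon> \<eta> s k = sqrt ((1 + \<epsilon> * q powi (2 * k)) * (1 + \<eta> * q powi (2 * (s + k))))"

definition jac_diag :: "real \<Rightarrow> real \<Rightarrow> int \<Rightarrow> int \<Rightarrow> int \<Rightarrow> real" where
  "jac_diag \<epsilon> \<eta> s m k = q powi (2 * k) * q powi s / q * (\<eta> * q powi m + \<epsilon> / q powi m)"

text \<open>Says that both labels, eps q^k and eta q^(s+k), lie in I_q: a negative label needs an
  exponent of at least 1.\<close>

definition in_range :: "real \<Rightarrow> real \<Rightarrow> int \<Rightarrow> int \<Rightarrow> bool" where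
  "in_range \<epsilon> \<eta> s k \<longleftrightarrow> (\<epsilon> = 1 \<or> k \<ge> 1) \<and> (\<eta> = 1 \<or> s + k \<ge> 1)"

definition jacobi_sol :: "real \<Rightarrow> real \<Rightarrow> int \<Rightarrow> int \<Rightarrow> real \<Rightarrow> (int \<Rightarrow> real) \<Rightarrow> bool" where
  "jacobi_sol \<epsilon> \<eta> s m X a \<longleftrightarrow> (\<forall>k. \<not> in_range \<epsilon> \<eta> s k \<longrightarrow> a k = 0) \<and>
     (\<forall>k. in_range \<epsilon> \<eta> s k \<longrightarrow> jac_off \<epsilon> \<eta> s k * a (k + 1) + jac_off \<epsilon> \<eta> s (k - 1) * a (k - 1) = (jac_diag \<epsilon> \<eta> s m k - X) * a k)"

text \<open>Conjugation by this factor removes the square roots from the Jacobi recurrence. By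
  \<open>x / 0 = 0\<close> it vanishes outside \<open>in_range\<close> also where the denominator does.\<close>

definition gauge :: "real \<Rightarrow> real \<Rightarrow> int \<Rightarrow> int \<Rightarrow> real" where
  "gauge \<epsilon> \<eta> s k = sqrt (qpoch_inf (- (\<eta> * q powi (2 * (s + k)))) / qpoch_inf (- (\<epsilon> * q powi (2 * k))))"

text \<open>In these cases the left end of the range, if there is one, is k = 1 - s and is due to
  eta, while 1 + eps q^(2k) is positive on the range, so the gauge factor makes sense there. The
  remaining sign patterns are reached by exchanging the two labels.\<close>

definition left_reg :: "real \<Rightarrow> real \<Rightarrow> int \<Rightarrow> bool" where
  "left_reg \<epsilon> \<eta> s \<longleftrightarrow> \<epsilon> \<in> {-1, 1} \<and> \<eta> \<in> {-1, 1} \<and> (\<epsilon> = 1 \<or> \<eta> = -1 \<and> s \<le> 0)"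

lemma powi_double_Suc: "q powi (2 * (k + 1)) = q powi (2 * k) * q\<^sup>2"
  by (simp add: powi_expand power2_eq_square field_simps)

lemma qpoch_inf_powi_step: "qpoch_inf (- (x * q powi (2 * k))) = (1 + x * q powi (2 * k)) * qpoch_inf (- (x * q powi (2 * (k + 1))))"
  using qpoch_inf_step[of "- (x * q powi (2 * k))"] unfolding powi_double_Suc by (simp add: mult.assoc)

lemma one_plus_sign_pos:
  assumes "x \<in> {-1, 1}" "x = 1 \<or> k \<ge> 1"
  shows "1 + x * q powi (2 * k) > 0"
  using assms powi_less_1_iff[of "2 * k"] powi_pos[of "2 * k"] by (auto simp: add_pos_pos)

lemma sqrt_sq_mult: "p > 0 \<Longrightarrow> sqrt (p\<^sup>2 * x) = p * sqrt x"
  by (simp add: real_sqrt_mult)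

text \<open>By the one-step rule of the infinite products, the radicand of the left side is a
  perfect square times that of \<open>gauge\<close> at k. Together with \<open>gauge_down\<close>
  this turns the Jacobi recurrence into one whose coefficients are polynomials in y =
  q^(2k).\<close>

lemma gauge_up:
  assumes "left_reg \<epsilon> \<eta> s" "in_range \<epsilon> \<eta> s k"
  shows "jac_off \<epsilon> \<eta> s k * gauge \<epsilon> \<eta> s (k + 1) = (1 + \<epsilon> * q powi (2 * k)) * gauge \<epsilon> \<eta> s k"
proof -
  have p: "1 + \<epsilon> * q powi (2 * k) > 0"
    using assms by (intro one_plus_sign_pos) (auto simp: left_reg_def in_range_def)
  define u v where "u = qpoch_inf (- (\<eta> * q powi (2 * (s + k + 1))))" and "v = qpoch_inf (- (\<epsilon> * q powi (2 * (k + 1))))"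
  have s: "qpoch_inf (- (\<eta> * q powi (2 * (s + k)))) = (1 + \<eta> * q powi (2 * (s + k))) * u"
    "qpoch_inf (- (\<epsilon> * q powi (2 * k))) = (1 + \<epsilon> * q powi (2 * k)) * v"
    using qpoch_inf_powi_step[of \<eta> "s + k"] qpoch_inf_powi_step[of \<epsilon> k] by (simp_all add: u_def v_def add.assoc)
  have "jac_off \<epsilon> \<eta> s k * gauge \<epsilon> \<eta> s (k + 1) = sqrt ((1 + \<epsilon> * q powi (2 * k)) * (1 + \<eta> * q powi (2 * (s + k))) * (u / v))"
    by (simp only: jac_off_def gauge_def u_def v_def real_sqrt_mult add.assoc)
  also have "(1 + \<epsilon> * q powi (2 * k)) * (1 + \<eta> * q powi (2 * (s + k))) * (u / v)
     = (1 + \<epsilon> * q powi (2 * k))\<^sup>2 * (((1 + \<eta> * q powi (2 * (s + k))) * u) / ((1 + \<epsilon> * q powi (2 * k)) * v))"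
    using p by (simp add: power2_eq_square)
  finally show ?thesis
    unfolding sqrt_sq_mult[OF p] gauge_def s .
qed

lemma gauge_down:
  assumes "left_reg \<epsilon> \<eta> s" "in_range \<epsilon> \<eta> s k"
  shows "jac_off \<epsilon> \<eta> s (k - 1) * gauge \<epsilon> \<eta> s (k - 1) = (1 + \<eta> * q powi (2 * (s + k - 1))) * gauge \<epsilon> \<eta> s k"
proof (cases "\<eta> = -1 \<and> k = 1 - s")
  \<comment> \<open>Left end of the range: jac_off at k - 1 and the factor 1 + eta q^(2(s+k-1)) are
    both 0, so nothing has to be known about the gauge factor outside.\<close>
  case True
  then show ?thesis by (simp add: jac_off_def)
next
  case False
  then have p: "1 + \<epsilon> * q powi (2 * (k - 1)) > 0" "1 + \<eta> * q powi (2 * (s + k - 1)) > 0"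
    using assms one_plus_sign_pos[of \<epsilon> "k - 1"] one_plus_sign_pos[of \<eta> "s + k - 1"]
    unfolding left_reg_def in_range_def by fastforce+
  define u v where "u = qpoch_inf (- (\<eta> * q powi (2 * (s + k))))" and "v = qpoch_inf (- (\<epsilon> * q powi (2 * k)))"
  have s: "qpoch_inf (- (\<eta> * q powi (2 * (s + (k - 1))))) = (1 + \<eta> * q powi (2 * (s + k - 1))) * u"
    "qpoch_inf (- (\<epsilon> * q powi (2 * (k - 1)))) = (1 + \<epsilon> * q powi (2 * (k - 1))) * v"
    using qpoch_inf_powi_step[of \<eta> "s + k - 1"] qpoch_inf_powi_step[of \<epsilon> "k - 1"] by (simp_all add: u_def v_def add_diff_eq)
  have "jac_off \<epsilon> \<eta> s (k - 1) * gauge \<epsilon> \<eta> s (k - 1) = sqrt ((1 + \<epsilon> * q powi (2 * (k - 1))) * (1 + \<eta> * q powi (2 * (s + k - 1))) *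
      (((1 + \<eta> * q powi (2 * (s + k - 1))) * u) / ((1 + \<epsilon> * q powi (2 * (k - 1))) * v)))"
    unfolding gauge_def s unfolding jac_off_def real_sqrt_mult[symmetric] add_diff_eq ..
  also have "(1 + \<epsilon> * q powi (2 * (k - 1))) * (1 + \<eta> * q powi (2 * (s + k - 1))) *
      (((1 + \<eta> * q powi (2 * (s + k - 1))) * u) / ((1 + \<epsilon> * q powi (2 * (k - 1))) * v))
     = (1 + \<eta> * q powi (2 * (s + k - 1)))\<^sup>2 * (u / v)"
    using p by (simp add: power2_eq_square)
  finally show ?thesis
    unfolding sqrt_sq_mult[OF p(2)] by (simp only: gauge_def u_def v_def)
qed

text \<open>The power of -1/L is the decaying solution of the limiting recurrence a(k+1) + a(k-1) =
  -(L + 1/L) a(k) for k -> +infinity; \<open>F\<close> corrects it.\<close>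

definition phi :: "real \<Rightarrow> real \<Rightarrow> int \<Rightarrow> (real \<Rightarrow> real) \<Rightarrow> real \<Rightarrow> int \<Rightarrow> real" where
  "phi \<epsilon> \<eta> s F L k = gauge \<epsilon> \<eta> s k * (- 1 / L) powi k * F (q powi (2 * k))"

lemma phi_psum_rec:
  assumes "left_reg \<epsilon> \<eta> s" "in_range \<epsilon> \<eta> s k" "\<bar>L\<bar> > 1"
  shows "jac_off \<epsilon> \<eta> s k * phi \<epsilon> \<eta> s (ser_partial \<epsilon> \<eta> s m L N) L (k + 1)
       + jac_off \<epsilon> \<eta> s (k - 1) * phi \<epsilon> \<eta> s (ser_partial \<epsilon> \<eta> s m L N) L (k - 1)
       - (jac_diag \<epsilon> \<eta> s m k - (L + 1 / L)) * phi \<epsilon> \<eta> s (ser_partial \<epsilon> \<eta> s m L N) L k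
     = - (gauge \<epsilon> \<eta> s k * (- 1 / L) powi k * (ser_coeff \<epsilon> \<eta> s m L N * ser_bracket \<epsilon> \<eta> s m L N * (q powi (2 * k)) ^ Suc N))"
proof -
  define y where "y = q powi (2 * k)"
  have sq: "\<epsilon>\<^sup>2 = 1" "\<eta>\<^sup>2 = 1" using assms(1) by (auto simp: left_reg_def)
  have L: "L \<noteq> 0" "- 1 / L \<noteq> 0" using assms(3) by auto
  have y1: "q powi (2 * (k + 1)) = y * q\<^sup>2" "q powi (2 * (k - 1)) = y / q\<^sup>2" "q powi (2 * (s + k - 1)) = (q powi s)\<^sup>2 * y / q\<^sup>2"
    unfolding y_def powi_expand by (simp_all add: power2_eq_square)
  have l: "(- 1 / L) powi (k + 1) = (- 1 / L) powi k * (- (1 / L))" "(- 1 / L) powi (k - 1) = (- 1 / L) powi k * (- L)"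
    using L by (simp_all add: power_int_add power_int_diff)
  have 1: "jac_off \<epsilon> \<eta> s k * phi \<epsilon> \<eta> s F L (k + 1) = gauge \<epsilon> \<eta> s k * (- 1 / L) powi k * (- (1 / L) * (1 + \<epsilon> * y) * F (y * q\<^sup>2))" for F
  proof -
    have "jac_off \<epsilon> \<eta> s k * phi \<epsilon> \<eta> s F L (k + 1) = (jac_off \<epsilon> \<eta> s k * gauge \<epsilon> \<eta> s (k + 1)) * (- 1 / L) powi (k + 1) * F (q powi (2 * (k + 1)))"
      by (simp only: phi_def mult_ac)
    then show ?thesis unfolding gauge_up[OF assms(1,2)] y1 l y_def[symmetric] by (simp only: mult_ac)
  qed
  have 2: "jac_off \<epsilon> \<eta> s (k - 1) * phi \<epsilon> \<eta> s F L (k - 1) = gauge \<epsilon> \<eta> s k * (- 1 / L) powi k * (- L * (1 + \<eta> * (q powi s)\<^sup>2 * y / q\<^sup>2) * F (y / q\<^sup>2))" for F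
  proof -
    have "jac_off \<epsilon> \<eta> s (k - 1) * phi \<epsilon> \<eta> s F L (k - 1) = (jac_off \<epsilon> \<eta> s (k - 1) * gauge \<epsilon> \<eta> s (k - 1)) * (- 1 / L) powi (k - 1) * F (q powi (2 * (k - 1)))"
      by (simp only: phi_def mult_ac)
    then show ?thesis unfolding gauge_down[OF assms(1,2)] y1 l by (simp add: mult_ac)
  qed
  have D: "jac_diag \<epsilon> \<eta> s m k - (L + 1 / L) = y * q powi s / q * (\<eta> * q powi m + \<epsilon> / q powi m) - L - 1 / L"
    by (simp add: jac_diag_def y_def)
  have "c * x1 + c * x2 - d * (c * x3) = c * (x1 + x2 - d * x3)" for c x1 x2 x3 d :: real
    by (simp add: algebra_simps)
  then have gen: "gauge \<epsilon> \<eta> s k * (- 1 / L) powi k * x1 + gauge \<epsilon> \<eta> s k * (- 1 / L) powi k * x2 - d * (gauge \<epsilon> \<eta> s k * (- 1 / L) powi k * x3)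
      = gauge \<epsilon> \<eta> s k * (- 1 / L) powi k * (x1 + x2 - d * x3)" for x1 x2 x3 d :: real .
  have base: "- (1 / L) * (1 + \<epsilon> * y) * ser_partial \<epsilon> \<eta> s m L N (y * q\<^sup>2)
      + - L * (1 + \<eta> * (q powi s)\<^sup>2 * y / q\<^sup>2) * ser_partial \<epsilon> \<eta> s m L N (y / q\<^sup>2)
      - (y * q powi s / q * (\<eta> * q powi m + \<epsilon> / q powi m) - L - 1 / L) * ser_partial \<epsilon> \<eta> s m L N y
    = - (ser_coeff \<epsilon> \<eta> s m L N * ser_bracket \<epsilon> \<eta> s m L N * y ^ Suc N)"
    using ser_partial_rec[OF sq assms(3), of y s m N] by simp
  show ?thesis
    unfolding 1 2 D unfolding phi_def y_def[symmetric] gen base by (rule mult_minus_right)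
qed

text \<open>Stronger than square-summability on purpose: the coefficients of E grow at most like
  q^(-|k|), so this rate keeps their products with the solution bounded, as the cutoff argument
  requires.\<close>

definition decays :: "(int \<Rightarrow> real) \<Rightarrow> bool" where
  "decays a \<longleftrightarrow> (\<exists>C. \<forall>k. \<bar>a k\<bar> \<le> C * q powi \<bar>k\<bar>)"

lemma decaysI:
  assumes "Bseq (\<lambda>n. a (int n) / q ^ n)" "Bseq (\<lambda>n. a (- int n) / q ^ n)"
  shows "decays a"
proof -
  obtain C D where C: "\<And>n. \<bar>a (int n) / q ^ n\<bar> \<le> C" and D: "\<And>n. \<bar>a (- int n) / q ^ n\<bar> \<le> D"
    using assms by (auto simp: Bseq_def)
  have "\<bar>a k\<bar> \<le> max C D * q powi \<bar>k\<bar>" for k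
  proof (cases "k \<ge> 0")
    case True
    then have "\<bar>a k\<bar> / q powi \<bar>k\<bar> \<le> C"
      using C[of "nat k"] q_pos power_int_of_nat[of q "nat k"] by (simp add: abs_divide power_abs)
    then show ?thesis by (simp add: divide_le_eq le_max_iff_disj) (smt (verit) mult_right_mono powi_pos)
  next
    case False
    then have "\<bar>a k\<bar> / q powi \<bar>k\<bar> \<le> D"
      using D[of "nat (- k)"] q_pos power_int_of_nat[of q "nat (- k)"] by (simp add: abs_divide power_abs)
    then show ?thesis by (simp add: divide_le_eq le_max_iff_disj) (smt (verit) mult_right_mono powi_pos)
  qed
  then show ?thesis unfolding decays_def by blast
qed

section \<open>Limits at the right end and terminating solutions\<close>

lemma powi_shift: "q powi (2 * (c + int n)) = q powi (2 * c) * q ^ (2 * n)"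
  using powi_add[of "2 * c" "2 * int n"] powi_of_nat[of n] by (simp add: distrib_left)

lemma q_power_tendsto_0: "(\<lambda>n. x * q ^ (2 * n)) \<longlonglongrightarrow> 0"
proof -
  have "(\<lambda>n. (q\<^sup>2) ^ n) \<longlonglongrightarrow> 0"
    using q_sq_less_1 by (intro LIMSEQ_power_zero) simp
  then show ?thesis unfolding power_mult by (rule tendsto_mult_right_zero)
qed

lemma gauge_tendsto_1: "(\<lambda>n. gauge \<epsilon> \<eta> s (k0 + int n)) \<longlonglongrightarrow> 1"
proof -
  have "(\<lambda>n. sqrt (qpoch_inf (- (\<eta> * q powi (2 * (s + k0))) * q ^ (2 * n)) / qpoch_inf (- (\<epsilon> * q powi (2 * k0)) * q ^ (2 * n)))) \<longlonglongrightarrow> sqrt (1 / 1)"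
    by (intro tendsto_intros qpoch_inf_tendsto_1) simp
  then show ?thesis
    unfolding gauge_def add.assoc[symmetric] powi_shift by (simp add: mult.assoc)
qed

lemma jac_off_tendsto_1: "(\<lambda>n. jac_off \<epsilon> \<eta> s (k0 + int n)) \<longlonglongrightarrow> 1"
proof -
  have "(\<lambda>n. sqrt ((1 + (\<epsilon> * q powi (2 * k0)) * q ^ (2 * n)) * (1 + (\<eta> * q powi (2 * (s + k0))) * q ^ (2 * n)))) \<longlonglongrightarrow> sqrt ((1 + 0) * (1 + 0))"
    by (intro tendsto_intros q_power_tendsto_0)
  then show ?thesis
    unfolding jac_off_def add.assoc[symmetric] powi_shift by (simp add: mult.assoc)
qed

lemma jac_off_pos: "\<epsilon> \<in> {-1, 1} \<Longrightarrow> \<eta> \<in> {-1, 1} \<Longrightarrow> in_range \<epsilon> \<eta> s k \<Longrightarrow> jac_off \<epsilon> \<eta> s k > 0"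
  unfolding jac_off_def in_range_def using one_plus_sign_pos[of \<epsilon> k] one_plus_sign_pos[of \<eta> "s + k"] by auto

text \<open>For s + k <= 0 and eta = -1 the numerator product contains the factor 1 - q^0. The
  boundary condition on the left is thus built into the gauge factor.\<close>

lemma gauge_outside:
  assumes "left_reg \<epsilon> \<eta> s" "\<not> in_range \<epsilon> \<eta> s k"
  shows "gauge \<epsilon> \<eta> s k = 0"
proof -
  have "\<eta> = -1" "s + k \<le> 0"
    using assms by (auto simp: left_reg_def in_range_def)
  then have "q powi (2 * (s + k)) * q powi (2 * int (nat (- (s + k)))) = 1"
    unfolding powi_add[symmetric] by simp
  then have "q powi (2 * (s + k)) * q ^ (2 * nat (- (s + k))) = 1"
    unfolding powi_of_nat .
  then have "qpoch_inf (- (\<eta> * q powi (2 * (s + k)))) = 0"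
    using \<open>\<eta> = -1\<close> by (auto simp: qpoch_inf_eq_0_iff)
  then show ?thesis by (simp add: gauge_def)
qed

lemma ser_partial_tendsto_1: "(\<lambda>n. ser_partial \<epsilon> \<eta> s m L N (q powi (2 * int n))) \<longlonglongrightarrow> 1"
proof -
  have "(\<lambda>n. ser_partial \<epsilon> \<eta> s m L N (1 * q ^ (2 * n))) \<longlonglongrightarrow> (\<Sum>i\<le>N. ser_coeff \<epsilon> \<eta> s m L i * 0 ^ i)"
    unfolding ser_partial_def by (intro tendsto_intros q_power_tendsto_0)
  also have "(\<Sum>i\<le>N. ser_coeff \<epsilon> \<eta> s m L i * 0 ^ i) = (\<Sum>i\<le>N. if i = 0 then 1 else 0)"
    by (intro sum.cong) auto
  finally show ?thesis unfolding powi_of_nat by simp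
qed

lemma phi_psum_right:
  assumes "\<bar>L\<bar> > 1"
  shows "(\<lambda>n. phi \<epsilon> \<eta> s (ser_partial \<epsilon> \<eta> s m L N) L (int n) * (- L) ^ n) \<longlonglongrightarrow> 1"
proof -
  have "(\<lambda>n. gauge \<epsilon> \<eta> s (0 + int n) * ser_partial \<epsilon> \<eta> s m L N (q powi (2 * int n))) \<longlonglongrightarrow> 1 * 1"
    by (intro tendsto_intros ser_partial_tendsto_1 gauge_tendsto_1)
  moreover have "phi \<epsilon> \<eta> s (ser_partial \<epsilon> \<eta> s m L N) L (int n) * (- L) ^ n = gauge \<epsilon> \<eta> s (0 + int n) * ser_partial \<epsilon> \<eta> s m L N (q powi (2 * int n))" for n
  proof -
    have "(- 1 / L) ^ n * (- L) ^ n = 1"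
      using assms by (subst power_mult_distrib[symmetric]) auto
    then have "gauge \<epsilon> \<eta> s (int n) * ((- 1 / L) ^ n * (- L) ^ n) * ser_partial \<epsilon> \<eta> s m L N (q powi (2 * int n)) = gauge \<epsilon> \<eta> s (int n) * ser_partial \<epsilon> \<eta> s m L N (q powi (2 * int n))"
      by simp
    then show ?thesis by (simp only: phi_def power_int_of_nat add_0 mult_ac)
  qed
  ultimately show ?thesis by simp
qed

text \<open>The hypothesis |L| q >= 1 says that L^(-n) decays at least as fast as q^n; it will hold
  because |L| = q^(-d) with d >= 1.\<close>

lemma Bseq_right:
  assumes "(\<lambda>n. a (int n) * (- L) ^ n) \<longlonglongrightarrow> c" "\<bar>L\<bar> * q \<ge> 1"
  shows "Bseq (\<lambda>n. a (int n) / q ^ n)"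
proof -
  have "Bseq (\<lambda>n. a (int n) * (- L) ^ n)"
    using assms(1) convergent_imp_Bseq convergent_def by blast
  then show ?thesis
  proof (rule Bseq_eventually_mono[rotated], intro always_eventually allI)
    fix n
    have "1 / q \<le> \<bar>L\<bar>" using assms(2) q_pos by (simp add: field_simps)
    then have "(1 / q) ^ n \<le> \<bar>L\<bar> ^ n" using q_pos by (intro power_mono) auto
    then have "\<bar>a (int n)\<bar> * (1 / q) ^ n \<le> \<bar>a (int n)\<bar> * \<bar>L\<bar> ^ n" by (intro mult_left_mono) auto
    then show "norm (a (int n) / q ^ n) \<le> norm (a (int n) * (- L) ^ n)"
      using q_pos by (simp add: abs_mult power_abs[symmetric] power_divide abs_divide)
  qed
qed

lemma terminating_solution:
  assumes "left_reg \<epsilon> \<eta> s" "\<bar>L\<bar> > 1" "ser_coeff \<epsilon> \<eta> s m L N = 0"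
  shows "jacobi_sol \<epsilon> \<eta> s m (L + 1 / L) (phi \<epsilon> \<eta> s (ser_partial \<epsilon> \<eta> s m L N) L)"
  unfolding jacobi_sol_def
proof (intro conjI allI impI)
  fix k
  show "phi \<epsilon> \<eta> s (ser_partial \<epsilon> \<eta> s m L N) L k = 0" if "\<not> in_range \<epsilon> \<eta> s k"
    using gauge_outside[OF assms(1) that] by (simp add: phi_def)
  show "jac_off \<epsilon> \<eta> s k * phi \<epsilon> \<eta> s (ser_partial \<epsilon> \<eta> s m L N) L (k + 1) + jac_off \<epsilon> \<eta> s (k - 1) * phi \<epsilon> \<eta> s (ser_partial \<epsilon> \<eta> s m L N) L (k - 1)
     = (jac_diag \<epsilon> \<eta> s m k - (L + 1 / L)) * phi \<epsilon> \<eta> s (ser_partial \<epsilon> \<eta> s m L N) L k" if "in_range \<epsilon> \<eta> s k"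
    using phi_psum_rec[OF assms(1) that assms(2), of m N] assms(3) by simp
qed

lemma phi_psum_nonzero:
  assumes "\<bar>L\<bar> > 1"
  shows "\<exists>k. phi \<epsilon> \<eta> s (ser_partial \<epsilon> \<eta> s m L N) L k \<noteq> 0"
proof (rule ccontr)
  assume "\<not> ?thesis"
  then have "(\<lambda>n. 0 :: real) \<longlonglongrightarrow> 1"
    using phi_psum_right[OF assms, of \<epsilon> \<eta> s m N] by simp
  then show False using LIMSEQ_const_iff[of "0::real" 1] by simp
qed

text \<open>Termination removes the remainder of the truncated recurrence, the gauge factor takes
  care of the boundary condition, and to the left of the range the sequence is identically 0, so
  only the decay on the right has to be estimated.\<close>

lemma half_line_existence:
  assumes "left_reg \<epsilon> (-1) s" "\<bar>L\<bar> > 1" "\<bar>L\<bar> * q \<ge> 1" "ser_coeff \<epsilon> (-1) s m L N = 0"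
  shows "\<exists>a k. jacobi_sol \<epsilon> (-1) s m (L + 1 / L) a \<and> decays a \<and> a k \<noteq> 0"
proof -
  define a where "a = phi \<epsilon> (-1) s (ser_partial \<epsilon> (-1) s m L N) L"
  have jacobi_sol: "jacobi_sol \<epsilon> (-1) s m (L + 1 / L) a"
    unfolding a_def by (rule terminating_solution[OF assms(1,2,4)])
  have "a (- int n) = 0" if "n \<ge> nat (- s)" "n \<ge> nat s" for n
    using jacobi_sol that by (auto simp: jacobi_sol_def in_range_def)
  then have "eventually (\<lambda>n. a (- int n) / q ^ n = 0) sequentially"
    unfolding eventually_sequentially by (intro exI[of _ "nat (- s) + nat s"]) auto
  then have "(\<lambda>n. a (- int n) / q ^ n) \<longlonglongrightarrow> 0"
    by (rule tendsto_eventually)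
  then have "decays a"
    using Bseq_right[OF phi_psum_right[OF assms(2)] assms(3)] convergent_imp_Bseq[OF convergentI]
    by (intro decaysI) (auto simp: a_def)
  then show ?thesis
    using jacobi_sol phi_psum_nonzero[OF assms(2)] unfolding a_def by blast
qed

section \<open>Half lines: no eigenvector unless the series terminates\<close>

definition ser_ratio :: "real \<Rightarrow> int \<Rightarrow> int \<Rightarrow> real \<Rightarrow> nat \<Rightarrow> real" where
  "ser_ratio \<epsilon> s m L n = qpoch (- (q * q powi m / (q powi s * L))) n * qpoch (\<epsilon> * q / (q powi s * q powi m * L)) n /
     (qpoch (q\<^sup>2) n * qpoch (q\<^sup>2 / L\<^sup>2) n)"

lemma ser_coeff_gf: "ser_coeff \<epsilon> (-1) s m L n = ((q powi s)\<^sup>2) ^ n * ser_ratio \<epsilon> s m L n"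
  by (simp add: ser_coeff_def ser_ratio_def)

lemma qpoch_inf_0_imp: "qpoch_inf x = 0 \<Longrightarrow> \<exists>n. qpoch x n = 0"
proof -
  assume "qpoch_inf x = 0"
  then obtain i where "x * q ^ (2 * i) = 1" by (auto simp: qpoch_inf_eq_0_iff)
  then have "qpoch x (Suc i) = 0" by (simp add: qpoch_Suc)
  then show ?thesis by blast
qed

lemma qpoch_inf_q2_pos: "\<bar>L\<bar> \<ge> 1 \<Longrightarrow> qpoch_inf (q\<^sup>2 / L\<^sup>2) > 0"
proof -
  assume L: "\<bar>L\<bar> \<ge> 1"
  then have "1 \<le> L\<^sup>2" by (metis abs_1 abs_le_square_iff one_power2)
  then have "q\<^sup>2 / L\<^sup>2 \<le> q\<^sup>2" by (simp add: divide_le_eq mult_left_mono)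
  then show ?thesis using q_sq_less_1 by (intro qpoch_inf_pos) linarith
qed

text \<open>For eta = -1 the coefficients are q^(2sn) times a convergent quotient of Pochhammer
  symbols. If no coefficient vanishes, the limit is nonzero and the radius of convergence in y is
  q^(-2s): every point q^(2k) of the range lies inside, and the point one step to the left of it
  lies on the circle.\<close>

lemma ser_ratio_tendsto:
  assumes "\<bar>L\<bar> > 1"
  obtains G where "ser_ratio \<epsilon> s m L \<longlonglongrightarrow> G" "(\<And>n. ser_coeff \<epsilon> (-1) s m L n \<noteq> 0) \<Longrightarrow> G \<noteq> 0"
proof -
  define x y where "x = - (q * q powi m / (q powi s * L))" and "y = \<epsilon> * q / (q powi s * q powi m * L)"
  have pos: "qpoch_inf (q\<^sup>2) > 0" "qpoch_inf (q\<^sup>2 / L\<^sup>2) > 0"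
    using qpoch_inf_q2_pos[of 1] qpoch_inf_q2_pos[of L] assms by auto
  have "(\<lambda>n. qpoch x n * qpoch y n / (qpoch (q\<^sup>2) n * qpoch (q\<^sup>2 / L\<^sup>2) n)) \<longlonglongrightarrow> qpoch_inf x * qpoch_inf y / (qpoch_inf (q\<^sup>2) * qpoch_inf (q\<^sup>2 / L\<^sup>2))"
    using pos by (intro tendsto_intros qpoch_tendsto) auto
  moreover have "ser_ratio \<epsilon> s m L = (\<lambda>n. qpoch x n * qpoch y n / (qpoch (q\<^sup>2) n * qpoch (q\<^sup>2 / L\<^sup>2) n))"
    by (auto simp: ser_ratio_def x_def y_def)
  moreover have "qpoch_inf x * qpoch_inf y / (qpoch_inf (q\<^sup>2) * qpoch_inf (q\<^sup>2 / L\<^sup>2)) \<noteq> 0" if "\<And>n. ser_coeff \<epsilon> (-1) s m L n \<noteq> 0"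
  proof -
    have "qpoch x n \<noteq> 0" "qpoch y n \<noteq> 0" for n
      using that[of n] by (auto simp: ser_coeff_gf ser_ratio_def x_def y_def)
    then show ?thesis using pos qpoch_inf_0_imp[of x] qpoch_inf_0_imp[of y] by auto
  qed
  ultimately show ?thesis using that by metis
qed

text \<open>The full series \<open>F\<close> decays and satisfies all interior equations, but misses
  the boundary equation at k0 = 1 - s by a nonzero constant. The coefficient towards k0 - 1 is 0,
  yet the remainder of the truncated recurrence does not tend to 0 there, because q^(2(k0-1)) is on
  the circle of convergence. The Wronskian comparison then excludes every decaying solution.\<close>

lemma half_line_nonexistence:
  assumes lr: "left_reg \<epsilon> (-1) s" and L: "\<bar>L\<bar> > 1" and nt: "\<And>n. ser_coeff \<epsilon> (-1) s m L n \<noteq> 0"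
    and jacobi_sol: "jacobi_sol \<epsilon> (-1) s m (L + 1 / L) a" and lim: "(\<lambda>n. a (int n)) \<longlonglongrightarrow> 0"
  shows "a k = 0"
proof -
  define k0 where "k0 = 1 - s"
  have \<epsilon>: "\<epsilon> \<in> {-1, 1}" using lr by (auto simp: left_reg_def)
  have in_range: "in_range \<epsilon> (-1) s (k0 + int n)" for n
    using lr by (auto simp: left_reg_def in_range_def k0_def)
  obtain G where G: "ser_ratio \<epsilon> s m L \<longlonglongrightarrow> G" "G \<noteq> 0"
    using ser_ratio_tendsto[OF L, of \<epsilon> s m] nt by metis
  define F where "F y = (\<Sum>n. ser_coeff \<epsilon> (-1) s m L n * y ^ n)" for y
  have summ: "summable (\<lambda>n. ser_coeff \<epsilon> (-1) s m L n * y ^ n)" if y: "\<bar>(q powi s)\<^sup>2 * y\<bar> < 1" for y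
  proof -
    obtain B where B: "\<And>n. \<bar>ser_ratio \<epsilon> s m L n\<bar> \<le> B"
      using convergent_imp_Bseq[OF convergentI[OF G(1)]] by (auto simp: Bseq_def)
    show ?thesis
    proof (rule summable_comparison_test')
      show "summable (\<lambda>n. B * \<bar>(q powi s)\<^sup>2 * y\<bar> ^ n)"
        using y by (intro summable_mult summable_geometric) simp
      show "norm (ser_coeff \<epsilon> (-1) s m L n * y ^ n) \<le> B * \<bar>(q powi s)\<^sup>2 * y\<bar> ^ n" for n
      proof -
        have "ser_coeff \<epsilon> (-1) s m L n * y ^ n = ser_ratio \<epsilon> s m L n * ((q powi s)\<^sup>2 * y) ^ n"
          by (simp add: ser_coeff_gf power_mult_distrib)
        then show ?thesis using B[of n] by (simp add: abs_mult power_abs mult_right_mono)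
      qed
    qed
  qed
  have t_eq: "(q powi s)\<^sup>2 * q powi (2 * k) = q powi (2 * (s + k))" for k
    by (simp add: powi_expand power_mult_distrib)
  have t_less: "\<bar>(q powi s)\<^sup>2 * q powi (2 * (k0 + int n))\<bar> < 1" for n
    unfolding t_eq abs_of_pos[OF powi_pos] powi_less_1_iff by (simp add: k0_def)
  have psF: "(\<lambda>N. ser_partial \<epsilon> (-1) s m L N (q powi (2 * (k0 + int n)))) \<longlonglongrightarrow> F (q powi (2 * (k0 + int n)))" for n
    unfolding ser_partial_def F_def using summable_LIMSEQ'[OF summ[OF t_less[of n]]] .
  have phF: "(\<lambda>N. phi \<epsilon> (-1) s (ser_partial \<epsilon> (-1) s m L N) L (k0 + int n)) \<longlonglongrightarrow> phi \<epsilon> (-1) s F L (k0 + int n)" for n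
    unfolding phi_def by (intro tendsto_intros psF)
  \<comment> \<open>Put t = q^(2s) y = q^(2n+2). The term of \<open>ser_bracket\<close> with q^(-2N)
    turns t^N into (t / q^2)^N = q^(2nN), which is 1 for n = 0 and tends to 0 otherwise. So only the
    first equation keeps a defect.\<close>
  have rem: "(\<lambda>N. ser_coeff \<epsilon> (-1) s m L N * ser_bracket \<epsilon> (-1) s m L N * (q powi (2 * (k0 + int n))) ^ Suc N)
      \<longlonglongrightarrow> (if n = 0 then - (G * q powi (2 * k0) * L * (q powi s)\<^sup>2 / q\<^sup>2) else 0)" for n
  proof -
    define y t where "y = q powi (2 * (k0 + int n))" and "t = q\<^sup>2 * q ^ (2 * n)"
    have ty: "(q powi s)\<^sup>2 * y = t"
      unfolding y_def t_eq t_def using powi_shift[of 1 n] by (simp add: k0_def)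
    have t1: "\<bar>t\<bar> < 1" using t_less[of n] unfolding y_def[symmetric] ty .
    have t2: "\<bar>q\<^sup>2 * t\<bar> < 1"
      using t1 q_sq_less_1 q_pos by (simp add: abs_mult mult_less_cancel_left1 ) (smt (verit) mult_left_le mult_mono zero_le_power2)
    have "(\<lambda>N. (t / q\<^sup>2) ^ N) \<longlonglongrightarrow> (if n = 0 then 1 else 0)"
    proof (cases "n = 0")
      case True
      then show ?thesis by (simp add: t_def)
    next
      case False
      have "q ^ (2 * n) < 1" using False q_pos q_less_1 by (simp add: power_less_one_iff)
      then show ?thesis using False q_pos by (auto simp: t_def intro!: LIMSEQ_power_zero)
    qed
    then have "(\<lambda>N. ser_ratio \<epsilon> s m L N * y * (\<epsilon> / L * (q\<^sup>2 * t) ^ N - L * (q powi s)\<^sup>2 / q\<^sup>2 * (t / q\<^sup>2) ^ N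
         + q powi s / q * (- (q powi m) + \<epsilon> / q powi m) * t ^ N))
      \<longlonglongrightarrow> G * y * (\<epsilon> / L * 0 - L * (q powi s)\<^sup>2 / q\<^sup>2 * (if n = 0 then 1 else 0)
         + q powi s / q * (- (q powi m) + \<epsilon> / q powi m) * 0)"
      using t1 t2 by (intro tendsto_intros G LIMSEQ_power_zero) auto
    moreover have "ser_coeff \<epsilon> (-1) s m L N * ser_bracket \<epsilon> (-1) s m L N * y ^ Suc N = ser_ratio \<epsilon> s m L N * y * (\<epsilon> / L * (q\<^sup>2 * t) ^ N - L * (q powi s)\<^sup>2 / q\<^sup>2 * (t / q\<^sup>2) ^ N
         + q powi s / q * (- (q powi m) + \<epsilon> / q powi m) * t ^ N)" for N
    proof -
      have "ser_coeff \<epsilon> (-1) s m L N * ser_bracket \<epsilon> (-1) s m L N * y ^ Suc N = ser_ratio \<epsilon> s m L N * y * (ser_bracket \<epsilon> (-1) s m L N * t ^ N)"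
        by (simp add: ser_coeff_gf ty[symmetric] power_mult_distrib)
      moreover have "ser_bracket \<epsilon> (-1) s m L N * t ^ N = \<epsilon> / L * (q\<^sup>2 * t) ^ N - L * (q powi s)\<^sup>2 / q\<^sup>2 * (t / q\<^sup>2) ^ N
         + q powi s / q * (- (q powi m) + \<epsilon> / q powi m) * t ^ N"
        unfolding ser_bracket_def power_mult by (simp add: power_mult_distrib power_divide algebra_simps)
      ultimately show ?thesis by simp
    qed
    ultimately have "(\<lambda>N. ser_coeff \<epsilon> (-1) s m L N * ser_bracket \<epsilon> (-1) s m L N * y ^ Suc N) \<longlonglongrightarrow>
        G * y * (\<epsilon> / L * 0 - L * (q powi s)\<^sup>2 / q\<^sup>2 * (if n = 0 then 1 else 0) + q powi s / q * (- (q powi m) + \<epsilon> / q powi m) * 0)"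
      by (simp only:)
    also have "G * y * (\<epsilon> / L * 0 - L * (q powi s)\<^sup>2 / q\<^sup>2 * (if n = 0 then 1 else 0) + q powi s / q * (- (q powi m) + \<epsilon> / q powi m) * 0)
      = (if n = 0 then - (G * q powi (2 * k0) * L * (q powi s)\<^sup>2 / q\<^sup>2) else 0)"
      by (simp add: y_def)
    finally show ?thesis unfolding y_def .
  qed
  define c where "c = gauge \<epsilon> (-1) s k0 * (- 1 / L) powi k0 * (G * q powi (2 * k0) * L * (q powi s)\<^sup>2 / q\<^sup>2)"
  have wpos: "gauge \<epsilon> (-1) s k0 \<noteq> 0"
  proof -
    have "q powi (2 * (s + k0)) < 1" by (subst powi_less_1_iff) (simp add: k0_def)
    moreover have "- (\<epsilon> * q powi (2 * k0)) < 1"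
      using one_plus_sign_pos[OF \<epsilon>, of k0] in_range[of 0] by (simp add: in_range_def)
    ultimately show ?thesis using qpoch_inf_pos unfolding gauge_def by (smt (verit) divide_eq_0_iff mult_minus_left real_sqrt_eq_zero_cancel_iff mult_1)
  qed
  have c: "c \<noteq> 0" using wpos L G by (auto simp: c_def)
  \<comment> \<open>For n = 0 the neighbour k0 - 1 is replaced by 0, since \<open>F\<close> need not
    converge there. For the partial sums the replacement is exact, as jac_off vanishes at k0 -
    1.\<close>
  have lim_eq: "jac_off \<epsilon> (-1) s (k0 + int n) * phi \<epsilon> (-1) s F L (k0 + int (Suc n))
     + (if n = 0 then 0 else jac_off \<epsilon> (-1) s (k0 + int (n - 1)) * phi \<epsilon> (-1) s F L (k0 + int (n - 1)))
     - (jac_diag \<epsilon> (-1) s m (k0 + int n) - (L + 1 / L)) * phi \<epsilon> (-1) s F L (k0 + int n) = (if n = 0 then c else 0)" for n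
  proof (rule LIMSEQ_unique)
    show "(\<lambda>N. jac_off \<epsilon> (-1) s (k0 + int n) * phi \<epsilon> (-1) s (ser_partial \<epsilon> (-1) s m L N) L (k0 + int (Suc n))
     + (if n = 0 then 0 else jac_off \<epsilon> (-1) s (k0 + int (n - 1)) * phi \<epsilon> (-1) s (ser_partial \<epsilon> (-1) s m L N) L (k0 + int (n - 1)))
     - (jac_diag \<epsilon> (-1) s m (k0 + int n) - (L + 1 / L)) * phi \<epsilon> (-1) s (ser_partial \<epsilon> (-1) s m L N) L (k0 + int n)) \<longlonglongrightarrow>
       jac_off \<epsilon> (-1) s (k0 + int n) * phi \<epsilon> (-1) s F L (k0 + int (Suc n))
     + (if n = 0 then 0 else jac_off \<epsilon> (-1) s (k0 + int (n - 1)) * phi \<epsilon> (-1) s F L (k0 + int (n - 1)))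
     - (jac_diag \<epsilon> (-1) s m (k0 + int n) - (L + 1 / L)) * phi \<epsilon> (-1) s F L (k0 + int n)"
      by (cases "n = 0") (simp_all only: if_True if_False simp_thms, (intro tendsto_intros phF)+)
    have eq: "jac_off \<epsilon> (-1) s (k0 + int n) * phi \<epsilon> (-1) s (ser_partial \<epsilon> (-1) s m L N) L (k0 + int (Suc n))
     + (if n = 0 then 0 else jac_off \<epsilon> (-1) s (k0 + int (n - 1)) * phi \<epsilon> (-1) s (ser_partial \<epsilon> (-1) s m L N) L (k0 + int (n - 1)))
     - (jac_diag \<epsilon> (-1) s m (k0 + int n) - (L + 1 / L)) * phi \<epsilon> (-1) s (ser_partial \<epsilon> (-1) s m L N) L (k0 + int n)
     = - (gauge \<epsilon> (-1) s (k0 + int n) * (- 1 / L) powi (k0 + int n) * (ser_coeff \<epsilon> (-1) s m L N * ser_bracket \<epsilon> (-1) s m L N * (q powi (2 * (k0 + int n))) ^ Suc N))" for N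
    proof -
      have 1: "k0 + int n + 1 = k0 + int (Suc n)" by simp
      have 2: "jac_off \<epsilon> (-1) s (k0 + int n - 1) * phi \<epsilon> (-1) s (ser_partial \<epsilon> (-1) s m L N) L (k0 + int n - 1) =
         (if n = 0 then 0 else jac_off \<epsilon> (-1) s (k0 + int (n - 1)) * phi \<epsilon> (-1) s (ser_partial \<epsilon> (-1) s m L N) L (k0 + int (n - 1)))"
      proof (cases "n = 0")
        case True
        then show ?thesis by (simp add: jac_off_def k0_def)
      next
        case False
        then have "k0 + int n - 1 = k0 + int (n - 1)" by simp
        then show ?thesis using False by (simp only: if_False)
      qed
      show ?thesis
        using phi_psum_rec[OF lr in_range[of n] L, of m N] unfolding 1 2 .
    qed
    have "(\<lambda>N. - (gauge \<epsilon> (-1) s (k0 + int n) * (- 1 / L) powi (k0 + int n) * (ser_coeff \<epsilon> (-1) s m L N * ser_bracket \<epsilon> (-1) s m L N * (q powi (2 * (k0 + int n))) ^ Suc N)))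
      \<longlonglongrightarrow> - (gauge \<epsilon> (-1) s (k0 + int n) * (- 1 / L) powi (k0 + int n) * (if n = 0 then - (G * q powi (2 * k0) * L * (q powi s)\<^sup>2 / q\<^sup>2) else 0))"
      by (intro tendsto_intros rem)
    also have "- (gauge \<epsilon> (-1) s (k0 + int n) * (- 1 / L) powi (k0 + int n) * (if n = 0 then - (G * q powi (2 * k0) * L * (q powi s)\<^sup>2 / q\<^sup>2) else 0)) = (if n = 0 then c else 0)"
      by (auto simp: c_def)
    finally show "(\<lambda>N. jac_off \<epsilon> (-1) s (k0 + int n) * phi \<epsilon> (-1) s (ser_partial \<epsilon> (-1) s m L N) L (k0 + int (Suc n))
     + (if n = 0 then 0 else jac_off \<epsilon> (-1) s (k0 + int (n - 1)) * phi \<epsilon> (-1) s (ser_partial \<epsilon> (-1) s m L N) L (k0 + int (n - 1)))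
     - (jac_diag \<epsilon> (-1) s m (k0 + int n) - (L + 1 / L)) * phi \<epsilon> (-1) s (ser_partial \<epsilon> (-1) s m L N) L (k0 + int n)) \<longlonglongrightarrow> (if n = 0 then c else 0)"
      unfolding eq .
  qed
  have F0: "(\<lambda>n. F (q powi (2 * (k0 + int n)))) \<longlonglongrightarrow> F 0"
  proof -
    have "isCont F 0"
      unfolding F_def[abs_def]
      using isCont_powser[OF summ[OF t_less[of 0]], of 0] by simp
    then show ?thesis
      by (rule isCont_tendsto_compose) (unfold powi_shift, rule q_power_tendsto_0)
  qed
  have "(\<lambda>n. gauge \<epsilon> (-1) s (k0 + int n) * ((- 1 / L) powi k0 * (- 1 / L) ^ n) * F (q powi (2 * (k0 + int n)))) \<longlonglongrightarrow> 1 * ((- 1 / L) powi k0 * 0) * F 0"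
    using L by (intro tendsto_intros gauge_tendsto_1 F0 LIMSEQ_power_zero) auto
  then have \<phi>0: "(\<lambda>n. phi \<epsilon> (-1) s F L (k0 + int n)) \<longlonglongrightarrow> 0"
    using L by (simp add: phi_def power_int_add)
  obtain B where B: "\<And>n. \<bar>jac_off \<epsilon> (-1) s (k0 + int n)\<bar> \<le> B"
    using convergent_imp_Bseq[OF convergentI[OF jac_off_tendsto_1]] by (auto simp: Bseq_def) blast
  have lim': "(\<lambda>n. a (k0 + int n)) \<longlonglongrightarrow> 0"
  proof (rule LIMSEQ_offset[of _ "nat s"])
    have "(\<lambda>n. a (int (n + nat (1 - s + int (nat s))))) \<longlonglongrightarrow> 0"
      using LIMSEQ_ignore_initial_segment[OF lim] by blast
    moreover have "int (n + nat (1 - s + int (nat s))) = k0 + int (n + nat s)" for n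
      by (simp add: k0_def)
    ultimately show "(\<lambda>n. a (k0 + int (n + nat s))) \<longlonglongrightarrow> 0"
      by (simp only:)
  qed
  have rec: "jac_off \<epsilon> (-1) s k * a (k + 1) + jac_off \<epsilon> (-1) s (k - 1) * a (k - 1) = (jac_diag \<epsilon> (-1) s m k - (L + 1 / L)) * a k" if "in_range \<epsilon> (-1) s k" for k
    using jacobi_sol that by (auto simp: jacobi_sol_def)
  have "a (k0 + int n) = 0" for n
  proof (rule half_line_uniqueness[where A = "\<lambda>n. jac_off \<epsilon> (-1) s (k0 + int n)" and E = "\<lambda>n. jac_diag \<epsilon> (-1) s m (k0 + int n) - (L + 1 / L)"
        and \<phi> = "\<lambda>n. phi \<epsilon> (-1) s F L (k0 + int n)" and a = "\<lambda>n. a (k0 + int n)" and B = B])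
    have "jac_off \<epsilon> (-1) s (k0 - 1) = 0" by (simp add: jac_off_def k0_def)
    then show "jac_off \<epsilon> (-1) s (k0 + int 0) * a (k0 + int 1) = (jac_diag \<epsilon> (-1) s m (k0 + int 0) - (L + 1 / L)) * a (k0 + int 0)"
      using rec[OF in_range[of 0]] by simp
    show "jac_off \<epsilon> (-1) s (k0 + int (Suc n)) * a (k0 + int (Suc (Suc n))) + jac_off \<epsilon> (-1) s (k0 + int n) * a (k0 + int n)
       = (jac_diag \<epsilon> (-1) s m (k0 + int (Suc n)) - (L + 1 / L)) * a (k0 + int (Suc n))" for n
      using rec[OF in_range[of "Suc n"]] by (simp add: algebra_simps)
    show "jac_off \<epsilon> (-1) s (k0 + int 0) * phi \<epsilon> (-1) s F L (k0 + int 1) \<noteq> (jac_diag \<epsilon> (-1) s m (k0 + int 0) - (L + 1 / L)) * phi \<epsilon> (-1) s F L (k0 + int 0)"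
      using lim_eq[of 0] c by simp
    show "jac_off \<epsilon> (-1) s (k0 + int (Suc n)) * phi \<epsilon> (-1) s F L (k0 + int (Suc (Suc n))) + jac_off \<epsilon> (-1) s (k0 + int n) * phi \<epsilon> (-1) s F L (k0 + int n)
       = (jac_diag \<epsilon> (-1) s m (k0 + int (Suc n)) - (L + 1 / L)) * phi \<epsilon> (-1) s F L (k0 + int (Suc n))" for n
      using lim_eq[of "Suc n"] by simp
    show "jac_off \<epsilon> (-1) s (k0 + int n) \<noteq> 0" for n
      using jac_off_pos[OF \<epsilon> _ in_range[of n]] by simp
  qed (use B lim' \<phi>0 in auto)
  from this[of "nat (k - k0)"] show ?thesis
    using jacobi_sol by (cases "k \<ge> k0") (auto simp: jacobi_sol_def in_range_def k0_def)
qed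

text \<open>Exchange of the two labels: now eta q^(s+k) is the one that is numbered, so k moves by
  s. The numbers s and m, and hence s - m = a, change sign; p turns into 1/p.\<close>

lemma jacobi_sol_flip:
  assumes "jacobi_sol \<epsilon> \<eta> s m X a"
  shows "jacobi_sol \<eta> \<epsilon> (- s) (- m) X (\<lambda>k. a (k - s))"
proof -
  have A: "jac_off \<eta> \<epsilon> (- s) k = jac_off \<epsilon> \<eta> s (k - s)" for k
    by (simp add: jac_off_def mult.commute)
  have D: "jac_diag \<eta> \<epsilon> (- s) (- m) k = jac_diag \<epsilon> \<eta> s m (k - s)" for k
    unfolding jac_diag_def powi_expand by (simp add: field_simps power2_eq_square)
  have R: "in_range \<eta> \<epsilon> (- s) k \<longleftrightarrow> in_range \<epsilon> \<eta> s (k - s)" for k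
    by (auto simp: in_range_def)
  show ?thesis
    using assms unfolding jacobi_sol_def A D R by (auto simp: algebra_simps)
qed

text \<open>For eps = eta = 1 the number m enters only through q^m + q^(-m).\<close>

lemma jacobi_sol_minus_m: "jacobi_sol 1 1 s m X a \<Longrightarrow> jacobi_sol 1 1 s (- m) X a"
  by (simp add: jacobi_sol_def jac_diag_def powi_uminus add.commute)

lemma decays_shift:
  assumes "decays a"
  shows "decays (\<lambda>k. a (k - s))"
proof -
  obtain C where C: "\<And>k. \<bar>a k\<bar> \<le> C * q powi \<bar>k\<bar>" using assms by (auto simp: decays_def)
  have C0: "C \<ge> 0" using C[of 0] by simp
  have "\<bar>a (k - s)\<bar> \<le> (C * q powi (- \<bar>s\<bar>)) * q powi \<bar>k\<bar>" for k
  proof -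
    have "q powi \<bar>k - s\<bar> \<le> q powi (- \<bar>s\<bar> + \<bar>k\<bar>)" by (subst powi_le_iff) simp
    then have "C * q powi \<bar>k - s\<bar> \<le> C * (q powi (- \<bar>s\<bar>) * q powi \<bar>k\<bar>)"
      unfolding powi_add[symmetric] using C0 by (rule mult_left_mono)
    then show ?thesis using C[of "k - s"] by (simp add: mult.assoc)
  qed
  then show ?thesis unfolding decays_def by blast
qed

definition has_decaying_sol :: "real \<Rightarrow> real \<Rightarrow> int \<Rightarrow> int \<Rightarrow> real \<Rightarrow> bool" where
  "has_decaying_sol \<epsilon> \<eta> s m X \<longleftrightarrow> (\<exists>a k. jacobi_sol \<epsilon> \<eta> s m X a \<and> decays a \<and> a k \<noteq> 0)"

text \<open>Mere convergence to 0 at both ends is what every square-summable family provides, while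
  \<open>has_decaying_sol\<close> demands the rate of \<open>decays\<close>. The two properties are
  therefore not formal opposites; that one of them holds has to be shown case by case.\<close>

definition only_zero_sol :: "real \<Rightarrow> real \<Rightarrow> int \<Rightarrow> int \<Rightarrow> real \<Rightarrow> bool" where
  "only_zero_sol \<epsilon> \<eta> s m X \<longleftrightarrow> (\<forall>a. jacobi_sol \<epsilon> \<eta> s m X a \<longrightarrow> (\<lambda>n. a (int n)) \<longlonglongrightarrow> 0 \<longrightarrow> (\<lambda>n. a (- int n)) \<longlonglongrightarrow> 0 \<longrightarrow> (\<forall>k. a k = 0))"

lemma has_decaying_sol_flip: "has_decaying_sol \<eta> \<epsilon> (- s) (- m) X \<Longrightarrow> has_decaying_sol \<epsilon> \<eta> s m X"
  unfolding has_decaying_sol_def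
  using jacobi_sol_flip[of \<eta> \<epsilon> "- s" "- m" X] decays_shift[of _ "- s"]
  by (metis (no_types, lifting) add_diff_cancel_right' minus_minus)

lemma tendsto_int_shift:
  fixes a :: "int \<Rightarrow> real"
  assumes "(\<lambda>n. a (int n)) \<longlonglongrightarrow> 0" shows "(\<lambda>n. a (int n + c)) \<longlonglongrightarrow> 0"
proof (rule LIMSEQ_offset[of _ "nat (- c)"])
  have "(\<lambda>n. a (int (n + nat (int (nat (- c)) + c)))) \<longlonglongrightarrow> 0"
    using LIMSEQ_ignore_initial_segment[OF assms] by blast
  moreover have "int (n + nat (int (nat (- c)) + c)) = int (n + nat (- c)) + c" for n
    by simp
  ultimately show "(\<lambda>n. a (int (n + nat (- c)) + c)) \<longlonglongrightarrow> 0"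
    by (simp only:)
qed

lemma only_zero_sol_flip:
  assumes "only_zero_sol \<eta> \<epsilon> (- s) (- m) X"
  shows "only_zero_sol \<epsilon> \<eta> s m X"
  unfolding only_zero_sol_def
proof (intro allI impI)
  fix a k assume a: "jacobi_sol \<epsilon> \<eta> s m X a" "(\<lambda>n. a (int n)) \<longlonglongrightarrow> 0" "(\<lambda>n. a (- int n)) \<longlonglongrightarrow> 0"
  have "(\<lambda>n. a (int n - s)) \<longlonglongrightarrow> 0"
    using tendsto_int_shift[OF a(2), of "- s"] by simp
  moreover have "(\<lambda>n. a (- int n - s)) \<longlonglongrightarrow> 0"
    using tendsto_int_shift[of "\<lambda>k. a (- k)", OF a(3), of s] by simp
  ultimately have "a ((k + s) - s) = 0"
    using assms jacobi_sol_flip[OF a(1)] unfolding only_zero_sol_def by blast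
  then show "a k = 0" by simp
qed

section \<open>Asymptotics at the left end of the full line\<close>

lemma qpoch_left_asymp:
  "(\<lambda>n. qpoch (- (x * q powi (- 2 * int n))) u * q ^ (2 * n * u)) \<longlonglongrightarrow> (\<Prod>i<u. x * q ^ (2 * i))"
proof -
  have "qpoch (- (x * q powi (- 2 * int n))) u * q ^ (2 * n * u) = (\<Prod>i<u. 1 * q ^ (2 * n) + x * q ^ (2 * i))" for n
  proof -
    have 1: "q powi (- 2 * int n) * q ^ (2 * n) = 1"
      using powi_of_nat[of n] powi_uminus[of "2 * int n"] by simp
    have "(1 + x * q powi (- 2 * int n) * q ^ (2 * i)) * q ^ (2 * n) = 1 * q ^ (2 * n) + x * q ^ (2 * i)" for i
    proof -
      have "(1 + x * q powi (- 2 * int n) * q ^ (2 * i)) * q ^ (2 * n) = 1 * q ^ (2 * n) + x * q ^ (2 * i) * (q powi (- 2 * int n) * q ^ (2 * n))"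
        by (simp add: algebra_simps)
      then show ?thesis unfolding 1 by simp
    qed
    then have "(\<Prod>i<u. (1 + x * q powi (- 2 * int n) * q ^ (2 * i)) * q ^ (2 * n)) = (\<Prod>i<u. 1 * q ^ (2 * n) + x * q ^ (2 * i))"
      by (intro prod.cong) auto
    then show ?thesis
      unfolding qpoch_def power_mult[of q "2 * n" u] by (simp add: prod.distrib)
  qed
  moreover have "(\<lambda>n. \<Prod>i<u. 1 * q ^ (2 * n) + x * q ^ (2 * i)) \<longlonglongrightarrow> (\<Prod>i<u. 0 + x * q ^ (2 * i))"
    by (intro tendsto_intros q_power_tendsto_0)
  ultimately show ?thesis by simp
qed

text \<open>The arguments of the two infinite products differ by the factor q^(2s), so their
  quotient is a finite product of |s| factors or its inverse, according to the sign of s. Each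
  factor grows like q^(-2n), which gives the rate q^(sn) after the square root.\<close>

lemma gauge_left_asymp:
  obtains c where "c > 0" "(\<lambda>n. gauge 1 1 s (- int n) * q powi (- s * int n)) \<longlonglongrightarrow> c"
proof (cases "s \<ge> 0")
  case True
  define u where "u = nat s"
  define P where "P n = qpoch (- (1 * q powi (- 2 * int n))) u" for n
  have w: "gauge 1 1 s (- int n) * q powi (- s * int n) = sqrt (1 / (P n * q ^ (2 * n * u)))" for n
  proof -
    have "q powi (2 * (s - int n)) = q powi (- 2 * int n) * q ^ (2 * u)"
      using powi_shift[of "- int n" u] True by (simp add: u_def algebra_simps)
    then have e: "qpoch_inf (- (q powi (- 2 * int n))) = P n * qpoch_inf (- (q powi (2 * (s - int n))))"
      using qpoch_inf_split[of "- (q powi (- 2 * int n))" u] by (simp add: P_def)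
    have pos: "qpoch_inf (- (q powi (2 * (s - int n)))) > 0"
      by (rule qpoch_inf_pos) (use powi_pos[of "2 * (s - int n)"] in linarith)
    have "gauge 1 1 s (- int n) = sqrt (1 / P n)"
      unfolding gauge_def using e pos by (simp add: algebra_simps)
    moreover have "q powi (- s * int n) = sqrt (1 / q ^ (2 * n * u))"
    proof -
      have "q powi (- s * int n) = 1 / q ^ (n * u)"
        using True power_int_of_nat[of q "n * u"] by (simp add: u_def powi_uminus mult.commute)
      moreover have "q ^ (2 * n * u) = (q ^ (n * u))\<^sup>2"
        by (simp add: power_mult[symmetric] mult_ac)
      ultimately show ?thesis using q_pos by (simp add: real_sqrt_divide)
    qed
    ultimately show ?thesis by (simp add: real_sqrt_mult[symmetric])
  qed
  have "(\<lambda>n. sqrt (1 / (P n * q ^ (2 * n * u)))) \<longlonglongrightarrow> sqrt (1 / (\<Prod>i<u. 1 * q ^ (2 * i)))"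
    unfolding P_def by (intro tendsto_intros qpoch_left_asymp) auto
  then show ?thesis
    unfolding w[symmetric] using q_pos by (intro that) (auto intro: prod_pos)
next
  case False
  define u where "u = nat (- s)"
  define x where "x = q powi (2 * s)"
  define P where "P n = qpoch (- (x * q powi (- 2 * int n))) u" for n
  have w: "gauge 1 1 s (- int n) * q powi (- s * int n) = sqrt (P n * q ^ (2 * n * u))" for n
  proof -
    have x1: "q powi (2 * (s - int n)) = x * q powi (- 2 * int n)"
      using powi_add[of "2 * s" "- 2 * int n"] by (simp add: x_def algebra_simps)
    have F: "x * q powi (- 2 * int n) * q ^ (2 * u) = q powi (- 2 * int n)"
      using powi_shift[of "s - int n" u] False unfolding x1 by (simp add: u_def algebra_simps)
    have e: "qpoch_inf (- (q powi (2 * (s - int n)))) = P n * qpoch_inf (- (q powi (- 2 * int n)))"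
      unfolding x1 P_def using qpoch_inf_split[of "- (x * q powi (- 2 * int n))" u] by (simp only: mult_minus_left[of "x * q powi (- 2 * int n)"] F)
    have pos: "qpoch_inf (- (q powi (- 2 * int n))) > 0"
      by (rule qpoch_inf_pos) (use powi_pos[of "- 2 * int n"] in linarith)
    have "gauge 1 1 s (- int n) = sqrt (P n)"
      unfolding gauge_def using e pos by (simp add: algebra_simps)
    moreover have "q powi (- s * int n) = sqrt (q ^ (2 * n * u))"
    proof -
      have "q powi (- s * int n) = q ^ (n * u)"
        using False power_int_of_nat[of q "n * u"] by (simp add: u_def mult.commute)
      moreover have "q ^ (2 * n * u) = (q ^ (n * u))\<^sup>2"
        by (simp add: power_mult[symmetric] mult_ac)
      ultimately show ?thesis using q_pos by simp
    qed
    ultimately show ?thesis by (simp add: real_sqrt_mult[symmetric])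
  qed
  have "(\<lambda>n. sqrt (P n * q ^ (2 * n * u))) \<longlonglongrightarrow> sqrt (\<Prod>i<u. x * q ^ (2 * i))"
    unfolding P_def by (intro tendsto_intros qpoch_left_asymp)
  then show ?thesis
    unfolding w[symmetric] using q_pos by (intro that) (auto intro!: prod_pos simp: x_def)
qed

lemma ser_partial_left_asymp: "(\<lambda>n. ser_partial \<epsilon> \<eta> s m L N (q powi (- 2 * int n)) * q ^ (2 * n * N)) \<longlonglongrightarrow> ser_coeff \<epsilon> \<eta> s m L N"
proof -
  have "ser_partial \<epsilon> \<eta> s m L N (q powi (- 2 * int n)) * q ^ (2 * n * N) = (\<Sum>i\<le>N. ser_coeff \<epsilon> \<eta> s m L i * (1 * q ^ (2 * n)) ^ (N - i))" for n
  proof -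
    have 1: "q powi (- 2 * int n) * q ^ (2 * n) = 1"
      using powi_of_nat[of n] powi_uminus[of "2 * int n"] by simp
    have e: "(q powi (- 2 * int n)) ^ i * q ^ (2 * n * N) = (1 * q ^ (2 * n)) ^ (N - i)" if "i \<le> N" for i
    proof -
      have "q ^ (2 * n * N) = (q ^ (2 * n)) ^ i * (q ^ (2 * n)) ^ (N - i)"
        using that by (simp add: power_mult power_add[symmetric])
      then have "(q powi (- 2 * int n)) ^ i * q ^ (2 * n * N) = (q powi (- 2 * int n) * q ^ (2 * n)) ^ i * (q ^ (2 * n)) ^ (N - i)"
        by (simp only: power_mult_distrib mult.assoc)
      then show ?thesis unfolding 1 by simp
    qed
    show ?thesis
      unfolding ser_partial_def sum_distrib_right by (intro sum.cong refl) (simp only: atMost_iff mult.assoc[of "ser_coeff _ _ _ _ _ _"] e)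
  qed
  moreover have "(\<lambda>n. \<Sum>i\<le>N. ser_coeff \<epsilon> \<eta> s m L i * (1 * q ^ (2 * n)) ^ (N - i)) \<longlonglongrightarrow> (\<Sum>i\<le>N. ser_coeff \<epsilon> \<eta> s m L i * 0 ^ (N - i))"
    by (intro tendsto_intros q_power_tendsto_0)
  moreover have "(\<Sum>i\<le>N. ser_coeff \<epsilon> \<eta> s m L i * 0 ^ (N - i)) = (\<Sum>i\<le>N. if i = N then ser_coeff \<epsilon> \<eta> s m L N else 0)"
    by (intro sum.cong) (auto simp: power_0_left)
  ultimately show ?thesis by simp
qed

text \<open>At k = -n three rates multiply: q^(sn) from the gauge factor, q^(-dn) from the power of
  -1/L = q^d, and q^(-2nN) from a polynomial of exact degree N at q^(-2n). The sign of d + 2N - s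
  therefore decides between decay and growth.\<close>

lemma phi_psum_left:
  assumes d: "d \<ge> 1" and c: "ser_coeff 1 1 s m (- (q powi (- d))) N \<noteq> 0"
  obtains c where "c \<noteq> 0" "(\<lambda>n. phi 1 1 s (ser_partial 1 1 s m (- (q powi (- d))) N) (- (q powi (- d))) (- int n) * q powi (int n * (d + 2 * int N - s))) \<longlonglongrightarrow> c"
proof -
  define L where "L = - (q powi (- d))"
  obtain c0 where c0: "c0 > 0" "(\<lambda>n. gauge 1 1 s (- int n) * q powi (- s * int n)) \<longlonglongrightarrow> c0"
    by (rule gauge_left_asymp)
  have "(\<lambda>n. (gauge 1 1 s (- int n) * q powi (- s * int n)) * (ser_partial 1 1 s m L N (q powi (- 2 * int n)) * q ^ (2 * n * N))) \<longlonglongrightarrow> c0 * ser_coeff 1 1 s m L N"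
    by (intro tendsto_intros ser_partial_left_asymp c0)
  moreover have "(gauge 1 1 s (- int n) * q powi (- s * int n)) * (ser_partial 1 1 s m L N (q powi (- 2 * int n)) * q ^ (2 * n * N))
     = phi 1 1 s (ser_partial 1 1 s m L N) L (- int n) * q powi (int n * (d + 2 * int N - s))" for n
  proof -
    have "- 1 / L = q powi d" by (simp add: L_def powi_uminus)
    then have 1: "(- 1 / L) powi (- int n) = q powi (- (d * int n))"
      by (simp add: power_int_mult[symmetric])
    have 2: "q ^ (2 * n * N) = q powi (2 * int n * int N)"
      using power_int_of_nat[of q "2 * n * N"] by simp
    have "q powi (int n * (d + 2 * int N - s)) = q powi (d * int n + (2 * int n * int N + - s * int n))"
      by (rule arg_cong[where f = "(powi) q"]) (simp add: algebra_simps)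
    then have 3: "q powi (int n * (d + 2 * int N - s)) = q powi (d * int n) * (q powi (2 * int n * int N) * q powi (- s * int n))"
      by (simp only: powi_add)
    have 4: "q powi (- (d * int n)) * q powi (d * int n) = 1"
      by (simp add: powi_uminus)
    have "phi 1 1 s (ser_partial 1 1 s m L N) L (- int n) * q powi (int n * (d + 2 * int N - s))
      = (q powi (- (d * int n)) * q powi (d * int n)) * (gauge 1 1 s (- int n) * q powi (- s * int n) * (ser_partial 1 1 s m L N (q powi (2 * - int n)) * q powi (2 * int n * int N)))"
      unfolding phi_def 1 3 by (simp only: mult_ac)
    then show ?thesis unfolding 4 2 by simp
  qed
  ultimately have "(\<lambda>n. phi 1 1 s (ser_partial 1 1 s m L N) L (- int n) * q powi (int n * (d + 2 * int N - s))) \<longlonglongrightarrow> c0 * ser_coeff 1 1 s m L N"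
    by simp
  then show ?thesis using c0(1) c unfolding L_def by (intro that[of "c0 * ser_coeff 1 1 s m (- (q powi (- d))) N"]) auto
qed

text \<open>Both numerator symbols have the form (-theta q^c; q^2)_n with theta = 1 or -1, so a
  factor vanishes only for theta = -1 and c = -2i. Termination is thus a sign condition, a parity
  condition and an inequality.\<close>

lemma ser_coeff_eq_0_iff:
  assumes "d \<ge> 1" "\<delta> \<in> {-1, 1}" "\<epsilon> \<in> {-1, 1}" "\<eta> \<in> {-1, 1}"
  shows "ser_coeff \<epsilon> \<eta> s m (\<delta> * q powi (- d)) n = 0 \<longleftrightarrow>
    (\<exists>i<n. \<delta> = -1 \<and> 1 + m - s + d + 2 * int i = 0 \<or> \<epsilon> * \<eta> * \<delta> = -1 \<and> 1 - m - s + d + 2 * int i = 0)"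
proof -
  define L where "L = \<delta> * q powi (- d)"
  have L: "\<bar>L\<bar> \<ge> 1"
    using assms(1,2) powi_le_iff[of 0 "- d"] by (auto simp: L_def abs_mult)
  have zero: "qpoch (- (\<theta> * q powi c)) n = 0 \<longleftrightarrow> (\<exists>i<n. \<theta> = -1 \<and> c + 2 * int i = 0)" if "\<theta> \<in> {-1, 1}" for \<theta> c
  proof -
    have "1 - - (\<theta> * q powi c) * q ^ (2 * i) = 0 \<longleftrightarrow> \<theta> = -1 \<and> c + 2 * int i = 0" for i
    proof -
      have "q powi c * q ^ (2 * i) = q powi (c + 2 * int i)"
        by (simp only: powi_add powi_of_nat)
      moreover have "q powi (c + 2 * int i) = 1 \<longleftrightarrow> c + 2 * int i = 0"
        using powi_eq_iff[of "c + 2 * int i" 0] by auto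
      moreover have "1 + q powi (c + 2 * int i) \<noteq> 0"
        using powi_pos[of "c + 2 * int i"] by linarith
      ultimately show ?thesis
        using that by (auto simp: mult.assoc)
    qed
    then show ?thesis unfolding qpoch_def by (auto simp: prod_zero_iff)
  qed
  have 1: "- (q * q powi m / (q powi s * L)) = - (\<delta> * q powi (1 + m - s + d))"
    using assms(2) by (auto simp: L_def powi_expand field_simps)
  have 2: "- (\<epsilon> * \<eta> * q / (q powi s * q powi m * L)) = - (\<epsilon> * \<eta> * \<delta> * q powi (1 - m - s + d))"
    using assms(2) by (auto simp: L_def powi_expand field_simps)
  have "\<epsilon> * \<eta> * \<delta> \<in> {-1, 1}" using assms by auto
  moreover have "- \<eta> * (q powi s)\<^sup>2 \<noteq> 0" using assms by auto
  ultimately show ?thesis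
    using qpoch_q2_nz'[of n] qpoch_q2_nz[OF L, of n] zero[OF assms(2), of "1 + m - s + d"] zero[of "\<epsilon> * \<eta> * \<delta>" "1 - m - s + d"]
    unfolding L_def[symmetric] ser_coeff_def 1 2 by auto
qed

lemma L_big: "d \<ge> 1 \<Longrightarrow> \<delta> \<in> {-1, 1} \<Longrightarrow> \<bar>\<delta> * q powi (- d)\<bar> > 1 \<and> \<bar>\<delta> * q powi (- d)\<bar> * q \<ge> 1"
proof -
  assume d: "d \<ge> 1" "\<delta> \<in> {-1, 1}"
  have "q powi (- d) > 1" using powi_less_iff[of 0 "- d"] d by simp
  moreover have "q powi (- d) * q \<ge> 1" using powi_le_iff[of 0 "- d + 1"] d powi_add[of "- d" 1] by simp
  ultimately show ?thesis using d(2) by (auto simp: abs_mult)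
qed

text \<open>The parity hypothesis makes 1 + m - s + d and 1 - m - s + d even, so a numerator symbol
  with the right sign has a zero as soon as its exponent is not positive.\<close>

lemma half_line_dichotomy:
  assumes lr: "left_reg \<epsilon> (-1) s" and d: "d \<ge> 1" and \<delta>: "\<delta> \<in> {-1, 1}" and par: "odd (s + m + d)"
  shows "(\<delta> = -1 \<and> s - m \<ge> d + 1) \<or> (\<epsilon> * \<delta> = 1 \<and> s + m \<ge> d + 1) \<Longrightarrow> has_decaying_sol \<epsilon> (-1) s m (\<delta> * q powi (- d) + 1 / (\<delta> * q powi (- d)))"
    and "\<not> ((\<delta> = -1 \<and> s - m \<ge> d + 1) \<or> (\<epsilon> * \<delta> = 1 \<and> s + m \<ge> d + 1)) \<Longrightarrow> only_zero_sol \<epsilon> (-1) s m (\<delta> * q powi (- d) + 1 / (\<delta> * q powi (- d)))"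
proof -
  define L where "L = \<delta> * q powi (- d)"
  have L: "\<bar>L\<bar> > 1" "\<bar>L\<bar> * q \<ge> 1" using L_big[OF d \<delta>] by (auto simp: L_def)
  have \<epsilon>: "\<epsilon> \<in> {-1, 1}" using lr by (auto simp: left_reg_def)
  have cf0: "ser_coeff \<epsilon> (-1) s m L n = 0 \<longleftrightarrow> (\<exists>i<n. \<delta> = -1 \<and> 1 + m - s + d + 2 * int i = 0 \<or> \<epsilon> * \<delta> = 1 \<and> 1 - m - s + d + 2 * int i = 0)" for n
    unfolding L_def by (subst ser_coeff_eq_0_iff[OF d \<delta> \<epsilon>]) auto
  {
    assume "(\<delta> = -1 \<and> s - m \<ge> d + 1) \<or> (\<epsilon> * \<delta> = 1 \<and> s + m \<ge> d + 1)"
    then have "\<exists>i. \<delta> = -1 \<and> 1 + m - s + d + 2 * int i = 0 \<or> \<epsilon> * \<delta> = 1 \<and> 1 - m - s + d + 2 * int i = 0"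
    proof (elim disjE conjE)
      assume a: "\<delta> = -1" "s - m \<ge> d + 1"
      have "even (s - m - d - 1)" using par by simp
      then have "1 + m - s + d + 2 * int (nat ((s - m - d - 1) div 2)) = 0" using a(2) by simp
      then show ?thesis using a by blast
    next
      assume a: "\<epsilon> * \<delta> = 1" "s + m \<ge> d + 1"
      have "even (s + m - d - 1)" using par by simp
      then have "1 - m - s + d + 2 * int (nat ((s + m - d - 1) div 2)) = 0" using a(2) by simp
      then show ?thesis using a by blast
    qed
    then obtain N where "ser_coeff \<epsilon> (-1) s m L N = 0" unfolding cf0 by blast
    then show "has_decaying_sol \<epsilon> (-1) s m (\<delta> * q powi (- d) + 1 / (\<delta> * q powi (- d)))"
      using half_line_existence[OF lr L] unfolding has_decaying_sol_def L_def by blast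
  next
    assume n: "\<not> ((\<delta> = -1 \<and> s - m \<ge> d + 1) \<or> (\<epsilon> * \<delta> = 1 \<and> s + m \<ge> d + 1))"
    have "ser_coeff \<epsilon> (-1) s m L N \<noteq> 0" for N
      unfolding cf0 using n by auto
    then show "only_zero_sol \<epsilon> (-1) s m (\<delta> * q powi (- d) + 1 / (\<delta> * q powi (- d)))"
      using half_line_nonexistence[OF lr L(1)] unfolding only_zero_sol_def L_def by blast
  }
qed

text \<open>For m >= 0 both numerator symbols vanish eventually and the earlier zero wins, so the
  degree is N = (s - m - d - 1) / 2. Then d + 2N - s = -m - 1, and the solution decays on the left
  like q^((m+1)n). Negative m follows from the symmetry in m.\<close>

lemma plus_plus_neg_existence:
  assumes d: "d \<ge> 1" and par: "odd (s + m + d)" and sm: "s \<ge> \<bar>m\<bar> + d + 1"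
  shows "has_decaying_sol 1 1 s m (- (q powi (- d)) + 1 / (- (q powi (- d))))"
proof -
  have main: "has_decaying_sol 1 1 s m (- (q powi (- d)) + 1 / (- (q powi (- d))))"
    if par: "odd (s + m + d)" and m: "m \<ge> 0" and sm: "s \<ge> m + d + 1" for m
  proof -
    define L where "L = - (q powi (- d))"
    have L: "\<bar>L\<bar> > 1" "\<bar>L\<bar> * q \<ge> 1" using L_big[OF d, of "-1"] by (auto simp: L_def)
    have cf0: "ser_coeff 1 1 s m L n = 0 \<longleftrightarrow> (\<exists>i<n. 1 + m - s + d + 2 * int i = 0 \<or> 1 - m - s + d + 2 * int i = 0)" for n
      using ser_coeff_eq_0_iff[OF d, of "-1" 1 1 s m n] by (simp add: L_def)
    define N where "N = nat ((s - m - d - 1) div 2)"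
    have "even (s - m - d - 1)" using par by simp
    then have N: "2 * int N = s - m - d - 1" using sm by (simp add: N_def)
    have z: "ser_coeff 1 1 s m L (Suc N) = 0" unfolding cf0 using N by (intro exI[of _ N]) auto
    have nz: "ser_coeff 1 1 s m L N \<noteq> 0" unfolding cf0 using N m by auto
    have ps: "ser_partial 1 1 s m L (Suc N) = ser_partial 1 1 s m L N" using z by (simp add: ser_partial_def fun_eq_iff)
    define a where "a = phi 1 1 s (ser_partial 1 1 s m L N) L"
    have "left_reg 1 1 s" by (simp add: left_reg_def)
    then have jacobi_sol: "jacobi_sol 1 1 s m (L + 1 / L) a"
      using terminating_solution[OF _ L(1) z] unfolding a_def ps by simp
    obtain c where "(\<lambda>n. phi 1 1 s (ser_partial 1 1 s m (- (q powi (- d))) N) (- (q powi (- d))) (- int n) * q powi (int n * (d + 2 * int N - s))) \<longlonglongrightarrow> c"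
      by (rule phi_psum_left[OF d nz[unfolded L_def]])
    note c = this[folded L_def, folded a_def]
    have "Bseq (\<lambda>n. a (- int n) / q ^ n)"
    proof (rule Bseq_eventually_mono[OF always_eventually convergent_imp_Bseq[OF convergentI[OF c]]], intro allI)
      fix n
      have "1 / q ^ n \<le> q powi (int n * (d + 2 * int N - s))"
      proof -
        have "int n * (d + 2 * int N - s) \<le> int n * (-1)" using N m by (intro mult_left_mono) auto
        then have "q powi (- int n) \<le> q powi (int n * (d + 2 * int N - s))" by (simp add: powi_le_iff)
        then show ?thesis by (simp add: powi_uminus)
      qed
      then have "\<bar>a (- int n)\<bar> * (1 / q ^ n) \<le> \<bar>a (- int n)\<bar> * q powi (int n * (d + 2 * int N - s))"
        by (rule mult_left_mono) simp
      then show "norm (a (- int n) / q ^ n) \<le> norm (a (- int n) * q powi (int n * (d + 2 * int N - s)))"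
        using q_pos by (simp add: abs_mult abs_divide)
    qed
    then have "decays a"
      using Bseq_right[OF phi_psum_right[OF L(1)] L(2)] by (intro decaysI) (auto simp: a_def)
    then show ?thesis
      using jacobi_sol phi_psum_nonzero[OF L(1)] unfolding a_def has_decaying_sol_def L_def by blast
  qed
  show ?thesis
  proof (cases "m \<ge> 0")
    case True
    then show ?thesis using main par sm by simp
  next
    case False
    then have "has_decaying_sol 1 1 s (- m) (- (q powi (- d)) + 1 / (- (q powi (- d))))"
      using main[of "- m"] par sm by simp
    then obtain a k where a: "jacobi_sol 1 1 s (- m) (- (q powi (- d)) + 1 / (- (q powi (- d)))) a" "decays a" "a k \<noteq> 0"
      unfolding has_decaying_sol_def by blast
    then show ?thesis
      unfolding has_decaying_sol_def using jacobi_sol_minus_m[OF a(1)] unfolding minus_minus by blast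
  qed
qed

text \<open>For m >= 0 only the second numerator symbol vanishes, and the degree is N = (s + m - d -
  1) / 2. Then d + 2N - s = m - 1, and the two inequalities force m >= 1, so the terminating
  solution stays away from 0 on the left. Comparison with it excludes every solution that decays at
  both ends.\<close>

lemma plus_plus_neg_nonexistence:
  assumes d: "d \<ge> 1" and par: "odd (s + m + d)" and sm: "s \<ge> 0" "s + \<bar>m\<bar> \<ge> d + 1" "s < \<bar>m\<bar> + d + 1"
  shows "only_zero_sol 1 1 s m (- (q powi (- d)) + 1 / (- (q powi (- d))))"
proof -
  have main: "only_zero_sol 1 1 s m (- (q powi (- d)) + 1 / (- (q powi (- d))))"
    if par: "odd (s + m + d)" and m: "m \<ge> 0" and sm: "s + m \<ge> d + 1" "s < m + d + 1" for m
  proof -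
    define L where "L = - (q powi (- d))"
    have L: "\<bar>L\<bar> > 1" "\<bar>L\<bar> * q \<ge> 1" using L_big[OF d, of "-1"] by (auto simp: L_def)
    have cf0: "ser_coeff 1 1 s m L n = 0 \<longleftrightarrow> (\<exists>i<n. 1 + m - s + d + 2 * int i = 0 \<or> 1 - m - s + d + 2 * int i = 0)" for n
      using ser_coeff_eq_0_iff[OF d, of "-1" 1 1 s m n] by (simp add: L_def)
    define N where "N = nat ((s + m - d - 1) div 2)"
    have "even (s + m - d - 1)" using par by simp
    then have N: "2 * int N = s + m - d - 1" using sm by (simp add: N_def)
    have m1: "m \<ge> 1" using sm by linarith
    have z: "ser_coeff 1 1 s m L (Suc N) = 0" unfolding cf0 using N by (intro exI[of _ N]) auto
    have nz: "ser_coeff 1 1 s m L N \<noteq> 0" unfolding cf0 using N sm(2) by auto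
    have ps: "ser_partial 1 1 s m L (Suc N) = ser_partial 1 1 s m L N" using z by (simp add: ser_partial_def fun_eq_iff)
    define \<phi> where "\<phi> = phi 1 1 s (ser_partial 1 1 s m L N) L"
    have "left_reg 1 1 s" by (simp add: left_reg_def)
    then have jacobi_sol: "jacobi_sol 1 1 s m (L + 1 / L) \<phi>"
      using terminating_solution[OF _ L(1) z] unfolding \<phi>_def ps by simp
    obtain c where "c \<noteq> 0" "(\<lambda>n. phi 1 1 s (ser_partial 1 1 s m (- (q powi (- d))) N) (- (q powi (- d))) (- int n) * q powi (int n * (d + 2 * int N - s))) \<longlonglongrightarrow> c"
      by (rule phi_psum_left[OF d nz[unfolded L_def]])
    note c = this[folded L_def, folded \<phi>_def]
    have "eventually (\<lambda>n. \<bar>\<phi> (- int n) * q powi (int n * (d + 2 * int N - s))\<bar> > \<bar>c\<bar> / 2) sequentially"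
      using c by (intro order_tendstoD(1)[OF tendsto_rabs[OF c(2)]]) simp
    then obtain n0 where n0: "\<And>n. n \<ge> n0 \<Longrightarrow> \<bar>\<phi> (- int n) * q powi (int n * (d + 2 * int N - s))\<bar> > \<bar>c\<bar> / 2"
      by (auto simp: eventually_sequentially)
    have lower: "\<bar>\<phi> (- int n)\<bar> \<ge> \<bar>c\<bar> / 2" if "n \<ge> n0" for n
    proof -
      have "q powi (int n * (d + 2 * int N - s)) \<le> 1" using N m1 by (simp add: powi_le_1_iff)
      then have "\<bar>\<phi> (- int n)\<bar> * q powi (int n * (d + 2 * int N - s)) \<le> \<bar>\<phi> (- int n)\<bar>"
        by (simp add: mult_left_le)
      then show ?thesis using n0[OF that] by (simp add: abs_mult)
    qed
    have \<phi>0: "(\<lambda>n. \<phi> (int n)) \<longlonglongrightarrow> 0"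
    proof -
      have "(\<lambda>n. \<phi> (int n) * (- L) ^ n * (1 / (- L)) ^ n) \<longlonglongrightarrow> 1 * 0"
        unfolding \<phi>_def by (intro tendsto_mult phi_psum_right L LIMSEQ_power_zero) (use L in auto)
      moreover have "\<phi> (int n) * (- L) ^ n * (1 / (- L)) ^ n = \<phi> (int n)" for n
      proof -
        have "(- L) ^ n * (1 / (- L)) ^ n = 1" using L by (subst power_mult_distrib[symmetric]) auto
        then show ?thesis by (simp add: mult.assoc)
      qed
      ultimately show ?thesis by (simp only: mult_zero_right)
    qed
    obtain B where B: "\<And>n. \<bar>jac_off 1 1 s (0 + int n)\<bar> \<le> B"
      using convergent_imp_Bseq[OF convergentI[OF jac_off_tendsto_1[of 1 1 s 0]]] by (auto simp: Bseq_def)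
    have in_range: "in_range 1 1 s k" for k by (simp add: in_range_def)
    have "a k = 0" if a: "jacobi_sol 1 1 s m (L + 1 / L) a" "(\<lambda>n. a (int n)) \<longlonglongrightarrow> 0" "(\<lambda>n. a (- int n)) \<longlonglongrightarrow> 0" for a k
    proof (rule whole_line_uniqueness[where A = "jac_off 1 1 s" and E = "\<lambda>k. jac_diag 1 1 s m k - (L + 1 / L)" and \<phi> = \<phi> and B = B and c = "\<bar>c\<bar> / 2" and M = n0])
      show "\<bar>jac_off 1 1 s k\<bar> \<le> B" if "k \<ge> 0" for k using B[of "nat k"] that by simp
      show "jac_off 1 1 s k \<noteq> 0" for k using jac_off_pos[of 1 1 s k] in_range[of k] by simp
    qed (use a jacobi_sol in_range \<phi>0 lower c(1) in \<open>auto simp: jacobi_sol_def\<close>)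
    then show ?thesis unfolding only_zero_sol_def L_def by blast
  qed
  show ?thesis
  proof (cases "m \<ge> 0")
    case True
    then show ?thesis using main par sm by simp
  next
    case False
    then have "only_zero_sol 1 1 s (- m) (- (q powi (- d)) + 1 / (- (q powi (- d))))"
      using main[of "- m"] par sm by simp
    then show ?thesis
      unfolding only_zero_sol_def using jacobi_sol_minus_m by blast
  qed
qed

section \<open>The solution on the full line decaying at both ends\<close>

text \<open>The value 0 for N <= 0 is forced by the product (q^(2N); q^2)_inf, which contains the
  factor 1 - q^0 in that case.\<close>

definition vseq :: "int \<Rightarrow> real \<Rightarrow> int \<Rightarrow> real" where
  "vseq b \<rho> N = (if N \<le> 0 then 0 else (- (q powi b)) powi N * qpoch_inf (q powi (2 * N)) / qpoch_inf (- (\<rho> * q powi (2 * N))))"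

text \<open>With g = \<open>useq e\<close> this is, up to a constant and the power (-q^b)^kappa, the
  right side of Heine's transformation 2phi1(A, B; C; z) = (B)_inf (Az)_inf / ((C)_inf (z)_inf)
  2phi1(C/B, z; Az; B) for B = -q^b, C/B = -q^(2e), z = -rho q^(2 kappa) and Az = q^(2 kappa). The
  infinite products are absorbed into the summands, so zeros of (Az)_n do no harm.\<close>

definition vsum :: "int \<Rightarrow> real \<Rightarrow> (nat \<Rightarrow> real) \<Rightarrow> int \<Rightarrow> real" where
  "vsum b \<rho> g \<kappa> = (\<Sum>n. g n * vseq b \<rho> (\<kappa> + int n))"

text \<open>The rule also crosses the edge of the support: at N = 0 the factor 1 - q^0 annihilates
  the first nonzero value. Hence sums over n need no boundary terms.\<close>

lemma vseq_rec:
  assumes "\<rho> > 0"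
  shows "(1 - q powi (2 * N)) * vseq b \<rho> (N + 1) = - (q powi b) * (1 + \<rho> * q powi (2 * N)) * vseq b \<rho> N"
proof (cases "N \<ge> 1")
  case True
  have 1: "qpoch_inf (q powi (2 * N)) = (1 - q powi (2 * N)) * qpoch_inf (q powi (2 * (N + 1)))"
    using qpoch_inf_powi_step[of "-1" N] by simp
  have 2: "qpoch_inf (- (\<rho> * q powi (2 * N))) = (1 + \<rho> * q powi (2 * N)) * qpoch_inf (- (\<rho> * q powi (2 * (N + 1))))"
    by (rule qpoch_inf_powi_step)
  have 3: "1 + \<rho> * q powi (2 * N) > 0" using assms by (simp add: add_pos_pos)
  have 4: "(- (q powi b)) powi (N + 1) = - (q powi b) * (- (q powi b)) powi N"
    by (simp add: power_int_add)
  have "vseq b \<rho> (N + 1) = (- (q powi b) * (- (q powi b)) powi N) * qpoch_inf (q powi (2 * (N + 1))) / qpoch_inf (- (\<rho> * q powi (2 * (N + 1))))"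
    using True unfolding vseq_def 4 by simp
  moreover have "vseq b \<rho> N = (- (q powi b)) powi N * ((1 - q powi (2 * N)) * qpoch_inf (q powi (2 * (N + 1)))) / ((1 + \<rho> * q powi (2 * N)) * qpoch_inf (- (\<rho> * q powi (2 * (N + 1)))))"
    using True unfolding vseq_def 1 2 by simp
  ultimately show ?thesis using 3 by simp
next
  case False
  then show ?thesis by (cases "N = 0") (auto simp: vseq_def)
qed

lemma vseq_bound:
  assumes "\<rho> > 0"
  obtains V where "\<And>N. \<bar>vseq b \<rho> N\<bar> \<le> V * q powi (b * N)" "V \<ge> 0"
proof -
  have "(\<lambda>n. qpoch_inf (1 * q ^ (2 * n)) / qpoch_inf (- \<rho> * q ^ (2 * n))) \<longlonglongrightarrow> 1 / 1"
    by (intro tendsto_intros qpoch_inf_tendsto_1) simp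
  note convergent_imp_Bseq[OF convergentI[OF this]]
  then obtain V where V: "\<And>n. \<bar>qpoch_inf (1 * q ^ (2 * n)) / qpoch_inf (- \<rho> * q ^ (2 * n))\<bar> \<le> V"
    unfolding Bseq_def real_norm_def by blast
  have V0: "V \<ge> 0" using V[of 0] by linarith
  have "\<bar>vseq b \<rho> N\<bar> \<le> V * q powi (b * N)" for N
  proof (cases "N \<le> 0")
    case True
    then show ?thesis using V0 by (simp add: vseq_def)
  next
    case False
    define n where "n = nat N"
    have N: "N = int n" using False by (simp add: n_def)
    have "\<bar>(- (q powi b)) powi N\<bar> = q powi (b * N)"
      unfolding power_int_abs by (simp add: power_int_mult)
    moreover have "vseq b \<rho> N = (- (q powi b)) powi N * (qpoch_inf (q powi (2 * N)) / qpoch_inf (- (\<rho> * q powi (2 * N))))"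
      using False by (simp add: vseq_def)
    ultimately have "\<bar>vseq b \<rho> N\<bar> = q powi (b * N) * \<bar>qpoch_inf (q powi (2 * N)) / qpoch_inf (- (\<rho> * q powi (2 * N)))\<bar>"
      by (simp only: abs_mult)
    also have "\<dots> \<le> q powi (b * N) * V"
      using V[of n] unfolding N powi_of_nat by (intro mult_left_mono) auto
    finally show ?thesis by (simp add: mult.commute)
  qed
  then show ?thesis using that V0 by blast
qed

text \<open>The rate q^(b kappa) comes from the geometric bound on the summands. It is useless for
  negative kappa, but then the first -kappa summands vanish and the sum effectively restarts at
  argument 0, which gives a bound independent of kappa.\<close>

lemma vsum_bounds:
  assumes "\<rho> > 0" "b \<ge> 1" "\<And>n. \<bar>g n\<bar> \<le> K"
  shows "summable (\<lambda>n. \<bar>g n * vseq b \<rho> (\<kappa> + int n)\<bar>)"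
    and "\<exists>C. \<forall>\<kappa>. \<bar>vsum b \<rho> g \<kappa>\<bar> \<le> C \<and> \<bar>vsum b \<rho> g \<kappa>\<bar> \<le> C * q powi (b * \<kappa>)"
proof -
  obtain V where V: "\<And>N. \<bar>vseq b \<rho> N\<bar> \<le> V * q powi (b * N)" "V \<ge> 0"
    using vseq_bound[OF assms(1)] by blast
  have K0: "K \<ge> 0" using assms(3)[of 0] by linarith
  have qb: "q powi b < 1" using assms(2) by (simp add: powi_less_1_iff)
  have p: "q powi (b * (\<kappa> + int n)) = q powi (b * \<kappa>) * (q powi b) ^ n" for \<kappa> n
    by (simp add: distrib_left powi_add power_int_mult)
  have le: "\<bar>g n * vseq b \<rho> (\<kappa> + int n)\<bar> \<le> K * V * q powi (b * \<kappa>) * (q powi b) ^ n" for n \<kappa>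
    using mult_mono[OF assms(3)[of n] V(1)[of "\<kappa> + int n"]] K0 unfolding p by (simp add: abs_mult mult_ac)
  have geo: "summable (\<lambda>n. K * V * q powi (b * \<kappa>) * (q powi b) ^ n)" for \<kappa>
    using qb by (intro summable_mult summable_geometric) simp
  have summ: "summable (\<lambda>n. \<bar>g n * vseq b \<rho> (\<kappa> + int n)\<bar>)" for \<kappa>
    by (rule summable_comparison_test'[OF geo[of \<kappa>]]) (use le in auto)
  then show "summable (\<lambda>n. \<bar>g n * vseq b \<rho> (\<kappa> + int n)\<bar>)" .
  define S where "S = (\<Sum>n. (q powi b) ^ n)"
  have S0: "S \<ge> 0" unfolding S_def using qb by (intro suminf_nonneg summable_geometric zero_le_power) auto
  define C where "C = K * V * S"
  have C0: "C \<ge> 0" using K0 V(2) S0 by (simp add: C_def)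
  have b1: "(\<Sum>n. \<bar>g n * vseq b \<rho> (\<kappa> + int n)\<bar>) \<le> C * q powi (b * \<kappa>)" for \<kappa>
  proof -
    have "(\<Sum>n. \<bar>g n * vseq b \<rho> (\<kappa> + int n)\<bar>) \<le> (\<Sum>n. K * V * q powi (b * \<kappa>) * (q powi b) ^ n)"
      by (intro suminf_le le summ geo)
    also have "\<dots> = C * q powi (b * \<kappa>)"
      unfolding C_def S_def using qb by (subst suminf_mult) (auto intro: summable_geometric)
    finally show ?thesis .
  qed
  have abs_le: "\<bar>vsum b \<rho> g \<kappa>\<bar> \<le> (\<Sum>n. \<bar>g n * vseq b \<rho> (\<kappa> + int n)\<bar>)" for \<kappa>
    unfolding vsum_def using summable_norm[of "\<lambda>n. g n * vseq b \<rho> (\<kappa> + int n)"] summ[of \<kappa>] by simp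
  have b2: "(\<Sum>n. \<bar>g n * vseq b \<rho> (\<kappa> + int n)\<bar>) \<le> C" for \<kappa>
  proof (cases "\<kappa> \<ge> 0")
    case True
    then have "q powi (b * \<kappa>) \<le> 1" using assms(2) by (simp add: powi_le_1_iff)
    then have "C * q powi (b * \<kappa>) \<le> C" using C0 by (simp add: mult_left_le)
    then show ?thesis using b1[of \<kappa>] by linarith
  next
    case False
    define c where "c = nat (- \<kappa>)"
    have c: "\<kappa> = - int c" using False by (simp add: c_def)
    have "(\<Sum>n. \<bar>g n * vseq b \<rho> (\<kappa> + int n)\<bar>) = (\<Sum>n. \<bar>g (n + c) * vseq b \<rho> (\<kappa> + int (n + c))\<bar>) + (\<Sum>n<c. \<bar>g n * vseq b \<rho> (\<kappa> + int n)\<bar>)"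
      by (rule suminf_split_initial_segment[OF summ])
    also have "(\<Sum>n<c. \<bar>g n * vseq b \<rho> (\<kappa> + int n)\<bar>) = 0"
      by (intro sum.neutral) (auto simp: c vseq_def)
    also have "(\<Sum>n. \<bar>g (n + c) * vseq b \<rho> (\<kappa> + int (n + c))\<bar>) \<le> (\<Sum>n. K * V * q powi (b * 0) * (q powi b) ^ n)"
    proof (rule suminf_le)
      show "\<bar>g (n + c) * vseq b \<rho> (\<kappa> + int (n + c))\<bar> \<le> K * V * q powi (b * 0) * (q powi b) ^ n" for n
        using mult_mono[OF assms(3)[of "n + c"] V(1)[of "0 + int n"]] K0 unfolding p c by (simp add: abs_mult mult_ac)
      show "summable (\<lambda>n. \<bar>g (n + c) * vseq b \<rho> (\<kappa> + int (n + c))\<bar>)"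
        using summable_ignore_initial_segment[OF summ[of \<kappa>]] .
      show "summable (\<lambda>n. K * V * q powi (b * 0) * (q powi b) ^ n)" by (rule geo)
    qed
    also have "\<dots> = C" unfolding C_def S_def using qb by (subst suminf_mult) (auto intro: summable_geometric)
    finally show ?thesis by simp
  qed
  show "\<exists>C. \<forall>\<kappa>. \<bar>vsum b \<rho> g \<kappa>\<bar> \<le> C \<and> \<bar>vsum b \<rho> g \<kappa>\<bar> \<le> C * q powi (b * \<kappa>)"
    using order_trans[OF abs_le b1] order_trans[OF abs_le b2] by blast
qed

lemma vsum_summable:
  assumes "\<rho> > 0" "b \<ge> 1" "\<And>n. \<bar>g n\<bar> \<le> K"
  shows "summable (\<lambda>n. g n * vseq b \<rho> (\<kappa> + int n))"
  using vsum_bounds(1)[OF assms] by (rule summable_rabs_cancel)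

lemma vsum_lin:
  assumes "\<rho> > 0" "b \<ge> 1" "\<And>n. \<bar>g n\<bar> \<le> K" "\<And>n. \<bar>h n\<bar> \<le> K"
  shows "vsum b \<rho> (\<lambda>n. g n - x * h n) \<kappa> = vsum b \<rho> g \<kappa> - x * vsum b \<rho> h \<kappa>"
proof -
  have s: "summable (\<lambda>n. g n * vseq b \<rho> (\<kappa> + int n))" "summable (\<lambda>n. h n * vseq b \<rho> (\<kappa> + int n))"
    using vsum_summable assms by blast+
  have "vsum b \<rho> g \<kappa> - x * vsum b \<rho> h \<kappa> = (\<Sum>n. g n * vseq b \<rho> (\<kappa> + int n) - x * (h n * vseq b \<rho> (\<kappa> + int n)))"
    unfolding vsum_def suminf_diff[OF s(1) summable_mult[OF s(2)], symmetric] suminf_mult[OF s(2)] ..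
  then show ?thesis unfolding vsum_def by (simp add: algebra_simps)
qed

lemma vsum_shift:
  assumes "\<rho> > 0" "b \<ge> 1" "\<And>n. \<bar>g n\<bar> \<le> K" "g 0 = 0"
  shows "vsum b \<rho> g \<kappa> = vsum b \<rho> (\<lambda>n. g (Suc n)) (\<kappa> + 1)"
proof -
  have "summable (\<lambda>n. g n * vseq b \<rho> (\<kappa> + int n))"
    by (rule vsum_summable[OF assms(1-3)])
  from suminf_split_head[OF this] show ?thesis
    using assms(4) by (simp add: vsum_def add.assoc)
qed

definition useq :: "int \<Rightarrow> nat \<Rightarrow> real" where
  "useq e n = qpoch (- (q powi (2 * e))) n / qpoch (q\<^sup>2) n"

lemma useq_rec: "(1 - q ^ (2 * Suc n)) * useq e (Suc n) = (1 + q powi (2 * e) * q ^ (2 * n)) * useq e n"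
  using qpoch_q2_nz'[of "Suc n"] by (simp add: useq_def qpoch_Suc power2_eq_square field_simps)

lemma useq_bound: "\<exists>K. \<forall>n. \<bar>useq e n\<bar> \<le> K"
proof -
  have "qpoch_inf (q\<^sup>2) > 0" using qpoch_inf_q2_pos[of 1] by simp
  then have "(\<lambda>n. qpoch (- (q powi (2 * e))) n / qpoch (q\<^sup>2) n) \<longlonglongrightarrow> qpoch_inf (- (q powi (2 * e))) / qpoch_inf (q\<^sup>2)"
    by (intro tendsto_intros qpoch_tendsto) simp
  note convergent_imp_Bseq[OF convergentI[OF this]]
  then show ?thesis unfolding Bseq_def real_norm_def useq_def by blast
qed

lemma q_weight_bound: "\<bar>g n\<bar> \<le> K \<Longrightarrow> \<bar>q ^ i * g n\<bar> \<le> K"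
proof -
  assume g: "\<bar>g n\<bar> \<le> K"
  have "q ^ i \<le> 1" using q_pos q_less_1 by (simp add: power_le_one)
  then have "q ^ i * \<bar>g n\<bar> \<le> \<bar>g n\<bar>" using q_pos by (simp add: mult_left_le_one_le)
  then show ?thesis using g q_pos by (simp add: abs_mult)
qed

text \<open>The weights \<open>q^(2in)\<close> give the contiguous relation from which both the recurrence
  (\<open>i = 0\<close>) and the non-vanishing (\<open>i \<rightarrow> \<infinity>\<close>) follow.\<close>

lemma vsum_contiguous:
  assumes "\<rho> > 0" "b \<ge> 1"
  shows "vsum b \<rho> (\<lambda>n. q ^ (2 * n * i) * useq e n) \<kappa> - vsum b \<rho> (\<lambda>n. q ^ (2 * n * Suc i) * useq e n) \<kappa>
    = q ^ (2 * i) * (vsum b \<rho> (\<lambda>n. q ^ (2 * n * i) * useq e n) (\<kappa> + 1)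
        + q powi (2 * e) * vsum b \<rho> (\<lambda>n. q ^ (2 * n * Suc i) * useq e n) (\<kappa> + 1))"
proof -
  obtain K where K: "\<And>n. \<bar>useq e n\<bar> \<le> K" using useq_bound by blast
  define g where "g i n = q ^ (2 * n * i) * useq e n" for i n
  have gK: "\<bar>g i n\<bar> \<le> K" for i n unfolding g_def using q_weight_bound[of "useq e" n K] K by blast
  define h where "h n = g i n - 1 * g (Suc i) n" for n
  have h: "\<bar>h n\<bar> \<le> 2 * K" for n using gK[of i n] gK[of "Suc i" n] by (simp add: h_def)
  have "vsum b \<rho> (g i) \<kappa> - 1 * vsum b \<rho> (g (Suc i)) \<kappa> = vsum b \<rho> h \<kappa>"
    unfolding h_def by (rule vsum_lin[OF assms gK gK, symmetric])
  also have "\<dots> = vsum b \<rho> (\<lambda>n. h (Suc n)) (\<kappa> + 1)"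
    by (rule vsum_shift[OF assms h]) (simp add: h_def g_def)
  also have "(\<lambda>n. h (Suc n)) = (\<lambda>n. q ^ (2 * i) * (g i n - (- (q powi (2 * e))) * g (Suc i) n))"
  proof
    fix n
    have "h (Suc n) = q ^ (2 * Suc n * i) * ((1 - q ^ (2 * Suc n)) * useq e (Suc n))"
      by (simp add: h_def g_def power_add algebra_simps)
    also have "\<dots> = q ^ (2 * Suc n * i) * ((1 + q powi (2 * e) * q ^ (2 * n)) * useq e n)"
      unfolding useq_rec ..
    also have "\<dots> = q ^ (2 * i) * (g i n - (- (q powi (2 * e))) * g (Suc i) n)"
      by (simp add: g_def power_add algebra_simps)
    finally show "h (Suc n) = q ^ (2 * i) * (g i n - (- (q powi (2 * e))) * g (Suc i) n)" .
  qed
  also have "vsum b \<rho> (\<lambda>n. q ^ (2 * i) * (g i n - (- (q powi (2 * e))) * g (Suc i) n)) (\<kappa> + 1)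
     = q ^ (2 * i) * vsum b \<rho> (\<lambda>n. g i n - (- (q powi (2 * e))) * g (Suc i) n) (\<kappa> + 1)"
  proof -
    have "\<bar>g i n - (- (q powi (2 * e))) * g (Suc i) n\<bar> \<le> K + q powi (2 * e) * K" for n
    proof -
      have "\<bar>q powi (2 * e) * g (Suc i) n\<bar> \<le> q powi (2 * e) * K"
        unfolding abs_mult by (simp add: mult_left_mono gK)
      then show ?thesis using gK[of i n] by linarith
    qed
    then have "summable (\<lambda>n. (g i n - (- (q powi (2 * e))) * g (Suc i) n) * vseq b \<rho> (\<kappa> + 1 + int n))"
      by (rule vsum_summable[OF assms])
    from suminf_mult[OF this, of "q ^ (2 * i)"] show ?thesis
      unfolding vsum_def by (simp only: mult.assoc)
  qed
  also have "vsum b \<rho> (\<lambda>n. g i n - (- (q powi (2 * e))) * g (Suc i) n) (\<kappa> + 1) = vsum b \<rho> (g i) (\<kappa> + 1) - (- (q powi (2 * e))) * vsum b \<rho> (g (Suc i)) (\<kappa> + 1)"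
    by (rule vsum_lin[OF assms gK gK])
  finally show ?thesis unfolding g_def by simp
qed

text \<open>Termwise application of \<open>vseq_rec\<close>; the factor q^(2(kappa+n)) splits into
  q^(2 kappa) and the weight q^(2n), which brings in the sum with one more weight.\<close>

lemma vsum_step:
  assumes "\<rho> > 0" "b \<ge> 1"
  shows "vsum b \<rho> (useq e) (\<kappa> + 1) - q powi (2 * \<kappa>) * vsum b \<rho> (\<lambda>n. q ^ (2 * n) * useq e n) (\<kappa> + 1)
    = - (q powi b) * (vsum b \<rho> (useq e) \<kappa> + \<rho> * q powi (2 * \<kappa>) * vsum b \<rho> (\<lambda>n. q ^ (2 * n) * useq e n) \<kappa>)"
proof -
  obtain K where K: "\<And>n. \<bar>useq e n\<bar> \<le> K" using useq_bound by blast
  have K': "\<bar>q ^ (2 * n) * useq e n\<bar> \<le> K" for n using q_weight_bound[of "useq e" n K] K by blast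
  have "vsum b \<rho> (useq e) (\<kappa> + 1) - q powi (2 * \<kappa>) * vsum b \<rho> (\<lambda>n. q ^ (2 * n) * useq e n) (\<kappa> + 1)
     = vsum b \<rho> (\<lambda>n. useq e n - q powi (2 * \<kappa>) * (q ^ (2 * n) * useq e n)) (\<kappa> + 1)"
    by (rule vsum_lin[OF assms K K', symmetric])
  also have "\<dots> = (\<Sum>n. - (q powi b) * ((useq e n - (- (\<rho> * q powi (2 * \<kappa>))) * (q ^ (2 * n) * useq e n)) * vseq b \<rho> (\<kappa> + int n)))"
  proof -
    have "(useq e n - q powi (2 * \<kappa>) * (q ^ (2 * n) * useq e n)) * vseq b \<rho> (\<kappa> + 1 + int n)
       = - (q powi b) * ((useq e n - (- (\<rho> * q powi (2 * \<kappa>))) * (q ^ (2 * n) * useq e n)) * vseq b \<rho> (\<kappa> + int n))" for n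
    proof -
      have "(1 - q powi (2 * \<kappa>) * q ^ (2 * n)) * vseq b \<rho> (\<kappa> + 1 + int n) = - (q powi b) * (1 + \<rho> * (q powi (2 * \<kappa>) * q ^ (2 * n))) * vseq b \<rho> (\<kappa> + int n)"
        using vseq_rec[OF assms(1), of "\<kappa> + int n" b] unfolding powi_shift by (simp add: algebra_simps)
      then have "useq e n * ((1 - q powi (2 * \<kappa>) * q ^ (2 * n)) * vseq b \<rho> (\<kappa> + 1 + int n)) = useq e n * (- (q powi b) * (1 + \<rho> * (q powi (2 * \<kappa>) * q ^ (2 * n))) * vseq b \<rho> (\<kappa> + int n))"
        by (rule arg_cong)
      then show ?thesis by (simp add: algebra_simps)
    qed
    then show ?thesis unfolding vsum_def by (simp only:)
  qed
  also have "\<dots> = - (q powi b) * vsum b \<rho> (\<lambda>n. useq e n - (- (\<rho> * q powi (2 * \<kappa>))) * (q ^ (2 * n) * useq e n)) \<kappa>"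
  proof -
    have "\<bar>useq e n - (- (\<rho> * q powi (2 * \<kappa>))) * (q ^ (2 * n) * useq e n)\<bar> \<le> K + \<rho> * q powi (2 * \<kappa>) * K" for n
    proof -
      have "\<bar>(\<rho> * q powi (2 * \<kappa>)) * (q ^ (2 * n) * useq e n)\<bar> \<le> \<rho> * q powi (2 * \<kappa>) * K"
        using assms(1) mult_left_mono[OF K'[of n], of "\<rho> * q powi (2 * \<kappa>)"] by (simp add: abs_mult mult.assoc)
      then show ?thesis using K[of n] unfolding mult_minus_left by linarith
    qed
    then have "summable (\<lambda>n. (useq e n - (- (\<rho> * q powi (2 * \<kappa>))) * (q ^ (2 * n) * useq e n)) * vseq b \<rho> (\<kappa> + int n))"
      by (rule vsum_summable[OF assms])
    from suminf_mult[OF this] show ?thesis unfolding vsum_def .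
  qed
  also have "vsum b \<rho> (\<lambda>n. useq e n - (- (\<rho> * q powi (2 * \<kappa>))) * (q ^ (2 * n) * useq e n)) \<kappa>
     = vsum b \<rho> (useq e) \<kappa> - (- (\<rho> * q powi (2 * \<kappa>))) * vsum b \<rho> (\<lambda>n. q ^ (2 * n) * useq e n) \<kappa>"
    by (rule vsum_lin[OF assms K K'])
  finally show ?thesis by (simp only: minus_mult_left[symmetric] diff_minus_eq_add)
qed

text \<open>U and R are the sums with weights 1 and q^(2n), taken at three consecutive arguments a,
  b, c. Two first-order systems link them; eliminating R leaves a second-order recurrence for U
  alone.\<close>

lemma three_term_elimination:
  fixes Ua Ub Uc Ra Rb t x Q \<beta> r :: real
  assumes "Ua - Ra = Ub + x * Rb" "Ub - t * Rb = - \<beta> * (Ua + r * t * Ra)"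
    "Ub - Rb = Uc + x * Rc"  "Uc - t * Q * Rc = - \<beta> * (Ub + r * t * Q * Rb)" "t \<noteq> 0" "Q \<noteq> 0"
  shows "(t + x / Q) * Uc + \<beta> * (1 + r * t) * Ua = (t * (1 + \<beta> * r) - 1 - x * \<beta> / Q) * Ub"
proof -
  have Ra: "Ra = Ua - Ub - x * Rb" using assms(1) by simp
  have 1: "Ub + \<beta> * Ua + \<beta> * r * t * (Ua - Ub) = t * Rb * (1 + \<beta> * r * x)"
    using assms(2) unfolding Ra by (simp add: algebra_simps)
  have Rc: "x * Rc = x / (t * Q) * (Uc + \<beta> * (Ub + r * t * Q * Rb))"
    using assms(4,5,6) by (simp add: field_simps)
  have "Rb = Ub - Uc - x * Rc" using assms(3) by simp
  then have "t * Rb = t * (Ub - Uc - x / (t * Q) * (Uc + \<beta> * (Ub + r * t * Q * Rb)))"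
    unfolding Rc by (rule arg_cong)
  also have "t * (Ub - Uc - x / (t * Q) * w) = t * (Ub - Uc) - x / Q * w" for w
    using assms(5) by (simp add: right_diff_distrib)
  finally have "t * Rb = t * (Ub - Uc) - x / Q * (Uc + \<beta> * (Ub + r * t * Q * Rb))" .
  then have 2: "t * Rb * (1 + \<beta> * r * x) = t * (Ub - Uc) - x / Q * (Uc + \<beta> * Ub)"
    using assms(6) by (simp add: field_simps)
  show ?thesis using 1 unfolding 2 using assms(6) by (simp add: field_simps)
qed

lemma vsum_three_term:
  fixes b e :: int and \<rho> :: real
  assumes "\<rho> > 0" "b \<ge> 1"
  defines "U \<equiv> vsum b \<rho> (useq e)"
  shows "(q powi (2 * \<kappa>) + q powi (2 * e) / q\<^sup>2) * U (\<kappa> + 2) + q powi b * (1 + \<rho> * q powi (2 * \<kappa>)) * U \<kappa>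
    = (q powi (2 * \<kappa>) * (1 + q powi b * \<rho>) - 1 - q powi (2 * e) * q powi b / q\<^sup>2) * U (\<kappa> + 1)"
proof -
  define R where "R = vsum b \<rho> (\<lambda>n. q ^ (2 * n) * useq e n)"
  have 1: "U k - R k = U (k + 1) + q powi (2 * e) * R (k + 1)" for k
    using vsum_contiguous[OF assms(1,2), of 0 e k] by (simp add: U_def R_def)
  have 2: "U (k + 1) - q powi (2 * k) * R (k + 1) = - (q powi b) * (U k + \<rho> * q powi (2 * k) * R k)" for k
    unfolding U_def R_def by (rule vsum_step[OF assms(1,2)])
  show ?thesis
  proof (rule three_term_elimination[where Ra = "R \<kappa>" and Rb = "R (\<kappa> + 1)" and Rc = "R (\<kappa> + 2)"])
    show "U (\<kappa> + 2) - q powi (2 * \<kappa>) * q\<^sup>2 * R (\<kappa> + 2) = - (q powi b) * (U (\<kappa> + 1) + \<rho> * q powi (2 * \<kappa>) * q\<^sup>2 * R (\<kappa> + 1))"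
      using 2[of "\<kappa> + 1"] unfolding powi_double_Suc by (simp add: mult.assoc add.assoc)
    show "U (\<kappa> + 1) - R (\<kappa> + 1) = U (\<kappa> + 2) + q powi (2 * e) * R (\<kappa> + 2)"
      using 1[of "\<kappa> + 1"] by (simp add: add.assoc)
  qed (use 1 2 in auto)
qed

text \<open>If the unweighted sums vanish identically, \<open>vsum_contiguous\<close> becomes a
  first-order recursion for the next weight. Its iterates are bounded by a multiple of (q^(2e+b))^t,
  so that weight vanishes as well, and inductively all of them do. For growing i only the summand n
  = 0 survives at argument 1, and it is not 0.\<close>

lemma vsum_nonzero:
  assumes "\<rho> > 0" "b \<ge> 1" "2 * e + b \<ge> 1"
  shows "\<exists>\<kappa>. vsum b \<rho> (useq e) \<kappa> \<noteq> 0"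
proof (rule ccontr)
  assume "\<not> ?thesis"
  then have z: "vsum b \<rho> (useq e) \<kappa> = 0" for \<kappa> by blast
  obtain K where K: "\<And>n. \<bar>useq e n\<bar> \<le> K" using useq_bound by blast
  define P where "P i = vsum b \<rho> (\<lambda>n. q ^ (2 * n * i) * useq e n)" for i
  have gK: "\<bar>q ^ (2 * n * i) * useq e n\<bar> \<le> K" for i n using q_weight_bound[of "useq e" n K] K by blast
  have P0: "P i \<kappa> = 0" for i \<kappa>
  proof (induction i arbitrary: \<kappa>)
    case 0
    then show ?case using z by (simp add: P_def)
  next
    case (Suc i)
    define y where "y = - (q ^ (2 * i) * q powi (2 * e))"
    have step: "P (Suc i) \<kappa> = y * P (Suc i) (\<kappa> + 1)" for \<kappa>
      using vsum_contiguous[OF assms(1,2), of i e \<kappa>] Suc unfolding P_def[symmetric] by (simp add: y_def)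
    have it: "P (Suc i) \<kappa> = y ^ t * P (Suc i) (\<kappa> + int t)" for t
    proof (induction t)
      case (Suc t)
      then show ?case using step[of "\<kappa> + int t"] by (simp add: algebra_simps)
    qed simp
    obtain C where C: "\<And>k. \<bar>P (Suc i) k\<bar> \<le> C * q powi (b * k)"
      using vsum_bounds(2)[where g = "\<lambda>n. q ^ (2 * n * Suc i) * useq e n", OF assms(1,2) gK] unfolding P_def by blast
    have bd: "\<bar>P (Suc i) \<kappa>\<bar> \<le> C * q powi (b * \<kappa>) * (q powi (2 * e + b)) ^ t" for t
    proof -
      have y: "\<bar>y\<bar> \<le> q powi (2 * e)"
        using q_pos q_less_1 power_le_one[of q "2 * i"] by (simp add: y_def abs_mult mult_left_le_one_le)
      have "\<bar>P (Suc i) \<kappa>\<bar> = \<bar>y\<bar> ^ t * \<bar>P (Suc i) (\<kappa> + int t)\<bar>"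
        using it[of t] by (simp add: abs_mult power_abs)
      also have "\<dots> \<le> (q powi (2 * e)) ^ t * (C * q powi (b * (\<kappa> + int t)))"
        by (intro mult_mono power_mono y C) auto
      also have "q powi (b * (\<kappa> + int t)) = q powi (b * \<kappa>) * (q powi b) ^ t"
        by (simp add: distrib_left powi_add power_int_mult)
      finally show ?thesis by (simp add: powi_add power_mult_distrib mult_ac)
    qed
    have "(\<lambda>t. C * q powi (b * \<kappa>) * (q powi (2 * e + b)) ^ t) \<longlonglongrightarrow> C * q powi (b * \<kappa>) * 0"
      using assms(3) powi_less_1_iff[of "2 * e + b"] by (intro tendsto_intros LIMSEQ_power_zero) simp
    then have "\<bar>P (Suc i) \<kappa>\<bar> \<le> C * q powi (b * \<kappa>) * 0"
      by (rule LIMSEQ_le_const) (use bd in blast)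
    then show ?case by simp
  qed
  define f where "f i n = q ^ (2 * n * i) * useq e n * vseq b \<rho> (1 + int n)" for i n
  have s0: "summable (\<lambda>n. \<bar>f 0 n\<bar>)"
    using vsum_bounds(1)[where g = "\<lambda>n. q ^ (2 * n * 0) * useq e n", OF assms(1,2) gK, of 1] unfolding f_def .
  have "\<bar>vseq b \<rho> 1\<bar> \<le> (q ^ (2 * i)) * (\<Sum>n. \<bar>f 0 (Suc n)\<bar>)" for i
  proof -
    have si: "summable (f i)"
      unfolding f_def by (rule vsum_summable[where g = "\<lambda>n. q ^ (2 * n * i) * useq e n", OF assms(1,2) gK])
    have "0 = vseq b \<rho> 1 + (\<Sum>n. f i (Suc n))"
    proof -
      have "f i 0 = vseq b \<rho> 1" by (simp add: f_def useq_def)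
      moreover have "suminf (f i) = 0" using P0[of i 1] by (simp add: P_def vsum_def f_def[abs_def])
      ultimately show ?thesis using suminf_split_head[OF si] by simp
    qed
    moreover have "\<bar>\<Sum>n. f i (Suc n)\<bar> \<le> (\<Sum>n. q ^ (2 * i) * \<bar>f 0 (Suc n)\<bar>)"
    proof -
      have le: "\<bar>f i (Suc n)\<bar> \<le> q ^ (2 * i) * \<bar>f 0 (Suc n)\<bar>" for n
      proof -
        have "q ^ (2 * Suc n * i) \<le> q ^ (2 * i)" using q_pos q_less_1 by (intro power_decreasing) auto
        then have "q ^ (2 * Suc n * i) * \<bar>f 0 (Suc n)\<bar> \<le> q ^ (2 * i) * \<bar>f 0 (Suc n)\<bar>" by (rule mult_right_mono) simp
        then show ?thesis using q_pos by (simp add: f_def abs_mult mult.assoc)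
      qed
      have s1: "summable (\<lambda>n. q ^ (2 * i) * \<bar>f 0 (Suc n)\<bar>)"
        using s0 summable_Suc_iff[of "\<lambda>n. \<bar>f 0 n\<bar>"] by (intro summable_mult) simp
      have s2: "summable (\<lambda>n. \<bar>f i (Suc n)\<bar>)"
        by (rule summable_comparison_test'[OF s1]) (use le in auto)
      show ?thesis using order_trans[OF summable_rabs[OF s2] suminf_le[OF le s2 s1]] .
    qed
    moreover have "(\<Sum>n. q ^ (2 * i) * \<bar>f 0 (Suc n)\<bar>) = q ^ (2 * i) * (\<Sum>n. \<bar>f 0 (Suc n)\<bar>)"
      using s0 summable_Suc_iff[of "\<lambda>n. \<bar>f 0 n\<bar>"] by (intro suminf_mult) simp
    ultimately show ?thesis by linarith
  qed
  moreover have "(\<lambda>i. q ^ (2 * i) * (\<Sum>n. \<bar>f 0 (Suc n)\<bar>)) \<longlonglongrightarrow> 0"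
    using q_power_tendsto_0[of "\<Sum>n. \<bar>f 0 (Suc n)\<bar>"] by (simp add: mult.commute)
  ultimately have "\<bar>vseq b \<rho> 1\<bar> \<le> 0"
    by (intro LIMSEQ_le_const[where a = "\<bar>vseq b \<rho> 1\<bar>"]) auto
  moreover have "vseq b \<rho> 1 \<noteq> 0"
  proof -
    have "qpoch_inf (q powi (2 * 1)) > 0" "qpoch_inf (- (\<rho> * q powi (2 * 1))) > 0"
    proof -
      have "0 < \<rho> * q powi (2 * 1)" using assms(1) by simp
      then have "- (\<rho> * q powi (2 * 1)) < 1" by linarith
      then show "qpoch_inf (- (\<rho> * q powi (2 * 1))) > 0" by (rule qpoch_inf_pos)
      show "qpoch_inf (q powi (2 * 1)) > 0" using q_sq_less_1 by (intro qpoch_inf_pos) simp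
    qed
    then show ?thesis by (simp add: vseq_def)
  qed
  ultimately show False by simp
qed

text \<open>e, b and \<open>\<rho>\<close> are the parameters of Heine's formula for L = q^(-d), and
  \<open>\<theta>\<close> restores the power (-1/L)^k, since \<theta> q^b = q^d. The signs of s and
  m are used twice: they give b >= 1, so that the sum converges, and they give the rate q^((1-m)n)
  on the left, where gauge and \<theta>^k contribute q^(sn) and q^((1-s-m)n). On the right the rate
  is q^(dk).\<close>

lemma plus_plus_pos_existence_aux:
  assumes d: "d \<ge> 1" and par: "odd (s + m + d)" and sm: "s \<le> 0" "m \<le> 0"
  shows "has_decaying_sol 1 1 s m (q powi (- d) + 1 / q powi (- d))"
proof -
  define e where "e = (s + m + 1 + d) div 2"
  define b where "b = 1 - s - m + d"
  define \<rho> where "\<rho> = q powi (2 * s - 2 * e)"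
  define \<theta> where "\<theta> = q powi (s + m - 1)"
  define U where "U = vsum b \<rho> (useq e)"
  have e: "2 * e = s + m + 1 + d" using par unfolding e_def by simp
  have \<rho>: "\<rho> > 0" and b: "b \<ge> 1" using d sm by (auto simp: \<rho>_def b_def)
  have \<theta>: "\<theta> \<noteq> 0" by (simp add: \<theta>_def)
  define a where "a k = gauge 1 1 s k * \<theta> powi k * U (k + e)" for k
  have lr: "left_reg 1 1 s" by (simp add: left_reg_def)
  have jacobi_sol: "jacobi_sol 1 1 s m (q powi (- d) + 1 / q powi (- d)) a"
    unfolding jacobi_sol_def
  proof (intro conjI allI impI)
    fix k
    show "a k = 0" if "\<not> in_range 1 1 s k" using that by (simp add: in_range_def)
    assume in_range: "in_range 1 1 s k"
    define S M D y where "S = q powi s" and "M = q powi m" and "D = q powi d" and "y = q powi (2 * k)"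
    have nz: "S \<noteq> 0" "M \<noteq> 0" "D \<noteq> 0" by (auto simp: S_def M_def D_def)
    have e2: "q powi (2 * e) = S * M * q * D" unfolding e by (simp add: powi_add S_def M_def D_def)
    have p: "q powi b = q * D / (S * M)" "\<rho> = S / (M * q * D)" "\<theta> = S * M / q"
      unfolding b_def \<rho>_def \<theta>_def powi_diff e2 by (simp_all add: powi_expand S_def M_def D_def power2_eq_square)
    have \<kappa>: "q powi (2 * (k + e - 1)) = y * S * M * D / q"
    proof -
      have "q powi (2 * (k + e - 1)) = y * q powi (2 * e) / q\<^sup>2"
        by (simp add: y_def right_diff_distrib distrib_left powi_add powi_diff)
      then show ?thesis unfolding e2 by (simp add: power2_eq_square)
    qed
    have t: "(y * S * M * D / q + S * M * q * D / q\<^sup>2) * U (k + e + 1) + q * D / (S * M) * (1 + S / (M * q * D) * (y * S * M * D / q)) * U (k + e - 1)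
      = (y * S * M * D / q * (1 + q * D / (S * M) * (S / (M * q * D))) - 1 - S * M * q * D * (q * D / (S * M)) / q\<^sup>2) * U (k + e)"
    proof -
      have i: "k + e - 1 + 2 = k + e + 1" "k + e - 1 + 1 = k + e" by simp_all
      show ?thesis
        using vsum_three_term[OF \<rho> b, of "k + e - 1" e, folded U_def] unfolding \<kappa> e2 p i .
    qed
    \<comment> \<open>A common factor D = q^d cancels from the three-term relation; what remains is
      the Jacobi recurrence after conjugation by gauge and \<theta>^k.\<close>
    have t': "(1 + y) * \<theta> * U (k + e + 1) + (1 + S\<^sup>2 * y / q\<^sup>2) / \<theta> * U (k + e - 1) = (y * S / q * (M + 1 / M) - (1 / D + D)) * U (k + e)"
    proof -
      have *: "(y * S * M * D / q + S * M * q * D / q\<^sup>2) = D * ((1 + y) * \<theta>)"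
        "q * D / (S * M) * (1 + S / (M * q * D) * (y * S * M * D / q)) = D * ((1 + S\<^sup>2 * y / q\<^sup>2) / \<theta>)"
        "(y * S * M * D / q * (1 + q * D / (S * M) * (S / (M * q * D))) - 1 - S * M * q * D * (q * D / (S * M)) / q\<^sup>2) = D * (y * S / q * (M + 1 / M) - (1 / D + D))"
        using nz by (simp_all add: p(3) field_simps power2_eq_square)
      then have "D * ((1 + y) * \<theta> * U (k + e + 1) + (1 + S\<^sup>2 * y / q\<^sup>2) / \<theta> * U (k + e - 1)) = D * ((y * S / q * (M + 1 / M) - (1 / D + D)) * U (k + e))"
        using t unfolding * by (simp only: distrib_left mult.assoc)
      then show ?thesis using nz by simp
    qed
    have up: "jac_off 1 1 s k * a (k + 1) = gauge 1 1 s k * \<theta> powi k * ((1 + y) * \<theta> * U (k + e + 1))"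
    proof -
      have "jac_off 1 1 s k * a (k + 1) = (jac_off 1 1 s k * gauge 1 1 s (k + 1)) * \<theta> powi (k + 1) * U (k + 1 + e)"
        by (simp only: a_def mult_ac)
      also have "\<theta> powi (k + 1) = \<theta> powi k * \<theta>" using \<theta> by (simp add: power_int_add)
      finally show ?thesis unfolding gauge_up[OF lr in_range] by (simp add: y_def add_ac mult_ac)
    qed
    have down: "jac_off 1 1 s (k - 1) * a (k - 1) = gauge 1 1 s k * \<theta> powi k * ((1 + S\<^sup>2 * y / q\<^sup>2) / \<theta> * U (k + e - 1))"
    proof -
      have "jac_off 1 1 s (k - 1) * a (k - 1) = (jac_off 1 1 s (k - 1) * gauge 1 1 s (k - 1)) * \<theta> powi (k - 1) * U (k - 1 + e)"
        by (simp only: a_def mult_ac)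
      also have "\<theta> powi (k - 1) = \<theta> powi k / \<theta>" using \<theta> by (simp add: power_int_diff)
      also have "k - 1 + e = k + e - 1" by simp
      also have "jac_off 1 1 s (k - 1) * gauge 1 1 s (k - 1) = (1 + S\<^sup>2 * y / q\<^sup>2) * gauge 1 1 s k"
      proof -
        have "q powi (2 * (s + k - 1)) = S\<^sup>2 * y / q\<^sup>2"
          unfolding S_def y_def powi_expand by (simp add: power2_eq_square)
        then show ?thesis using gauge_down[OF lr in_range] by simp
      qed
      finally show ?thesis by (simp add: mult_ac)
    qed
    have jac_diag: "jac_diag 1 1 s m k - (q powi (- d) + 1 / q powi (- d)) = y * S / q * (M + 1 / M) - (1 / D + D)"
      by (simp add: jac_diag_def y_def S_def M_def D_def powi_uminus)
    have "jac_off 1 1 s k * a (k + 1) + jac_off 1 1 s (k - 1) * a (k - 1) = gauge 1 1 s k * \<theta> powi k * ((y * S / q * (M + 1 / M) - (1 / D + D)) * U (k + e))"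
      unfolding up down distrib_left[symmetric] t' ..
    also have "\<dots> = (y * S / q * (M + 1 / M) - (1 / D + D)) * a k" by (simp only: a_def mult_ac)
    finally show "jac_off 1 1 s k * a (k + 1) + jac_off 1 1 s (k - 1) * a (k - 1) = (jac_diag 1 1 s m k - (q powi (- d) + 1 / q powi (- d))) * a k"
      unfolding jac_diag .
  qed
  obtain K where K: "\<And>n. \<bar>useq e n\<bar> \<le> K" using useq_bound by blast
  obtain C where C: "\<And>\<kappa>. \<bar>U \<kappa>\<bar> \<le> C" "\<And>\<kappa>. \<bar>U \<kappa>\<bar> \<le> C * q powi (b * \<kappa>)"
    using vsum_bounds(2)[where g = "useq e", OF \<rho> b K] unfolding U_def by blast
  have C0: "C \<ge> 0" using C(1)[of 0] by linarith
  have \<theta>k: "\<theta> powi k = q powi ((s + m - 1) * k)" for k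
    unfolding \<theta>_def by (rule power_int_mult[symmetric])
  note convergent_imp_Bseq[OF convergentI[OF gauge_tendsto_1[of 1 1 s 0]]]
  then obtain W where W: "\<And>n. \<bar>gauge 1 1 s (int n)\<bar> \<le> W" unfolding Bseq_def real_norm_def add_0 by blast
  obtain c0 where "(\<lambda>n. gauge 1 1 s (- int n) * q powi (- s * int n)) \<longlonglongrightarrow> c0" by (rule gauge_left_asymp)
  note convergent_imp_Bseq[OF convergentI[OF this]]
  then obtain V where V: "\<And>n. \<bar>gauge 1 1 s (- int n) * q powi (- s * int n)\<bar> \<le> V" unfolding Bseq_def real_norm_def by blast
  have dec: "\<bar>a k\<bar> \<le> max (W * (C * q powi (b * e))) (V * C) * q powi \<bar>k\<bar>" for k
  proof (cases "k \<ge> 0")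
    case True
    have "\<bar>a k\<bar> = (\<bar>gauge 1 1 s k\<bar> * q powi ((s + m - 1) * k)) * \<bar>U (k + e)\<bar>"
      by (simp add: a_def \<theta>k abs_mult)
    also have "\<dots> \<le> (W * q powi ((s + m - 1) * k)) * (C * q powi (b * (k + e)))"
      using W[of "nat k"] True C0 by (intro mult_mono C mult_right_mono) auto
    also have "\<dots> = (W * (C * q powi (b * e))) * q powi ((s + m - 1) * k + b * k)"
      by (simp add: distrib_left powi_add)
    also have "(s + m - 1) * k + b * k = d * k" by (simp add: b_def algebra_simps)
    also have "(W * (C * q powi (b * e))) * q powi (d * k) \<le> max (W * (C * q powi (b * e))) (V * C) * q powi \<bar>k\<bar>"
    proof (intro mult_mono)
      have "1 * k \<le> d * k" using d True by (intro mult_right_mono) auto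
      then show "q powi (d * k) \<le> q powi \<bar>k\<bar>" using True by (simp add: powi_le_iff)
      have "W \<ge> 0" using W[of 0] by linarith
      then show "0 \<le> max (W * (C * q powi (b * e))) (V * C)" using C0 by (simp add: le_max_iff_disj)
    qed auto
    finally show ?thesis .
  next
    case False
    have V0: "V \<ge> 0" using V[of 0] by linarith
    have "\<bar>a k\<bar> = \<bar>gauge 1 1 s k * q powi (s * k)\<bar> * q powi ((m - 1) * k) * \<bar>U (k + e)\<bar>"
    proof -
      have "(s + m - 1) * k = s * k + (m - 1) * k" by (simp add: algebra_simps)
      then show ?thesis by (simp add: a_def \<theta>k powi_add abs_mult)
    qed
    also have "\<dots> \<le> V * q powi \<bar>k\<bar> * C"
    proof (intro mult_mono C)
      show "\<bar>gauge 1 1 s k * q powi (s * k)\<bar> \<le> V" using V[of "nat (- k)"] False by simp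
      have "(1 - m) * (- k) \<ge> 1 * (- k)" using sm False by (intro mult_right_mono) auto
      then show "q powi ((m - 1) * k) \<le> q powi \<bar>k\<bar>" using False by (simp add: powi_le_iff algebra_simps)
    qed (use V0 in auto)
    also have "\<dots> = (V * C) * q powi \<bar>k\<bar>" by simp
    also have "\<dots> \<le> max (W * (C * q powi (b * e))) (V * C) * q powi \<bar>k\<bar>"
      by (rule mult_right_mono) auto
    finally show ?thesis .
  qed
  then have "decays a" unfolding decays_def by blast
  \<comment> \<open>Here 2e + b = 2d + 2, which is positive as non-vanishing requires.\<close>
  moreover obtain \<kappa> where "U \<kappa> \<noteq> 0"
    using vsum_nonzero[OF \<rho> b, of e] d e unfolding U_def b_def by auto
  moreover have "gauge 1 1 s (\<kappa> - e) \<noteq> 0"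
  proof -
    have "qpoch_inf (- (q powi (2 * j))) > 0" for j by (rule qpoch_inf_pos) (use powi_pos[of "2 * j"] in linarith)
    then show ?thesis unfolding gauge_def mult_1 by (smt (verit) divide_pos_pos real_sqrt_gt_0_iff)
  qed
  ultimately have "decays a" "a (\<kappa> - e) \<noteq> 0" using \<theta> by (auto simp: a_def)
  then show ?thesis using jacobi_sol unfolding has_decaying_sol_def by blast
qed

text \<open>The flip changes the signs of s and m together and \<open>jacobi_sol_minus_m\<close>
  that of m alone, so the quadrant s, m <= 0 reaches all others.\<close>

lemma plus_plus_pos_existence:
  assumes d: "d \<ge> 1" and par: "odd (s + m + d)"
  shows "has_decaying_sol 1 1 s m (q powi (- d) + 1 / q powi (- d))"
proof -
  have m: "has_decaying_sol 1 1 s m (q powi (- d) + 1 / q powi (- d))" if "odd (s + m + d)" "s \<le> 0" for s m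
  proof (cases "m \<le> 0")
    case True
    then show ?thesis using plus_plus_pos_existence_aux[OF d] that by blast
  next
    case False
    then have "has_decaying_sol 1 1 s (- m) (q powi (- d) + 1 / q powi (- d))"
      using that by (intro plus_plus_pos_existence_aux[OF d]) auto
    then obtain a k where a: "jacobi_sol 1 1 s (- m) (q powi (- d) + 1 / q powi (- d)) a" "decays a" "a k \<noteq> 0"
      unfolding has_decaying_sol_def by blast
    then show ?thesis
      unfolding has_decaying_sol_def using jacobi_sol_minus_m[OF a(1)] unfolding minus_minus by blast
  qed
  show ?thesis
  proof (cases "s \<le> 0")
    case True
    then show ?thesis using m par by blast
  next
    case False
    then have "has_decaying_sol 1 1 (- s) (- m) (q powi (- d) + 1 / q powi (- d))"
      using par by (intro m) auto
    then show ?thesis by (rule has_decaying_sol_flip)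
  qed
qed

end

section \<open>Square-summable families\<close>

definition l2 :: "hvec \<Rightarrow> bool" where
  "l2 v \<longleftrightarrow> (\<lambda>i. (cmod (v i))\<^sup>2) summable_on UNIV"

lemma hspace_l2: "v \<in> hspace q \<Longrightarrow> l2 v"
  by (simp add: hspace_def l2_def)

lemma l2_le: "l2 v \<Longrightarrow> (\<And>i. cmod (w i) \<le> cmod (v i)) \<Longrightarrow> l2 w"
  unfolding l2_def by (rule summable_on_comparison_test) (auto intro: power_mono)

lemma hnorm_nonneg [simp]: "hnorm v \<ge> 0"
  by (simp add: hnorm_def infsum_nonneg)

lemma hnorm_sq: "(hnorm v)\<^sup>2 = (\<Sum>\<^sub>\<infinity>i. (cmod (v i))\<^sup>2)"
  by (simp add: hnorm_def infsum_nonneg)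

lemma L2_set_le_hnorm:
  assumes "l2 v" shows "L2_set (\<lambda>i. cmod (v i)) F \<le> hnorm v"
proof (cases "finite F")
  case True
  have "(\<Sum>i\<in>F. (cmod (v i))\<^sup>2) \<le> (\<Sum>\<^sub>\<infinity>i. (cmod (v i))\<^sup>2)"
    using assms True unfolding l2_def by (intro finite_sum_le_infsum) auto
  then show ?thesis by (simp add: L2_set_def hnorm_def)
qed simp

lemma cmod_le_hnorm: "l2 v \<Longrightarrow> cmod (v i) \<le> hnorm v"
  using L2_set_le_hnorm[of v "{i}"] by (simp add: L2_set_def)

text \<open>Norm estimates are carried over from finite index sets, where \<open>L2_set\<close>
  provides the triangle and Cauchy-Schwarz inequalities.\<close>

lemma hnorm_le:
  assumes "C \<ge> 0" "\<And>F. finite F \<Longrightarrow> L2_set (\<lambda>i. cmod (v i)) F \<le> C"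
  shows "l2 v" "hnorm v \<le> C"
proof -
  have le: "(\<Sum>i\<in>F. (cmod (v i))\<^sup>2) \<le> C\<^sup>2" if "finite F" for F
    using assms(2)[OF that] assms(1) by (simp add: L2_set_def sqrt_le_D)
  then have "bdd_above (sum (\<lambda>i. (cmod (v i))\<^sup>2) ` {F. F \<subseteq> UNIV \<and> finite F})"
    by (intro bdd_aboveI2) auto
  then show l: "l2 v" unfolding l2_def by (intro nonneg_bdd_above_summable_on) auto
  have "(hnorm v)\<^sup>2 \<le> C\<^sup>2"
    unfolding hnorm_sq using l le unfolding l2_def by (intro infsum_le_finite_sums) auto
  then show "hnorm v \<le> C" using assms(1) by (rule power2_le_imp_le)
qed

lemma hnorm_add:
  assumes "l2 v" "l2 w"
  shows "l2 (v + w)" "hnorm (v + w) \<le> hnorm v + hnorm w"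
proof -
  have "L2_set (\<lambda>i. cmod ((v + w) i)) F \<le> hnorm v + hnorm w" if "finite F" for F
  proof -
    have "L2_set (\<lambda>i. cmod ((v + w) i)) F \<le> L2_set (\<lambda>i. cmod (v i) + cmod (w i)) F"
      by (intro L2_set_mono) (auto simp: norm_triangle_ineq)
    also have "\<dots> \<le> L2_set (\<lambda>i. cmod (v i)) F + L2_set (\<lambda>i. cmod (w i)) F"
      by (rule L2_set_triangle_ineq)
    also have "\<dots> \<le> hnorm v + hnorm w"
      by (intro add_mono L2_set_le_hnorm assms)
    finally show ?thesis .
  qed
  from hnorm_le[where v = "v + w", OF _ this] show "l2 (v + w)" "hnorm (v + w) \<le> hnorm v + hnorm w" by simp_all
qed

lemma hnorm_mono:
  assumes "l2 v" "\<And>i. cmod (w i) \<le> cmod (v i)" shows "hnorm w \<le> hnorm v"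
proof (rule hnorm_le(2))
  show "L2_set (\<lambda>i. cmod (w i)) F \<le> hnorm v" for F
    by (rule order_trans[OF L2_set_mono L2_set_le_hnorm]) (use assms in auto)
qed simp

lemma l2_scale: "l2 v \<Longrightarrow> l2 (hscale c v)"
  unfolding l2_def hscale_def norm_mult power_mult_distrib by (rule summable_on_cmult_right)

lemma hnorm_scale: "hnorm (hscale c v) = cmod c * hnorm v"
  unfolding hnorm_def hscale_def norm_mult power_mult_distrib infsum_cmult_right'
  by (simp add: real_sqrt_mult)

lemma uminus_hscale: "- v = hscale (- 1) v"
  by (simp add: hscale_def fun_eq_iff)

lemma hnorm_uminus: "hnorm (- v) = hnorm v"
  unfolding uminus_hscale hnorm_scale by simp

lemma hnorm_diff:
  assumes "l2 v" "l2 w"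
  shows "l2 (v - w)" "hnorm (v - w) \<le> hnorm v + hnorm w"
  using hnorm_add[OF assms(1) l2_scale[OF assms(2), of "-1"]]
  by (simp_all add: uminus_hscale[symmetric] hnorm_uminus)

lemma hnorm_0 [simp]: "hnorm 0 = 0"
  by (simp add: hnorm_def)

lemma hnorm_eq_0: "l2 v \<Longrightarrow> hnorm v = 0 \<Longrightarrow> v = 0"
  using cmod_le_hnorm[of v] by (auto simp: fun_eq_iff)

lemma l2_prod:
  assumes "l2 v" "l2 w"
  shows "(\<lambda>i. v i * cnj (w i)) summable_on UNIV"
    and "cmod (hinner v w) \<le> hnorm v * hnorm w"
proof -
  have le: "(\<Sum>i\<in>F. cmod (v i * cnj (w i))) \<le> hnorm v * hnorm w" if "finite F" for F
  proof -
    have "(\<Sum>i\<in>F. cmod (v i * cnj (w i))) = (\<Sum>i\<in>F. \<bar>cmod (v i)\<bar> * \<bar>cmod (w i)\<bar>)"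
      by (simp add: norm_mult)
    also have "\<dots> \<le> L2_set (\<lambda>i. cmod (v i)) F * L2_set (\<lambda>i. cmod (w i)) F"
      by (rule L2_set_mult_ineq)
    also have "\<dots> \<le> hnorm v * hnorm w"
      by (intro mult_mono L2_set_le_hnorm assms) simp_all
    finally show ?thesis .
  qed
  have s: "(\<lambda>i. cmod (v i * cnj (w i))) summable_on UNIV"
    by (rule nonneg_bdd_above_summable_on) (use le in \<open>auto intro!: bdd_aboveI2\<close>)
  then show "(\<lambda>i. v i * cnj (w i)) summable_on UNIV" by (rule abs_summable_summable)
  have "cmod (hinner v w) \<le> (\<Sum>\<^sub>\<infinity>i. cmod (v i * cnj (w i)))"
    unfolding hinner_def by (rule norm_infsum_bound) (use s in simp)
  also have "\<dots> \<le> hnorm v * hnorm w" using s le by (intro infsum_le_finite_sums) auto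
  finally show "cmod (hinner v w) \<le> hnorm v * hnorm w" .
qed

lemma hinner_add_left: "l2 u \<Longrightarrow> l2 v \<Longrightarrow> l2 w \<Longrightarrow> hinner (u + v) w = hinner u w + hinner v w"
  unfolding hinner_def by (subst infsum_add[symmetric]) (auto intro: l2_prod simp: algebra_simps)

lemma hinner_scale_left: "hinner (hscale c u) w = c * hinner u w"
  unfolding hinner_def hscale_def mult.assoc by (rule infsum_cmult_right')

lemma hinner_diff_left: "l2 u \<Longrightarrow> l2 v \<Longrightarrow> l2 w \<Longrightarrow> hinner (u - v) w = hinner u w - hinner v w"
  using hinner_add_left[of u "hscale (-1) v" w] hinner_scale_left[of "-1" v w] l2_scale[of v "-1"]
  by (simp add: uminus_hscale[symmetric])

lemma hinner_commute: "hinner v u = cnj (hinner u v)"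
  unfolding hinner_def infsum_cnj[symmetric] by (simp add: mult.commute)

lemma hinner_add_right: "l2 u \<Longrightarrow> l2 v \<Longrightarrow> l2 w \<Longrightarrow> hinner w (u + v) = hinner w u + hinner w v"
  unfolding hinner_commute[of w "u + v"] hinner_commute[of w u] hinner_commute[of w v] by (simp add: hinner_add_left)

lemma hinner_scale_right: "hinner w (hscale c u) = cnj c * hinner w u"
  unfolding hinner_commute[of w "hscale c u"] hinner_commute[of w u] by (simp add: hinner_scale_left)

lemma hinner_self: "l2 v \<Longrightarrow> hinner v v = of_real ((hnorm v)\<^sup>2)"
proof -
  assume v: "l2 v"
  have "hinner v v = (\<Sum>\<^sub>\<infinity>i. of_real ((cmod (v i))\<^sup>2))"
    unfolding hinner_def by (intro infsum_cong) (simp only: complex_norm_square)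
  then show ?thesis
    unfolding hnorm_sq
    using infsumI[OF has_sum_bounded_linear[OF bounded_linear_of_real has_sum_infsum[OF v[unfolded l2_def]]]]
    by (simp add: o_def)
qed

text \<open>The orthogonal projection onto the families supported in S; it will cut vectors down to
  one block.\<close>

definition restr :: "(int \<times> real \<times> real) set \<Rightarrow> hvec \<Rightarrow> hvec" where
  "restr S v = (\<lambda>i. if i \<in> S then v i else 0)"

lemma restr_l2: "l2 v \<Longrightarrow> l2 (restr S v)"
  by (erule l2_le) (simp add: restr_def)

lemma hnorm_restr: "l2 v \<Longrightarrow> hnorm (restr S v) \<le> hnorm v"
  by (erule hnorm_mono) (simp add: restr_def)

lemma restr_diff: "restr S v - restr S w = restr S (v - w)"
  by (simp add: restr_def fun_eq_iff)

lemma hinner_restr: "hinner (restr S v) w = hinner (restr S v) (restr S w)"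
  unfolding hinner_def by (intro infsum_cong) (simp add: restr_def)

lemma hspace_restr: "v \<in> hspace q \<Longrightarrow> restr S v \<in> hspace q"
  using restr_l2[of v S] by (auto simp: hspace_def l2_def restr_def split: if_splits)

lemma hspace_add: "v \<in> hspace q \<Longrightarrow> w \<in> hspace q \<Longrightarrow> v + w \<in> hspace q"
  unfolding hspace_def using hnorm_add(1)[of v w] unfolding l2_def
  by (auto; metis add.right_neutral)

lemma hspace_scale: "v \<in> hspace q \<Longrightarrow> hscale c v \<in> hspace q"
  using l2_scale[of v c] by (auto simp: hspace_def l2_def) (auto simp: hscale_def)

lemma hspace_diff: "v \<in> hspace q \<Longrightarrow> w \<in> hspace q \<Longrightarrow> v - w \<in> hspace q"
  using hspace_add[of v q "hscale (-1) w"] hspace_scale[of w q "-1"]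
  by (simp add: uminus_hscale[symmetric])

lemma hspace_0: "0 \<in> hspace q"
  by (simp add: hspace_def)

lemma sum_apply_fun: "(\<Sum>i\<in>A. F i) x = (\<Sum>i\<in>A. F i x)" for F :: "'b \<Rightarrow> hvec"
  by (induction A rule: infinite_finite_induct) auto

lemma l2_finite: "finite {i. v i \<noteq> 0} \<Longrightarrow> l2 v"
proof -
  assume "finite {i. v i \<noteq> 0}"
  then have "(\<lambda>i. (cmod (v i))\<^sup>2) summable_on {i. v i \<noteq> 0}" by simp
  then show ?thesis
    unfolding l2_def by (rule summable_on_cong_neutral[THEN iffD1, rotated -1]) auto
qed

lemma hinner_f_vec: "g \<in> hspace q \<Longrightarrow> hinner (f_vec q m p t) g = cnj (g (m, p, t))"
proof -
  assume g: "g \<in> hspace q"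
  have "hinner (f_vec q m p t) g = (\<Sum>\<^sub>\<infinity>i\<in>{(m, p, t)}. f_vec q m p t i * cnj (g i))"
    unfolding hinner_def by (rule infsum_cong_neutral) (auto simp: f_vec_def)
  then show ?thesis using g by (auto simp: f_vec_def hspace_def)
qed

section \<open>The operators in coordinates\<close>

definition fin_supp :: "real \<Rightarrow> hvec \<Rightarrow> bool" where
  "fin_supp q v \<longleftrightarrow> finite {i. v i \<noteq> 0} \<and> (\<forall>m p t. v (m, p, t) \<noteq> 0 \<longrightarrow> p \<in> I_q q \<and> t \<in> I_q q)"

lemma fin_supp_expand:
  assumes v: "fin_supp q v"
  shows "v = (\<Sum>i\<in>{i. v i \<noteq> 0}. hscale (v i) (f_vec q (fst i) (fst (snd i)) (snd (snd i))))"
proof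
  fix x
  have "(\<Sum>i\<in>{i. v i \<noteq> 0}. hscale (v i) (f_vec q (fst i) (fst (snd i)) (snd (snd i)))) x
      = (\<Sum>i\<in>{i. v i \<noteq> 0}. if i = x then v x else 0)"
    unfolding sum_apply_fun
  proof (rule sum.cong)
    fix i assume "i \<in> {i. v i \<noteq> 0}"
    then have "fst (snd i) \<in> I_q q \<and> snd (snd i) \<in> I_q q"
      using v by (cases i) (auto simp: fin_supp_def)
    then show "hscale (v i) (f_vec q (fst i) (fst (snd i)) (snd (snd i))) x = (if i = x then v x else 0)"
      by (auto simp: hscale_def f_vec_def)
  qed simp
  also have "\<dots> = v x" using v by (auto simp: fin_supp_def)
  finally show "v x = (\<Sum>i\<in>{i. v i \<noteq> 0}. hscale (v i) (f_vec q (fst i) (fst (snd i)) (snd (snd i)))) x" ..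
qed

lemma hspace0_iff: "v \<in> hspace0 q \<longleftrightarrow> fin_supp q v"
proof
  have "hvec.subspace {v. fin_supp q v}"
  proof (rule hvec.subspaceI)
    show "0 \<in> {v. fin_supp q v}" by (simp add: fin_supp_def)
    fix x y assume xy: "x \<in> {v. fin_supp q v}" "y \<in> {v. fin_supp q v}"
    have "finite {i. (x + y) i \<noteq> 0}"
      by (rule finite_subset[of _ "{i. x i \<noteq> 0} \<union> {i. y i \<noteq> 0}"]) (use xy in \<open>auto simp: fin_supp_def\<close>)
    moreover have "p \<in> I_q q \<and> t \<in> I_q q" if "(x + y) (m, p, t) \<noteq> 0" for m p t
    proof -
      have "x (m, p, t) \<noteq> 0 \<or> y (m, p, t) \<noteq> 0" using that by auto
      then show ?thesis using xy by (auto simp: fin_supp_def)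
    qed
    ultimately show "x + y \<in> {v. fin_supp q v}" by (simp add: fin_supp_def)
  next
    fix c x assume x: "x \<in> {v. fin_supp q v}"
    have "finite {i. hscale c x i \<noteq> 0}"
      by (rule finite_subset[of _ "{i. x i \<noteq> 0}"]) (use x in \<open>auto simp: fin_supp_def hscale_def\<close>)
    then show "hscale c x \<in> {v. fin_supp q v}" using x by (auto simp: fin_supp_def hscale_def)
  qed
  moreover have "fin_supp q (f_vec q m p t)" for m p t
    unfolding fin_supp_def by (auto simp: f_vec_def intro: finite_subset[of _ "{(m, p, t)}"])
  ultimately have "hspace0 q \<subseteq> {v. fin_supp q v}"
    unfolding hspace0_def by (intro hvec.span_minimal) auto
  then show "v \<in> hspace0 q \<Longrightarrow> fin_supp q v" by blast
next
  assume v: "fin_supp q v"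
  note eq = fin_supp_expand[OF v]
  have mem: "hscale (v i) (f_vec q (fst i) (fst (snd i)) (snd (snd i))) \<in> hspace0 q" if "v i \<noteq> 0" for i
  proof -
    have "fst (snd i) \<in> I_q q \<and> snd (snd i) \<in> I_q q"
      using v that by (cases i) (auto simp: fin_supp_def)
    then show ?thesis unfolding hspace0_def by (intro hvec.span_scale hvec.span_base) auto
  qed
  show "v \<in> hspace0 q"
    by (subst eq, unfold hspace0_def, rule hvec.span_sum) (use mem in \<open>simp add: hspace0_def\<close>)
qed

lemma fin_supp_hspace: "fin_supp q v \<Longrightarrow> v \<in> hspace q"
  using l2_finite[of v] unfolding fin_supp_def hspace_def l2_def by auto

definition E_coeff_t :: "real \<Rightarrow> int \<times> real \<times> real \<Rightarrow> real" where
  "E_coeff_t q = (\<lambda>(m, p, t). inverse (q - inverse q) * (sgn t * q powr (- (of_int m - 1) / 2) * \<bar>p / t\<bar> powr (1/2) * sqrt (1 + kappa (inverse q * t))))"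

definition E_coeff_p :: "real \<Rightarrow> int \<times> real \<times> real \<Rightarrow> real" where
  "E_coeff_p q = (\<lambda>(m, p, t). inverse (q - inverse q) * (sgn p * q powr ((of_int m - 1) / 2) * \<bar>t / p\<bar> powr (1/2) * sqrt (1 + kappa p)))"

definition K_coeff :: "real \<Rightarrow> int \<times> real \<times> real \<Rightarrow> real" where
  "K_coeff q = (\<lambda>(m, p, t). q powr (- of_int m / 2) * \<bar>p / t\<bar> powr (1/2))"

text \<open>E is read off at the target: the coordinate (n, p, t) of the image is fed only by (n+1,
  p, qt) and (n+1, p/q, t). In this form it applies to every family, in the domain or not, and can
  be compared with the closure.\<close>

definition E_apply :: "real \<Rightarrow> hvec \<Rightarrow> hvec" where
  "E_apply q v = (\<lambda>(n, p, t). if p \<in> I_q q \<and> t \<in> I_q q then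
     of_real (E_coeff_t q (n + 1, p, q * t)) * v (n + 1, p, q * t) - of_real (E_coeff_p q (n + 1, p / q, t)) * v (n + 1, p / q, t) else 0)"

lemma E_apply_apply: "E_apply q v (n, p, t) = (if p \<in> I_q q \<and> t \<in> I_q q then
     of_real (E_coeff_t q (n + 1, p, q * t)) * v (n + 1, p, q * t) - of_real (E_coeff_p q (n + 1, p / q, t)) * v (n + 1, p / q, t) else 0)"
  by (simp add: E_apply_def)

context unit_q begin

definition E_basis :: "int \<times> real \<times> real \<Rightarrow> hvec" where
  "E_basis = (\<lambda>(m, p, t). hscale (of_real (E_coeff_t q (m, p, t))) (f_vec q (m - 1) p (inverse q * t))
      - hscale (of_real (E_coeff_p q (m, p, t))) (f_vec q (m - 1) (q * p) t))"

lemma E0_op_alt: "E0_op q = op_of_basis q E_basis"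
proof -
  have "(\<lambda>(m, p, t). hscale (of_real (inverse (q - inverse q)))
     (hscale (of_real (sgn t * q powr (- (of_int m - 1) / 2) * \<bar>p / t\<bar> powr (1/2)
                         * sqrt (1 + kappa (inverse q * t))))
             (f_vec q (m - 1) p (inverse q * t))
      - hscale (of_real (sgn p * q powr ((of_int m - 1) / 2) * \<bar>t / p\<bar> powr (1/2)
                         * sqrt (1 + kappa p)))
             (f_vec q (m - 1) (q * p) t))) = E_basis"
    unfolding E_basis_def E_coeff_t_def E_coeff_p_def
    by (intro ext, clarify) (simp add: hscale_def algebra_simps del: of_real_inverse)
  then show ?thesis unfolding E0_op_def by simp
qed

lemma E_basis_sum:
  assumes "fin_supp q v"
  shows "(\<Sum>i | v i \<noteq> 0. hscale (v i) (E_basis i)) = E_apply q v"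
proof
  fix j :: "int \<times> real \<times> real"
  obtain n p t where j: "j = (n, p, t)" by (cases j)
  have fin: "finite {i. v i \<noteq> 0}" using assms by (simp add: fin_supp_def)
  have "(\<Sum>i | v i \<noteq> 0. hscale (v i) (E_basis i)) j = (\<Sum>i | v i \<noteq> 0. v i * E_basis i j)"
    by (simp add: sum_apply_fun hscale_def)
  also have "\<dots> = (\<Sum>i | v i \<noteq> 0. (if i = (n + 1, p, q * t) then (if p \<in> I_q q \<and> t \<in> I_q q then of_real (E_coeff_t q i) * v i else 0) else 0)
      - (if i = (n + 1, p / q, t) then (if p \<in> I_q q \<and> t \<in> I_q q then of_real (E_coeff_p q i) * v i else 0) else 0))"
  proof (rule sum.cong)
    fix i :: "int \<times> real \<times> real"
    obtain m p' t' where i: "i = (m, p', t')" by (cases i)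
    have "(n, p, t) = (m - 1, p', inverse q * t') \<longleftrightarrow> i = (n + 1, p, q * t)" "(n, p, t) = (m - 1, q * p', t') \<longleftrightarrow> i = (n + 1, p / q, t)"
      by (auto simp: i field_simps)
    then have f: "f_vec q (m - 1) p' (inverse q * t') j = (if i = (n + 1, p, q * t) \<and> p \<in> I_q q \<and> t \<in> I_q q then 1 else 0)"
      "f_vec q (m - 1) (q * p') t' j = (if i = (n + 1, p / q, t) \<and> p \<in> I_q q \<and> t \<in> I_q q then 1 else 0)"
      unfolding f_vec_def j by auto
    have "E_basis i j = of_real (E_coeff_t q i) * f_vec q (m - 1) p' (inverse q * t') j - of_real (E_coeff_p q i) * f_vec q (m - 1) (q * p') t' j"
      by (simp add: E_basis_def i hscale_def)
    moreover have "x * (A * (if P \<and> I \<and> J then 1 else 0) - B * (if Q \<and> I \<and> J then 1 else 0))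
      = (if P then (if I \<and> J then A * x else 0) else 0) - (if Q then (if I \<and> J then B * x else 0) else 0)" for x A B :: complex and P Q I J
      by (auto simp: algebra_simps)
    ultimately show "v i * E_basis i j = (if i = (n + 1, p, q * t) then (if p \<in> I_q q \<and> t \<in> I_q q then of_real (E_coeff_t q i) * v i else 0) else 0)
      - (if i = (n + 1, p / q, t) then (if p \<in> I_q q \<and> t \<in> I_q q then of_real (E_coeff_p q i) * v i else 0) else 0)"
      unfolding f by simp
  qed simp
  also have "\<dots> = E_apply q v j"
    unfolding sum_subtractf sum.delta[OF fin] by (auto simp: j E_apply_apply)
  finally show "(\<Sum>i | v i \<noteq> 0. hscale (v i) (E_basis i)) j = E_apply q v j" .
qed

lemma E0_iff: "(v, w) \<in> E0_op q \<longleftrightarrow> fin_supp q v \<and> w = E_apply q v"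
  unfolding E0_op_alt op_of_basis_def hspace0_iff using E_basis_sum by auto

lemma fin_supp_Ept:
  assumes "fin_supp q v" shows "fin_supp q (E_apply q v)"
proof -
  have "{j. E_apply q v j \<noteq> 0} \<subseteq> (\<lambda>(m, p, t). (m - 1, p, t / q)) ` {i. v i \<noteq> 0} \<union> (\<lambda>(m, p, t). (m - 1, q * p, t)) ` {i. v i \<noteq> 0}"
  proof
    fix j assume j: "j \<in> {j. E_apply q v j \<noteq> 0}"
    obtain n p t where jj: "j = (n, p, t)" by (cases j)
    have "v (n + 1, p, q * t) \<noteq> 0 \<or> v (n + 1, p / q, t) \<noteq> 0"
      using j by (auto simp: jj E_apply_apply split: if_splits)
    then show "j \<in> (\<lambda>(m, p, t). (m - 1, p, t / q)) ` {i. v i \<noteq> 0} \<union> (\<lambda>(m, p, t). (m - 1, q * p, t)) ` {i. v i \<noteq> 0}"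
    proof
      assume "v (n + 1, p, q * t) \<noteq> 0"
      then show ?thesis by (intro UnI1 image_eqI[of _ _ "(n + 1, p, q * t)"]) (auto simp: jj)
    next
      assume "v (n + 1, p / q, t) \<noteq> 0"
      then show ?thesis by (intro UnI2 image_eqI[of _ _ "(n + 1, p / q, t)"]) (auto simp: jj)
    qed
  qed
  moreover have "finite {i. v i \<noteq> 0}" using assms by (simp add: fin_supp_def)
  ultimately have "finite {j. E_apply q v j \<noteq> 0}" by (meson finite_UnI finite_imageI finite_subset)
  then show ?thesis by (auto simp: fin_supp_def E_apply_apply split: if_splits)
qed

lemma E_apply_diff: "E_apply q (v - w) = E_apply q v - E_apply q w"
  by (auto simp: fun_eq_iff E_apply_apply algebra_simps)

lemma tendsto_zero_imp_eq: "(\<And>r. r > 0 \<Longrightarrow> cmod (x - y) \<le> M * r) \<Longrightarrow> x = y" if "M \<ge> 0" for x y :: complex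
proof -
  assume a: "\<And>r. r > 0 \<Longrightarrow> cmod (x - y) \<le> M * r"
  have "cmod (x - y) \<le> 0 + r" if "r > 0" for r
  proof -
    have "cmod (x - y) \<le> M * (r / (M + 1))" using that \<open>M \<ge> 0\<close> by (intro a) simp
    also have "\<dots> \<le> r" using that \<open>M \<ge> 0\<close> by (simp add: divide_le_eq field_simps)
    finally show ?thesis by simp
  qed
  then have "cmod (x - y) \<le> 0" by (rule field_le_epsilon)
  then show ?thesis by simp
qed

text \<open>Norm convergence implies convergence of each coordinate, and a coordinate of
  \<open>E_apply\<close> involves only two coordinates of its argument; so the formula survives the
  closure.\<close>

lemma E_op_pointwise:
  assumes "(v, w) \<in> E_op q" shows "w = E_apply q v"
proof
  fix j :: "int \<times> real \<times> real"
  obtain n p t where j: "j = (n, p, t)" by (cases j)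
  define M where "M = \<bar>E_coeff_t q (n + 1, p, q * t)\<bar> + \<bar>E_coeff_p q (n + 1, p / q, t)\<bar> + 1"
  have vw: "v \<in> hspace q" "w \<in> hspace q" using assms by (auto simp: E_op_def op_closure_def)
  show "w j = E_apply q v j"
  proof (rule tendsto_zero_imp_eq[where M = M])
    show "M \<ge> 0" by (simp add: M_def)
    fix r :: real assume r: "r > 0"
    obtain v' w' where a: "(v', w') \<in> E0_op q" "hnorm (v - v') < r" "hnorm (w - w') < r"
      using assms r unfolding E_op_def op_closure_def by blast
    then have w': "w' = E_apply q v'" and fs: "fin_supp q v'" by (auto simp: E0_iff)
    have l: "l2 (v - v')" "l2 (w - w')"
      unfolding w' using hnorm_diff(1)[OF hspace_l2[OF vw(1)] hspace_l2[OF fin_supp_hspace[OF fs]]]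
        hnorm_diff(1)[OF hspace_l2[OF vw(2)] hspace_l2[OF fin_supp_hspace[OF fin_supp_Ept[OF fs]]]] by auto
    have 1: "cmod (v i - v' i) \<le> r" for i using cmod_le_hnorm[OF l(1), of i] a(2) by simp
    have "cmod (E_apply q (v - v') j) \<le> (M - 1) * r"
    proof (cases "p \<in> I_q q \<and> t \<in> I_q q")
      case True
      have "cmod (E_apply q (v - v') j) \<le> \<bar>E_coeff_t q (n + 1, p, q * t)\<bar> * cmod (v (n + 1, p, q * t) - v' (n + 1, p, q * t)) + \<bar>E_coeff_p q (n + 1, p / q, t)\<bar> * cmod (v (n + 1, p / q, t) - v' (n + 1, p / q, t))"
        using True by (simp add: j E_apply_apply) (rule order_trans[OF norm_triangle_ineq4], simp add: norm_mult)
      also have "\<dots> \<le> \<bar>E_coeff_t q (n + 1, p, q * t)\<bar> * r + \<bar>E_coeff_p q (n + 1, p / q, t)\<bar> * r"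
        by (intro add_mono mult_left_mono 1) auto
      finally show ?thesis by (simp add: M_def algebra_simps)
    next
      case False
      then have "E_apply q (v - v') j = 0" by (auto simp: j E_apply_apply)
      then show ?thesis using r by (simp add: M_def)
    qed
    moreover have "cmod (w j - w' j) \<le> r" using cmod_le_hnorm[OF l(2), of j] a(3) by simp
    moreover have eq: "w j - E_apply q v j = (w j - w' j) - E_apply q (v - v') j" by (simp add: E_apply_diff w')
    have "cmod (w j - E_apply q v j) \<le> cmod (w j - w' j) + cmod (E_apply q (v - v') j)"
      unfolding eq by (rule norm_triangle_ineq4)
    ultimately have "cmod (w j - E_apply q v j) \<le> r + (M - 1) * r"
      by linarith
    then show "cmod (w j - E_apply q v j) \<le> M * r" by (simp add: algebra_simps)
  qed
qed

lemma E0_sub_E: "fin_supp q v \<Longrightarrow> (v, E_apply q v) \<in> E_op q"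
  unfolding E_op_def op_closure_def
  by (auto intro!: fin_supp_hspace fin_supp_Ept bexI[of _ "(v, E_apply q v)"] simp: E0_iff)

text \<open>The basis vectors lie in the domain of E, and testing the defining identity of the
  adjoint on them isolates one coordinate. The coefficients are real, so no conjugates
  remain.\<close>

lemma adjoint_pointwise:
  assumes "(g, z) \<in> op_adjoint q (E_op q)" "p \<in> I_q q" "t \<in> I_q q"
  shows "z (m, p, t) = of_real (E_coeff_t q (m, p, t)) * g (m - 1, p, t / q) - of_real (E_coeff_p q (m, p, t)) * g (m - 1, q * p, t)"
proof -
  have gz: "g \<in> hspace q" "z \<in> hspace q" using assms(1) by (auto simp: op_adjoint_def)
  have fs: "fin_supp q (f_vec q m p t)"
    unfolding fin_supp_def by (auto simp: f_vec_def intro: finite_subset[of _ "{(m, p, t)}"])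
  have fsu: "fin_supp q (f_vec q m' p' t')" for m' p' t'
    unfolding fin_supp_def by (auto simp: f_vec_def intro: finite_subset[of _ "{(m', p', t')}"])
  have l: "l2 (f_vec q m' p' t')" for m' p' t' by (rule hspace_l2[OF fin_supp_hspace[OF fsu]])
  have supp: "{i. f_vec q m p t i \<noteq> 0} = {(m, p, t)}" using assms by (auto simp: f_vec_def)
  have E: "E_apply q (f_vec q m p t) = E_basis (m, p, t)"
    unfolding E_basis_sum[OF fs, symmetric] supp using assms by (simp add: f_vec_def[of q m p t] hscale_def)
  have "hinner (E_apply q (f_vec q m p t)) g = hinner (f_vec q m p t) z"
    using assms(1) E0_sub_E[OF fs] by (auto simp: op_adjoint_def)
  then have "cnj (z (m, p, t)) = of_real (E_coeff_t q (m, p, t)) * cnj (g (m - 1, p, inverse q * t)) - of_real (E_coeff_p q (m, p, t)) * cnj (g (m - 1, q * p, t))"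
    unfolding E E_basis_def
    by (simp add: hinner_diff_left l2_scale l hspace_l2[OF gz(1)] hinner_scale_left hinner_f_vec gz)
  then have "cnj (cnj (z (m, p, t))) = cnj (of_real (E_coeff_t q (m, p, t)) * cnj (g (m - 1, p, inverse q * t)) - of_real (E_coeff_p q (m, p, t)) * cnj (g (m - 1, q * p, t)))"
    by (rule arg_cong)
  then show ?thesis by (simp add: field_simps)
qed

lemma hnorm_small_0: "v \<in> hspace q \<Longrightarrow> w \<in> hspace q \<Longrightarrow> cmod (v i - w i) \<le> hnorm (v - w)"
  using cmod_le_hnorm[OF hnorm_diff(1)[OF hspace_l2 hspace_l2], of v q w q i] by simp

lemma K0_iff: "(v, w) \<in> K0_op q \<longleftrightarrow> fin_supp q v \<and> w = (\<lambda>i. of_real (K_coeff q i) * v i)"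
proof -
  have "(\<Sum>i | v i \<noteq> 0. hscale (v i) ((\<lambda>(m, p, t). hscale (of_real (q powr (- of_int m / 2) * \<bar>p / t\<bar> powr (1/2))) (f_vec q m p t)) i)) = (\<lambda>i. of_real (K_coeff q i) * v i)"
    if v: "fin_supp q v" for v
  proof
    fix j :: "int \<times> real \<times> real"
    have fin: "finite {i. v i \<noteq> 0}" using v by (simp add: fin_supp_def)
    have "(\<Sum>i | v i \<noteq> 0. hscale (v i) ((\<lambda>(m, p, t). hscale (of_real (q powr (- of_int m / 2) * \<bar>p / t\<bar> powr (1/2))) (f_vec q m p t)) i)) j
      = (\<Sum>i | v i \<noteq> 0. if i = j then of_real (K_coeff q i) * v i else 0)"
      unfolding sum_apply_fun
    proof (rule sum.cong)
      fix i assume i: "i \<in> {i. v i \<noteq> 0}"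
      obtain m p t where ii: "i = (m, p, t)" by (cases i)
      have "p \<in> I_q q \<and> t \<in> I_q q" using v i by (auto simp: ii fin_supp_def)
      then show "hscale (v i) ((\<lambda>(m, p, t). hscale (of_real (q powr (- of_int m / 2) * \<bar>p / t\<bar> powr (1/2))) (f_vec q m p t)) i) j = (if i = j then of_real (K_coeff q i) * v i else 0)"
        by (auto simp: ii hscale_def f_vec_def K_coeff_def)
    qed simp
    also have "\<dots> = of_real (K_coeff q j) * v j" using fin by simp
    finally show "(\<Sum>i | v i \<noteq> 0. hscale (v i) ((\<lambda>(m, p, t). hscale (of_real (q powr (- of_int m / 2) * \<bar>p / t\<bar> powr (1/2))) (f_vec q m p t)) i)) j = of_real (K_coeff q j) * v j" .
  qed
  then show ?thesis unfolding K0_op_def op_of_basis_def hspace0_iff by auto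
qed

lemma K_op_pointwise:
  assumes "(v, w) \<in> K_op q" shows "w i = of_real (K_coeff q i) * v i"
proof (rule tendsto_zero_imp_eq[where M = "\<bar>K_coeff q i\<bar> + 1"])
  have vw: "v \<in> hspace q" "w \<in> hspace q" using assms by (auto simp: K_op_def op_closure_def)
  fix r :: real assume r: "r > 0"
  obtain v' w' where a: "(v', w') \<in> K0_op q" "hnorm (v - v') < r" "hnorm (w - w') < r"
    using assms r unfolding K_op_def op_closure_def by blast
  then have w': "w' = (\<lambda>i. of_real (K_coeff q i) * v' i)" and fs: "fin_supp q v'" by (auto simp: K0_iff)
  have "fin_supp q w'" using fs unfolding w' fin_supp_def by (auto elim: rev_finite_subset)
  then have "cmod (w i - w' i) \<le> r" "cmod (v i - v' i) \<le> r"
    using hnorm_small_0[OF vw(2) fin_supp_hspace, of w' i] hnorm_small_0[OF vw(1) fin_supp_hspace[OF fs], of i] a by auto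
  moreover have eq: "w i - of_real (K_coeff q i) * v i = (w i - w' i) - of_real (K_coeff q i) * (v i - v' i)"
    by (simp add: w' algebra_simps)
  have "cmod (w i - of_real (K_coeff q i) * v i) \<le> cmod (w i - w' i) + cmod (of_real (K_coeff q i) * (v i - v' i))"
    unfolding eq by (rule norm_triangle_ineq4)
  then have "cmod (w i - of_real (K_coeff q i) * v i) \<le> cmod (w i - w' i) + \<bar>K_coeff q i\<bar> * cmod (v i - v' i)"
    by (simp add: norm_mult)
  moreover have "\<bar>K_coeff q i\<bar> * cmod (v i - v' i) \<le> \<bar>K_coeff q i\<bar> * r"
    using calculation(2) by (intro mult_left_mono) auto
  ultimately show "cmod (w i - of_real (K_coeff q i) * v i) \<le> (\<bar>K_coeff q i\<bar> + 1) * r"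
    by (simp add: algebra_simps)
qed simp

end

lemma truncation:
  assumes "l2 v" "r > 0"
  obtains F where "finite F" "hnorm (v - restr F v) < r"
proof -
  have s: "(\<lambda>i. (cmod (v i))\<^sup>2) summable_on UNIV" using assms by (simp add: l2_def)
  have "0 < (r / 2)\<^sup>2" using assms by simp
  then obtain F where F: "finite F" "dist (\<Sum>i\<in>F. (cmod (v i))\<^sup>2) (\<Sum>\<^sub>\<infinity>i. (cmod (v i))\<^sup>2) \<le> (r / 2)\<^sup>2"
    using infsum_finite_approximation[OF s] by blast
  have "(hnorm (v - restr F v))\<^sup>2 = (\<Sum>\<^sub>\<infinity>i\<in>UNIV - F. (cmod (v i))\<^sup>2)"
    unfolding hnorm_sq by (rule infsum_cong_neutral) (auto simp: restr_def)
  also have "\<dots> = (\<Sum>\<^sub>\<infinity>i. (cmod (v i))\<^sup>2) - (\<Sum>i\<in>F. (cmod (v i))\<^sup>2)"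
    using F(1) s by (subst infsum_Diff) auto
  also have "\<dots> \<le> (r / 2)\<^sup>2" using F(2) by (simp add: dist_real_def)
  finally have le: "(hnorm (v - restr F v))\<^sup>2 \<le> (r / 2)\<^sup>2" .
  have "hnorm (v - restr F v) \<le> r / 2"
    by (rule power2_le_imp_le[OF le]) (use assms(2) in simp)
  then show ?thesis using that[OF F(1)] assms by simp
qed

lemma fin_supp_restr: "v \<in> hspace q \<Longrightarrow> finite F \<Longrightarrow> fin_supp q (restr F v)"
  unfolding fin_supp_def hspace_def by (auto simp: restr_def elim: rev_finite_subset split: if_splits)

lemma fin_supp_restr': "fin_supp q v \<Longrightarrow> fin_supp q (restr S v)"
  unfolding fin_supp_def by (auto simp: restr_def elim: rev_finite_subset split: if_splits)

section \<open>One block K(p, m, eps, eta) and its coordinates\<close>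

locale block = unit_q +
  fixes a m :: int and \<epsilon> \<eta> :: real
  assumes \<epsilon>: "\<epsilon> \<in> {-1, 1}" and \<eta>: "\<eta> \<in> {-1, 1}"
begin

definition s :: int where "s = m + a"

text \<open>Membership of the labels in I_q is left out on purpose: without it the shifts by q are
  equivalences between \<open>S n\<close> and \<open>S (n + 1)\<close>, so E carries one support
  into the other without edge cases.\<close>

definition S :: "int \<Rightarrow> (int \<times> real \<times> real) set" where
  "S n = {(n', p, t). n' = - n \<and> p = \<epsilon> * \<eta> * q powi n * q powi a * t \<and> sgn t = \<epsilon>}"

text \<open>\<open>k\<close> numbers the labels \<open>z = \<epsilon> q^k\<close>; for \<open>p = q^a\<close> the other two labels are then determined.\<close>

definition idx :: "int \<Rightarrow> int \<Rightarrow> int \<times> real \<times> real" where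
  "idx n k = (- n, \<eta> * q powi (n + a + k), \<epsilon> * q powi k)"

lemma sq_signs [simp]: "\<epsilon> * \<epsilon> = 1" "\<eta> * \<eta> = 1" "\<epsilon> * (\<epsilon> * x) = x" "\<eta> * (\<eta> * x) = x" "\<epsilon> \<noteq> 0" "\<eta> \<noteq> 0" "\<bar>\<epsilon>\<bar> = 1" "\<bar>\<eta>\<bar> = 1"
  using \<epsilon> \<eta> by auto

lemma sgn_signs [simp]: "sgn \<epsilon> = \<epsilon>" "sgn \<eta> = \<eta>"
  using \<epsilon> \<eta> by auto

lemma I_q_iff: "\<theta> \<in> {-1, 1} \<Longrightarrow> \<theta> * q powi k \<in> I_q q \<longleftrightarrow> \<theta> = 1 \<or> k \<ge> 1"
proof -
  assume \<theta>: "\<theta> \<in> {-1, 1}"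
  show ?thesis
  proof (cases "\<theta> = 1")
    case True
    then show ?thesis by (auto simp: I_q_def q_ints_def)
  next
    case False
    then have \<theta>: "\<theta> = -1" using \<theta> by auto
    have "- (q powi k) \<in> I_q q \<longleftrightarrow> k \<ge> 1"
    proof
      assume "- (q powi k) \<in> I_q q"
      then consider n where "q powi k = q ^ n" "n \<ge> 1" | j where "- (q powi k) = q powi j"
        by (auto simp: I_q_def q_ints_def)
      then show "k \<ge> 1"
      proof cases
        case 1
        then have "q powi k = q powi (int n)" by simp
        then show ?thesis using 1(2) by (simp add: powi_eq_iff del: power_int_of_nat)
      next
        case 2
        then show ?thesis using powi_pos[of k] powi_pos[of j] by linarith
      qed
    next
      assume "k \<ge> 1"
      then have "q powi k = q ^ nat k" "nat k \<ge> 1" using power_int_of_nat[of q "nat k"] by auto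
      then show "- (q powi k) \<in> I_q q"
        unfolding I_q_def by (intro UnI1 CollectI exI[of _ "nat k"]) simp
    qed
    then show ?thesis using \<theta> by simp
  qed
qed

lemma I_q_cases: "t \<in> I_q q \<Longrightarrow> \<exists>k. t = sgn t * q powi k"
proof -
  assume "t \<in> I_q q"
  then consider n where "t = - (q ^ n)" "n \<ge> 1" | k where "t = q powi k"
    by (auto simp: I_q_def q_ints_def)
  then show ?thesis
  proof cases
    case 1
    then have "sgn t = -1" using q_pos by simp
    then show ?thesis using 1 by (intro exI[of _ "int n"]) simp
  next
    case 2
    then have "sgn t = 1" by simp
    then show ?thesis using 2 by (intro exI[of _ k]) simp
  qed
qed

lemma idx_I: "idx n k = (n', p, t) \<Longrightarrow> p \<in> I_q q \<and> t \<in> I_q q \<longleftrightarrow> in_range \<epsilon> \<eta> (n + a) k"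
  using I_q_iff[OF \<epsilon>, of k] I_q_iff[OF \<eta>, of "n + a + k"] by (auto simp: idx_def in_range_def)

lemma idx_S: "idx n k \<in> S n"
  unfolding idx_def S_def by (simp add: powi_add mult_ac sgn_mult)

lemma S_idx: "(n', p, t) \<in> S n \<Longrightarrow> t \<in> I_q q \<Longrightarrow> \<exists>k. (n', p, t) = idx n k"
  using I_q_cases[of t] by (auto simp: S_def idx_def powi_add mult_ac)

lemma idx_eq_iff [simp]: "idx n k = idx n k' \<longleftrightarrow> k = k'"
  by (auto simp: idx_def powi_eq_iff)

lemma idx_shift: "idx n k = (- n, p, t) \<Longrightarrow> idx (n + 1) (k - 1) = (- n - 1, p, t / q) \<and> idx (n + 1) k = (- n - 1, q * p, t)"
  by (auto simp: idx_def powi_add powi_diff algebra_simps)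

lemma S_shift: "(n' + 1, p, q * t) \<in> S n \<longleftrightarrow> (n', p, t) \<in> S (n + 1)" "(n' + 1, p / q, t) \<in> S n \<longleftrightarrow> (n', p, t) \<in> S (n + 1)"
  using q_pos by (auto simp: S_def powi_add sgn_mult field_simps)

lemma S_shift': "(n' - 1, p, t / q) \<in> S (n + 1) \<longleftrightarrow> (n', p, t) \<in> S n" "(n' - 1, q * p, t) \<in> S (n + 1) \<longleftrightarrow> (n', p, t) \<in> S n"
  using q_pos by (auto simp: S_def powi_add sgn_divide field_simps)

lemma E_apply_restr: "E_apply q (restr (S n) v) = restr (S (n + 1)) (E_apply q v)"
  by (auto simp: fun_eq_iff E_apply_apply restr_def S_shift)

text \<open>The projections onto blocks intertwine with E on finitely supported families and do not
  increase norms, so approximating pairs can be projected.\<close>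

lemma E_op_restr:
  assumes "(v, h) \<in> E_op q"
  shows "(restr (S n) v, restr (S (n + 1)) h) \<in> E_op q"
proof -
  have vh: "v \<in> hspace q" "h \<in> hspace q" using assms by (auto simp: E_op_def op_closure_def)
  have "\<exists>(v', h')\<in>E0_op q. hnorm (restr (S n) v - v') < r \<and> hnorm (restr (S (n + 1)) h - h') < r" if r: "r > 0" for r
  proof -
    obtain v' h' where 1: "(v', h') \<in> E0_op q" "hnorm (v - v') < r" "hnorm (h - h') < r"
      using assms r unfolding E_op_def op_closure_def by blast
    then have h': "h' = E_apply q v'" and fs: "fin_supp q v'" by (auto simp: E0_iff)
    have l: "l2 (v - v')" "l2 (h - h')"
      unfolding h' using hnorm_diff(1)[OF hspace_l2[OF vh(1)] hspace_l2[OF fin_supp_hspace[OF fs]]]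
        hnorm_diff(1)[OF hspace_l2[OF vh(2)] hspace_l2[OF fin_supp_hspace[OF fin_supp_Ept[OF fs]]]] by auto
    have "(restr (S n) v', restr (S (n + 1)) h') \<in> E0_op q"
      using fin_supp_restr'[OF fs] by (auto simp: E0_iff h' E_apply_restr)
    moreover have "hnorm (restr (S n) v - restr (S n) v') < r" "hnorm (restr (S (n + 1)) h - restr (S (n + 1)) h') < r"
      unfolding restr_diff using hnorm_restr[OF l(1)] hnorm_restr[OF l(2)] 1 by (meson le_less_trans)+
    ultimately show ?thesis by blast
  qed
  then show ?thesis
    using vh unfolding E_op_def op_closure_def by (auto intro: hspace_restr)
qed

text \<open>Evaluation at an index is continuous, so closing the span cannot enlarge the support;
  conversely, finite truncations of a supported family lie in the span and converge to it.\<close>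

lemma K_sub_iff: "v \<in> K_sub q (q powi a) m \<epsilon> \<eta> \<longleftrightarrow> v \<in> hspace q \<and> (\<forall>i. v i \<noteq> 0 \<longrightarrow> i \<in> S m)"
proof -
  define B where "B = {f_vec q (- m) (\<epsilon> * \<eta> * q powi m * q powi a * z) z | z.
        z \<in> I_q q \<and> sgn z = \<epsilon> \<and> \<epsilon> * \<eta> * q powi m * q powi a * z \<in> I_q q}"
  have Ks: "K_sub q (q powi a) m \<epsilon> \<eta> = hclosure q (hvec.span B)"
    by (simp add: K_sub_def closed_span_def B_def)
  have sub: "hvec.span B \<subseteq> {w. fin_supp q w \<and> (\<forall>i. w i \<noteq> 0 \<longrightarrow> i \<in> S m)}"
  proof (rule hvec.span_minimal)
    have inter: "hspace0 q \<inter> {w. \<forall>i. w i \<noteq> 0 \<longrightarrow> i \<in> S m} = {w. fin_supp q w \<and> (\<forall>i. w i \<noteq> 0 \<longrightarrow> i \<in> S m)}"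
      by (auto simp: hspace0_iff)
    have sp: "hvec.subspace {w. \<forall>i. w i \<noteq> 0 \<longrightarrow> i \<in> S m}"
    proof (rule hvec.subspaceI)
      show "0 \<in> {w :: hvec. \<forall>i. w i \<noteq> 0 \<longrightarrow> i \<in> S m}" by simp
      fix x y :: hvec
      assume xy: "x \<in> {w. \<forall>i. w i \<noteq> 0 \<longrightarrow> i \<in> S m}" "y \<in> {w. \<forall>i. w i \<noteq> 0 \<longrightarrow> i \<in> S m}"
      have "x i \<noteq> 0 \<or> y i \<noteq> 0" if "(x + y) i \<noteq> 0" for i using that by auto
      then show "x + y \<in> {w. \<forall>i. w i \<noteq> 0 \<longrightarrow> i \<in> S m}" using xy by blast
    next
      fix c and x :: hvec
      assume x: "x \<in> {w. \<forall>i. w i \<noteq> 0 \<longrightarrow> i \<in> S m}"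
      have "x i \<noteq> 0" if "hscale c x i \<noteq> 0" for i using that by (simp add: hscale_def)
      then show "hscale c x \<in> {w. \<forall>i. w i \<noteq> 0 \<longrightarrow> i \<in> S m}" using x by blast
    qed
    have "hvec.subspace (hspace0 q)"
      unfolding hspace0_def by (rule hvec.subspace_span)
    from hvec.subspace_inter[OF this sp]
    show "hvec.subspace {w. fin_supp q w \<and> (\<forall>i. w i \<noteq> 0 \<longrightarrow> i \<in> S m)}"
      unfolding inter .
    have fs: "fin_supp q (f_vec q m' p' t')" for m' p' t'
      unfolding fin_supp_def by (auto simp: f_vec_def intro: finite_subset[of _ "{(m', p', t')}"])
    show "B \<subseteq> {w. fin_supp q w \<and> (\<forall>i. w i \<noteq> 0 \<longrightarrow> i \<in> S m)}"
    proof
      fix w assume "w \<in> B"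
      then obtain z where z: "w = f_vec q (- m) (\<epsilon> * \<eta> * q powi m * q powi a * z) z" "sgn z = \<epsilon>"
        unfolding B_def by blast
      have "(- m, \<epsilon> * \<eta> * q powi m * q powi a * z, z) \<in> S m" using z(2) by (simp add: S_def)
      moreover have "i = (- m, \<epsilon> * \<eta> * q powi m * q powi a * z, z)" if "w i \<noteq> 0" for i
        using that unfolding z(1) f_vec_def by presburger
      ultimately show "w \<in> {w. fin_supp q w \<and> (\<forall>i. w i \<noteq> 0 \<longrightarrow> i \<in> S m)}"
        using fs unfolding z(1) by blast
    qed
  qed
  show ?thesis
  proof
    assume "v \<in> K_sub q (q powi a) m \<epsilon> \<eta>"
    then have v: "v \<in> hspace q" "\<And>r. r > 0 \<Longrightarrow> \<exists>w\<in>hvec.span B. hnorm (v - w) < r"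
      by (auto simp: Ks hclosure_def)
    have "i \<in> S m" if i: "v i \<noteq> 0" for i
    proof (rule ccontr)
      assume n: "i \<notin> S m"
      obtain w where w: "w \<in> hvec.span B" "hnorm (v - w) < cmod (v i)"
        using v(2)[of "cmod (v i)"] i by auto
      have "w \<in> {w. fin_supp q w \<and> (\<forall>i. w i \<noteq> 0 \<longrightarrow> i \<in> S m)}" using sub w(1) by (rule subsetD)
      then have "fin_supp q w" "w i = 0" using n by blast+
      then show False
        using hnorm_small_0[OF v(1) fin_supp_hspace, of w i] w(2) by simp
    qed
    then show "v \<in> hspace q \<and> (\<forall>i. v i \<noteq> 0 \<longrightarrow> i \<in> S m)" using v by blast
  next
    assume v: "v \<in> hspace q \<and> (\<forall>i. v i \<noteq> 0 \<longrightarrow> i \<in> S m)"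
    have "\<exists>w\<in>hvec.span B. hnorm (v - w) < r" if r: "r > 0" for r
    proof -
      have "l2 v" using v hspace_l2 by blast
      then obtain F where F: "finite F" "hnorm (v - restr F v) < r"
        using truncation[OF _ r] by blast
      define w where "w = restr F v"
      have fs: "fin_supp q w" unfolding w_def using v F(1) by (intro fin_supp_restr) auto
      have "w \<in> hvec.span B"
      proof (subst fin_supp_expand[OF fs], rule hvec.span_sum)
        fix i assume i: "i \<in> {i. w i \<noteq> 0}"
        obtain n p t where ii: "i = (n, p, t)" by (cases i)
        have "p \<in> I_q q" "t \<in> I_q q" using fs i by (auto simp: fin_supp_def ii)
        moreover have "(n, p, t) \<in> S m" using v i by (auto simp: w_def ii restr_def split: if_splits)
        ultimately have "f_vec q n p t \<in> B" by (auto simp: B_def S_def)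
        then show "hscale (w i) (f_vec q (fst i) (fst (snd i)) (snd (snd i))) \<in> hvec.span B"
          by (simp add: ii hvec.span_scale hvec.span_base)
      qed
      then show ?thesis using F(2) by (auto simp: w_def)
    qed
    then show "v \<in> K_sub q (q powi a) m \<epsilon> \<eta>" using v by (simp add: Ks hclosure_def)
  qed
qed

end

lemma E_apply_bound: "\<exists>M\<ge>0. \<forall>v. l2 v \<longrightarrow> cmod (E_apply q v j) \<le> M * hnorm v"
proof -
  obtain n p t where j: "j = (n, p, t)" by (cases j)
  define M where "M = \<bar>E_coeff_t q (n + 1, p, q * t)\<bar> + \<bar>E_coeff_p q (n + 1, p / q, t)\<bar>"
  have "cmod (E_apply q v j) \<le> M * hnorm v" if l: "l2 v" for v
  proof (cases "p \<in> I_q q \<and> t \<in> I_q q")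
    case True
    then have "E_apply q v j = of_real (E_coeff_t q (n + 1, p, q * t)) * v (n + 1, p, q * t) - of_real (E_coeff_p q (n + 1, p / q, t)) * v (n + 1, p / q, t)"
      by (simp add: j E_apply_apply)
    then have "cmod (E_apply q v j) \<le> \<bar>E_coeff_t q (n + 1, p, q * t)\<bar> * cmod (v (n + 1, p, q * t)) + \<bar>E_coeff_p q (n + 1, p / q, t)\<bar> * cmod (v (n + 1, p / q, t))"
      using norm_triangle_ineq4[of "of_real (E_coeff_t q (n + 1, p, q * t)) * v (n + 1, p, q * t)" "of_real (E_coeff_p q (n + 1, p / q, t)) * v (n + 1, p / q, t)"]
      by (simp add: norm_mult)
    also have "\<dots> \<le> \<bar>E_coeff_t q (n + 1, p, q * t)\<bar> * hnorm v + \<bar>E_coeff_p q (n + 1, p / q, t)\<bar> * hnorm v"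
      by (intro add_mono mult_left_mono cmod_le_hnorm l) auto
    finally show ?thesis by (simp add: M_def distrib_right)
  next
    case False
    then have "E_apply q v j = 0" by (auto simp: j E_apply_apply)
    then show ?thesis by (simp add: M_def)
  qed
  then show ?thesis by (intro exI[of _ M]) (auto simp: M_def)
qed

section \<open>The Casimir operator before taking the closure\<close>

context unit_q begin

definition Casimir0 :: hop where
  "Casimir0 = op_scale (1/2)
     (op_diff
       (op_diff
         (op_scale (of_real ((q - inverse q)\<^sup>2)) (op_comp (op_adjoint q (E_op q)) (E_op q)))
         (op_scale (of_real q) (op_comp (K_op q) (K_op q))))
       (op_scale (of_real (inverse q)) (op_comp ((K_op q)\<inverse>) ((K_op q)\<inverse>))))"

lemma Casimir_alt: "Casimir q = op_closure q Casimir0"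
  by (simp add: Casimir_def Casimir0_def)

lemma K_op_hspace: "(v, w) \<in> K_op q \<Longrightarrow> v \<in> hspace q \<and> w \<in> hspace q"
  by (auto simp: K_op_def op_closure_def)

lemma E_op_hspace: "(v, w) \<in> E_op q \<Longrightarrow> v \<in> hspace q \<and> w \<in> hspace q"
  by (auto simp: E_op_def op_closure_def)

lemma adj_hspace: "(v, w) \<in> op_adjoint q (E_op q) \<Longrightarrow> v \<in> hspace q \<and> w \<in> hspace q"
  by (auto simp: op_adjoint_def)

text \<open>The intermediate pair (h, z) is kept because the energy argument needs the image under E
  itself. The condition on \<open>K_coeff\<close> excludes indices with a zero label, where the
  inverse of K cannot be computed by division.\<close>

lemma Casimir0D:
  assumes "(v, w) \<in> Casimir0"
  obtains h z where "(v, h) \<in> E_op q" "(h, z) \<in> op_adjoint q (E_op q)" "w \<in> hspace q"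
    "\<And>i. K_coeff q i \<noteq> 0 \<Longrightarrow> 2 * w i = of_real ((q - inverse q)\<^sup>2) * z i - of_real (q * (K_coeff q i)\<^sup>2 + inverse (q * (K_coeff q i)\<^sup>2)) * v i"
proof -
  obtain h z k1 k2 k3 k4 where 1: "(v, h) \<in> E_op q" "(h, z) \<in> op_adjoint q (E_op q)" "(v, k1) \<in> K_op q" "(k1, k2) \<in> K_op q"
    "(k3, v) \<in> K_op q" "(k4, k3) \<in> K_op q"
    and w: "w = hscale (1/2) (hscale (of_real ((q - inverse q)\<^sup>2)) z - hscale (of_real q) k2 - hscale (of_real (inverse q)) k4)"
    using assms unfolding Casimir0_def op_scale_def op_diff_def op_comp_def by auto
  have "w \<in> hspace q"
    unfolding w using 1 by (intro hspace_scale hspace_diff) (auto dest: K_op_hspace E_op_hspace adj_hspace)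
  moreover have "2 * w i = of_real ((q - inverse q)\<^sup>2) * z i - of_real (q * (K_coeff q i)\<^sup>2 + inverse (q * (K_coeff q i)\<^sup>2)) * v i" if nz: "K_coeff q i \<noteq> 0" for i
  proof -
    have k2: "k2 i = of_real ((K_coeff q i)\<^sup>2) * v i"
      using K_op_pointwise[OF 1(3), of i] K_op_pointwise[OF 1(4), of i] by (simp add: power2_eq_square)
    have "v i = of_real ((K_coeff q i)\<^sup>2) * k4 i"
      using K_op_pointwise[OF 1(5), of i] K_op_pointwise[OF 1(6), of i] by (simp add: power2_eq_square)
    then have k4: "k4 i = of_real (inverse ((K_coeff q i)\<^sup>2)) * v i" using nz by simp
    show ?thesis unfolding w by (simp add: hscale_def k2 k4 algebra_simps)
  qed
  ultimately show ?thesis using that 1(1,2) by blast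
qed

text \<open>Where K acts as a scalar, one truncation approximates the vector and its image at once;
  1 + |c| covers both distances.\<close>

lemma K_op_const:
  assumes v: "v \<in> hspace q" and k: "\<And>i. v i \<noteq> 0 \<Longrightarrow> K_coeff q i = c"
  shows "(v, hscale (of_real c) v) \<in> K_op q"
  unfolding K_op_def op_closure_def
proof (intro CollectI case_prodI conjI allI impI v hspace_scale)
  fix r :: real assume r: "r > 0"
  have "r / (1 + \<bar>c\<bar>) > 0" using r by (simp add: add_pos_nonneg)
  then obtain F where F: "finite F" "hnorm (v - restr F v) < r / (1 + \<bar>c\<bar>)"
    by (rule truncation[OF hspace_l2[OF v]])
  have b: "(1 + \<bar>c\<bar>) * hnorm (v - restr F v) < r" using F(2) by (simp add: field_simps add_pos_nonneg)
  have "hscale (of_real c) (restr F v) = (\<lambda>i. of_real (K_coeff q i) * restr F v i)"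
    using k by (auto simp: hscale_def restr_def fun_eq_iff)
  then have "(restr F v, hscale (of_real c) (restr F v)) \<in> K0_op q"
    using fin_supp_restr[OF v F(1)] by (simp add: K0_iff)
  moreover have "hscale (of_real c) v - hscale (of_real c) (restr F v) = hscale (of_real c) (v - restr F v)"
    by (simp add: hscale_def fun_eq_iff algebra_simps)
  then have "hnorm (hscale (of_real c) v - hscale (of_real c) (restr F v)) = \<bar>c\<bar> * hnorm (v - restr F v)"
    by (simp add: hnorm_scale)
  moreover have "\<bar>c\<bar> * hnorm (v - restr F v) \<le> (1 + \<bar>c\<bar>) * hnorm (v - restr F v)"
    "1 * hnorm (v - restr F v) \<le> (1 + \<bar>c\<bar>) * hnorm (v - restr F v)"
    by (intro mult_right_mono; simp)+
  ultimately show "\<exists>(v', w')\<in>K0_op q. hnorm (v - v') < r \<and> hnorm (hscale (of_real c) v - w') < r"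
    using b by (intro bexI[of _ "(restr F v, hscale (of_real c) (restr F v))"]) auto
qed

text \<open>As E is the closure of its restriction to finitely supported families, the adjoint is
  the maximal operator given by the transposed formula. The identity is checked on basis vectors,
  extended by linearity to finite support, and by Cauchy-Schwarz to the closure.\<close>

lemma adjointI:
  assumes h: "h \<in> hspace q" and z: "z \<in> hspace q"
    and pt: "\<And>m p t. p \<in> I_q q \<Longrightarrow> t \<in> I_q q \<Longrightarrow>
      z (m, p, t) = of_real (E_coeff_t q (m, p, t)) * h (m - 1, p, t / q) - of_real (E_coeff_p q (m, p, t)) * h (m - 1, q * p, t)"
  shows "(h, z) \<in> op_adjoint q (E_op q)"
proof -
  have fsu: "fin_supp q (f_vec q m' p' t')" for m' p' t'
    unfolding fin_supp_def by (auto simp: f_vec_def intro: finite_subset[of _ "{(m', p', t')}"])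
  have l: "l2 (f_vec q m' p' t')" for m' p' t' by (rule hspace_l2[OF fin_supp_hspace[OF fsu]])
  have bas: "hinner (E_basis i) h = cnj (z i)" if i: "fst (snd i) \<in> I_q q" "snd (snd i) \<in> I_q q" for i
  proof -
    obtain m p t where ii: "i = (m, p, t)" by (cases i)
    have "hinner (E_basis i) h = of_real (E_coeff_t q (m, p, t)) * cnj (h (m - 1, p, inverse q * t)) - of_real (E_coeff_p q (m, p, t)) * cnj (h (m - 1, q * p, t))"
      unfolding E_basis_def ii by (simp add: hinner_diff_left l2_scale l hspace_l2[OF h] hinner_scale_left hinner_f_vec h)
    moreover have "z (m, p, t) = of_real (E_coeff_t q (m, p, t)) * h (m - 1, p, inverse q * t) - of_real (E_coeff_p q (m, p, t)) * h (m - 1, q * p, t)"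
      using pt[of p t m] i by (simp add: ii divide_inverse mult.commute)
    ultimately show ?thesis by (simp add: ii)
  qed
  have lE: "l2 (E_basis i)" for i
  proof -
    obtain m p t where ii: "i = (m, p, t)" by (cases i)
    show ?thesis unfolding E_basis_def ii by (simp add: hnorm_diff(1) l2_scale l)
  qed
  have sum_l2: "l2 (\<Sum>i\<in>A. G i)" if "\<And>i. i \<in> A \<Longrightarrow> l2 (G i)" "finite A" for A and G :: "int \<times> real \<times> real \<Rightarrow> hvec"
    using that(2,1) by (induction A rule: finite_induct) (auto intro: hnorm_add(1) l2_finite)
  have hs: "hinner (\<Sum>i\<in>A. G i) w = (\<Sum>i\<in>A. hinner (G i) w)" if "\<And>i. i \<in> A \<Longrightarrow> l2 (G i)" "finite A" "l2 w" for A and G :: "int \<times> real \<times> real \<Rightarrow> hvec" and w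
    using that(2,1)
  proof (induction A rule: finite_induct)
    case empty
    then show ?case by (simp add: hinner_def)
  next
    case (insert x A)
    then have 1: "l2 (G x)" "l2 (sum G A)" and 2: "hinner (sum G A) w = (\<Sum>i\<in>A. hinner (G i) w)"
      using sum_l2[of A G] by auto
    show ?case
      unfolding sum.insert[OF insert(1,2)] hinner_add_left[OF 1 that(3)] 2 ..
  qed
  have fin: "hinner (E_apply q u) h = hinner u z" if fs: "fin_supp q u" for u
  proof -
    have f: "finite {i. u i \<noteq> 0}" using fs by (simp add: fin_supp_def)
    have "hinner (E_apply q u) h = (\<Sum>i | u i \<noteq> 0. u i * hinner (E_basis i) h)"
      unfolding E_basis_sum[OF fs, symmetric] using f by (subst hs) (auto intro: l2_scale lE hspace_l2[OF h] simp: hinner_scale_left)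
    also have "\<dots> = (\<Sum>i | u i \<noteq> 0. u i * cnj (z i))"
      using fs by (intro sum.cong refl) (auto simp: fin_supp_def bas)
    also have "\<dots> = hinner u z"
    proof -
      have "(\<Sum>\<^sub>\<infinity>i. u i * cnj (z i)) = (\<Sum>\<^sub>\<infinity>i\<in>{i. u i \<noteq> 0}. u i * cnj (z i))"
        by (rule infsum_cong_neutral) auto
      then show ?thesis using f by (simp add: hinner_def)
    qed
    finally show ?thesis .
  qed
  have "hinner w h = hinner u z" if uw: "(u, w) \<in> E_op q" for u w
  proof (rule tendsto_zero_imp_eq[where M = "hnorm h + hnorm z"])
    fix r :: real assume r: "r > 0"
    have hu: "u \<in> hspace q" "w \<in> hspace q" using E_op_hspace[OF uw] by auto
    obtain u' w' where 1: "(u', w') \<in> E0_op q" "hnorm (u - u') < r" "hnorm (w - w') < r"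
      using uw r unfolding E_op_def op_closure_def by blast
    then have w': "w' = E_apply q u'" and fs: "fin_supp q u'" by (auto simp: E0_iff)
    have l': "l2 u'" "l2 w'" using hspace_l2[OF fin_supp_hspace[OF fs]] hspace_l2[OF fin_supp_hspace[OF fin_supp_Ept[OF fs]]] by (auto simp: w')
    note ll = hspace_l2[OF hu(1)] hspace_l2[OF hu(2)] hspace_l2[OF h] hspace_l2[OF z]
    have "hinner w h - hinner u z = hinner (w - w') h - hinner (u - u') z"
      using fin[OF fs] by (simp add: hinner_diff_left ll l' w'[symmetric])
    then have "cmod (hinner w h - hinner u z) \<le> cmod (hinner (w - w') h) + cmod (hinner (u - u') z)"
      by (simp only: norm_triangle_ineq4)
    also have "\<dots> \<le> hnorm (w - w') * hnorm h + hnorm (u - u') * hnorm z"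
      by (intro add_mono l2_prod hnorm_diff ll l')
    also have "\<dots> \<le> r * hnorm h + r * hnorm z"
      using 1 by (intro add_mono mult_right_mono) auto
    finally show "cmod (hinner w h - hinner u z) \<le> (hnorm h + hnorm z) * r" by (simp add: algebra_simps)
  qed simp
  then show ?thesis using h z unfolding op_adjoint_def by auto
qed

lemma Casimir0I:
  assumes v: "v \<in> hspace q" and k: "\<And>i. v i \<noteq> 0 \<Longrightarrow> K_coeff q i = c" and c: "c > 0"
    and E: "(v, h) \<in> E_op q" and A: "(h, hscale \<zeta> v) \<in> op_adjoint q (E_op q)"
  shows "(v, hscale ((of_real ((q - inverse q)\<^sup>2) * \<zeta> - of_real (q * c\<^sup>2 + inverse (q * c\<^sup>2))) / 2) v) \<in> Casimir0"
proof -
  have K1: "(v, hscale (of_real c) v) \<in> K_op q" by (rule K_op_const[OF v k])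
  have K2: "(hscale (of_real c) v, hscale (of_real c) (hscale (of_real c) v)) \<in> K_op q"
    by (rule K_op_const[OF hspace_scale[OF v]]) (use k in \<open>auto simp: hscale_def\<close>)
  have inv: "hscale (of_real c) (hscale (of_real (inverse c)) w) = w" for w
    using c by (simp add: hscale_def fun_eq_iff)
  have K3: "(hscale (of_real (inverse c)) w, w) \<in> K_op q" if w: "w \<in> hspace q" "\<And>i. w i \<noteq> 0 \<Longrightarrow> v i \<noteq> 0" for w
    using K_op_const[of "hscale (of_real (inverse c)) w" c] hspace_scale[OF w(1)] w(2) k unfolding inv by (auto simp: hscale_def)
  have K4: "(hscale (of_real (inverse c)) v, v) \<in> K_op q" by (rule K3[OF v])
  have K5: "(hscale (of_real (inverse c)) (hscale (of_real (inverse c)) v), hscale (of_real (inverse c)) v) \<in> K_op q"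
    by (rule K3[OF hspace_scale[OF v]]) (auto simp: hscale_def)
  have "(v, hscale (1/2) (hscale (of_real ((q - inverse q)\<^sup>2)) (hscale \<zeta> v) - hscale (of_real q) (hscale (of_real c) (hscale (of_real c) v))
      - hscale (of_real (inverse q)) (hscale (of_real (inverse c)) (hscale (of_real (inverse c)) v)))) \<in> Casimir0"
    unfolding Casimir0_def op_scale_def op_diff_def op_comp_def using E A K1 K2 K4 K5 by blast
  also have "hscale (1/2) (hscale (of_real ((q - inverse q)\<^sup>2)) (hscale \<zeta> v) - hscale (of_real q) (hscale (of_real c) (hscale (of_real c) v))
      - hscale (of_real (inverse q)) (hscale (of_real (inverse c)) (hscale (of_real (inverse c)) v)))
    = hscale ((of_real ((q - inverse q)\<^sup>2) * \<zeta> - of_real (q * c\<^sup>2 + inverse (q * c\<^sup>2))) / 2) v"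
    using c by (simp add: hscale_def fun_eq_iff power2_eq_square field_simps)
  finally show ?thesis .
qed

lemma Casimir0_sub: "(v, w) \<in> Casimir0 \<Longrightarrow> (v, w) \<in> Casimir q"
proof -
  assume vw: "(v, w) \<in> Casimir0"
  then obtain h z where "(v, h) \<in> E_op q" "w \<in> hspace q" by (rule Casimir0D) blast
  then show ?thesis
    using vw E_op_hspace unfolding Casimir_alt op_closure_def by (auto intro!: bexI[of _ "(v, w)"])
qed

end

context block begin

section \<open>Eigenvalues of the restricted Casimir operator\<close>

text \<open>The factor q^((m+1)/2) |p/t|^(1/2) of the coefficients of E, which is constant on the
  block because |p/t| = q^s. As K^2 = q^(s+m) there, q K^2 = g^2, and \<open>\<kappa>\<close> = g^2
  + 1/g^2 is the scalar by which q K^2 + K^(-2)/q acts.\<close>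

definition g :: real where "g = q powr (of_int (s + m + 1) / 2)"
definition cc :: real where "cc = inverse (q - inverse q)"
definition sq1 :: "int \<Rightarrow> real" where "sq1 k = sqrt (1 + \<epsilon> * q powi (2 * k))"
definition sq2 :: "int \<Rightarrow> real" where "sq2 k = sqrt (1 + \<eta> * q powi (2 * (s + k)))"
definition \<kappa> :: real where "\<kappa> = q powi (s + m + 1) + q powi (- (s + m + 1))"
definition alc :: "int \<Rightarrow> real" where "alc k = cc * (\<epsilon> * g * sq1 (k - 1))"
definition bec :: "int \<Rightarrow> real" where "bec k = cc * (\<eta> / g * sq2 k)"

lemma powi_powr: "q powi j = q powr of_int j"
  using powr_real_of_int'[of q j] q_pos by simp

lemma g_pos: "g > 0"
  using q_pos by (simp add: g_def)

lemma g_sq: "g\<^sup>2 = q powi (s + m + 1)"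
  unfolding g_def powi_powr power2_eq_square powr_add[symmetric] by simp

lemma \<kappa>_g: "\<kappa> = g\<^sup>2 + 1 / g\<^sup>2"
  unfolding g_sq \<kappa>_def powi_uminus ..

lemma cc_nz: "cc \<noteq> 0" "(q - inverse q)\<^sup>2 * cc\<^sup>2 = 1"
proof -
  have "inverse q > 1" using q_pos q_less_1 by (simp add: one_less_inverse)
  then have "q - inverse q \<noteq> 0" using q_less_1 by linarith
  then show "cc \<noteq> 0" "(q - inverse q)\<^sup>2 * cc\<^sup>2 = 1" by (auto simp: cc_def power_mult_distrib[symmetric])
qed

lemma kappa_sign: "\<theta> \<in> {-1, 1} \<Longrightarrow> kappa (\<theta> * q powi k) = \<theta> * q powi (2 * k)"
  by (auto simp: kappa_def sgn_mult powi_double)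

lemma ratio_abs: "\<bar>\<eta> * q powi j / (\<epsilon> * q powi k)\<bar> powr (1/2) = q powr (of_int (j - k) / 2)" "\<bar>\<epsilon> * q powi k / (\<eta> * q powi j)\<bar> powr (1/2) = q powr (of_int (k - j) / 2)"
proof -
  have "\<bar>\<eta> * q powi j / (\<epsilon> * q powi k)\<bar> = q powi (j - k)" "\<bar>\<epsilon> * q powi k / (\<eta> * q powi j)\<bar> = q powi (k - j)"
    by (simp_all add: abs_mult powi_diff)
  then show "\<bar>\<eta> * q powi j / (\<epsilon> * q powi k)\<bar> powr (1/2) = q powr (of_int (j - k) / 2)" "\<bar>\<epsilon> * q powi k / (\<eta> * q powi j)\<bar> powr (1/2) = q powr (of_int (k - j) / 2)"
    by (simp_all add: powi_powr powr_powr)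
qed

lemma E_coeff_t_idx: "E_coeff_t q (idx m k) = alc k"
proof -
  have 1: "inverse q * (\<epsilon> * q powi k) = \<epsilon> * q powi (k - 1)" by (simp add: powi_diff field_simps)
  have 2: "sgn (\<epsilon> * q powi k) = \<epsilon>" by (simp add: sgn_mult)
  have 3: "q powr (- (of_int (- m) - 1) / 2) * q powr (of_int (m + a + k - k) / 2) = g"
    unfolding g_def powr_add[symmetric] s_def by (simp add: add_divide_distrib algebra_simps)
  have "E_coeff_t q (idx m k) = cc * (\<epsilon> * (q powr (- (of_int (- m) - 1) / 2) * q powr (of_int (m + a + k - k) / 2)) * sqrt (1 + \<epsilon> * q powi (2 * (k - 1))))"
    unfolding E_coeff_t_def idx_def prod.case 1 2 kappa_sign[OF \<epsilon>] ratio_abs cc_def by (simp only: mult.assoc)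
  then show ?thesis unfolding 3 by (simp only: alc_def sq1_def)
qed

lemma E_coeff_p_idx: "E_coeff_p q (idx m k) = bec k"
proof -
  have 2: "sgn (\<eta> * q powi (m + a + k)) = \<eta>" by (simp add: sgn_mult)
  have 3: "q powr ((of_int (- m) - 1) / 2) * q powr (of_int (k - (m + a + k)) / 2) = 1 / g"
    unfolding g_def powr_add[symmetric] s_def powr_minus_divide[symmetric]
    by (rule arg_cong[where f = "(powr) q"]) (simp add: field_simps)
  have "E_coeff_p q (idx m k) = cc * (\<eta> * (q powr ((of_int (- m) - 1) / 2) * q powr (of_int (k - (m + a + k)) / 2)) * sqrt (1 + \<eta> * q powi (2 * (m + a + k))))"
    unfolding E_coeff_p_def idx_def prod.case 2 kappa_sign[OF \<eta>] ratio_abs cc_def by (simp only: mult.assoc)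
  then show ?thesis unfolding 3 by (simp add: bec_def sq2_def s_def)
qed

lemma K_coeff_S:
  assumes "i \<in> S m" shows "K_coeff q i = q powr (of_int (s + m) / 2)"
proof -
  obtain n p t where i: "i = (n, p, t)" by (cases i)
  have S: "n = - m" "p = \<epsilon> * \<eta> * q powi m * q powi a * t" "sgn t = \<epsilon>" using assms by (auto simp: i S_def)
  then have t: "t \<noteq> 0" by auto
  have "\<bar>p / t\<bar> = q powi s" using t by (simp add: S(2) s_def powi_add abs_mult)
  then have "K_coeff q i = q powr (of_int m / 2) * q powr (of_int s / 2)"
    by (simp add: K_coeff_def i S(1) powi_powr powr_powr)
  then show ?thesis by (simp add: powr_add[symmetric] add_divide_distrib add.commute)
qed

lemma K_coeff_const: "q * (q powr (of_int (s + m) / 2))\<^sup>2 + inverse (q * (q powr (of_int (s + m) / 2))\<^sup>2) = \<kappa>"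
proof -
  have "(q powr (of_int (s + m) / 2))\<^sup>2 = q powi (s + m)"
    unfolding powi_powr power2_eq_square powr_add[symmetric] by simp
  then have "q * (q powr (of_int (s + m) / 2))\<^sup>2 = q powi (s + m + 1)"
    by (simp add: powi_add)
  then show ?thesis unfolding \<kappa>_def powi_uminus by (simp add: inverse_eq_divide)
qed

text \<open>The coordinates of the image under E, on the block with m + 1, in terms of the
  coordinates b on the block with m.\<close>

definition Hs :: "(int \<Rightarrow> complex) \<Rightarrow> int \<Rightarrow> complex" where
  "Hs b k = of_real (alc (k + 1)) * b (k + 1) - of_real (bec k) * b k"

text \<open>This is the adjoint of E times E in coordinates. The diagonal entry collects to
  \<open>\<kappa>\<close> plus eps eta \<open>jac_diag\<close>; in the mixed products g and 1/g
  cancel, and the two square roots form \<open>jac_off\<close>. Hence 2 Omega acts as eps eta times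
  the Jacobi expression, which is why the eigenvalue eps eta x leads to the parameter 2x for all
  signs.\<close>

lemma EE_identity:
  assumes "in_range \<epsilon> \<eta> s k"
  shows "of_real (alc k) * Hs b (k - 1) - of_real (bec k) * Hs b k =
    of_real (cc\<^sup>2) * (of_real \<kappa> * b k + of_real (\<epsilon> * \<eta>) * (of_real (jac_diag \<epsilon> \<eta> s m k) * b k
      - of_real (jac_off \<epsilon> \<eta> s k) * b (k + 1) - of_real (jac_off \<epsilon> \<eta> s (k - 1)) * b (k - 1)))"
proof -
  have p1: "1 + \<epsilon> * q powi (2 * (k - 1)) \<ge> 0"
  proof (cases "\<epsilon> = 1")
    case False
    then have "\<epsilon> = -1" "k \<ge> 1" using assms \<epsilon> by (auto simp: in_range_def)
    then show ?thesis using powi_le_1_iff[of "2 * (k - 1)"] by simp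
  qed simp
  have p2: "1 + \<eta> * q powi (2 * (s + k)) \<ge> 0"
    using one_plus_sign_pos[OF \<eta>, of "s + k"] assms by (simp add: in_range_def)
  have A1: "(sq1 (k - 1))\<^sup>2 = 1 + \<epsilon> * q powi (2 * (k - 1))" "(sq2 k)\<^sup>2 = 1 + \<eta> * q powi (2 * (s + k))"
    unfolding sq1_def sq2_def using p1 p2 by simp_all
  have A2: "sq1 k * sq2 k = jac_off \<epsilon> \<eta> s k" for k by (simp only: sq1_def sq2_def jac_off_def real_sqrt_mult)
  have r1: "alc k * alc k + bec k * bec k = cc\<^sup>2 * (\<kappa> + \<epsilon> * \<eta> * jac_diag \<epsilon> \<eta> s m k)"
  proof -
    have "alc k * alc k + bec k * bec k = cc\<^sup>2 * (g\<^sup>2 * (sq1 (k - 1))\<^sup>2 + 1 / g\<^sup>2 * (sq2 k)\<^sup>2)"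
      by (simp add: alc_def bec_def power2_eq_square algebra_simps)
    also have "\<dots> = cc\<^sup>2 * (\<kappa> + (\<epsilon> * g\<^sup>2 * q powi (2 * (k - 1)) + \<eta> / g\<^sup>2 * q powi (2 * (s + k))))"
      unfolding A1 \<kappa>_g by (simp add: algebra_simps)
    also have "\<epsilon> * g\<^sup>2 * q powi (2 * (k - 1)) + \<eta> / g\<^sup>2 * q powi (2 * (s + k)) = \<epsilon> * \<eta> * jac_diag \<epsilon> \<eta> s m k"
      unfolding g_sq jac_diag_def powi_expand by (simp add: field_simps power2_eq_square)
    finally show ?thesis .
  qed
  have r2: "alc k * bec (k - 1) = cc\<^sup>2 * (\<epsilon> * \<eta> * jac_off \<epsilon> \<eta> s (k - 1))"
    unfolding A2[symmetric] alc_def bec_def using g_pos by (simp add: power2_eq_square)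
  have r3: "bec k * alc (k + 1) = cc\<^sup>2 * (\<epsilon> * \<eta> * jac_off \<epsilon> \<eta> s k)"
    unfolding A2[symmetric] alc_def bec_def using g_pos by (simp add: power2_eq_square)
  have "of_real (alc k) * Hs b (k - 1) - of_real (bec k) * Hs b k =
      of_real (alc k * alc k + bec k * bec k) * b k - of_real (alc k * bec (k - 1)) * b (k - 1) - of_real (bec k * alc (k + 1)) * b (k + 1)"
    by (simp add: Hs_def algebra_simps)
  also have "\<dots> = of_real (cc\<^sup>2) * (of_real \<kappa> * b k + of_real (\<epsilon> * \<eta>) * (of_real (jac_diag \<epsilon> \<eta> s m k) * b k
      - of_real (jac_off \<epsilon> \<eta> s k) * b (k + 1) - of_real (jac_off \<epsilon> \<eta> s (k - 1)) * b (k - 1)))"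
    unfolding r1 r2 r3 by (simp add: algebra_simps)
  finally show ?thesis .
qed

text \<open>The block with m + 1 has the range belonging to s + 1. The delicate case is eps = -1, k
  = 0: b 1 may be nonzero, but its coefficient contains the square root of 1 - q^0.\<close>

lemma Hs_outside:
  assumes "\<And>k. \<not> in_range \<epsilon> \<eta> s k \<Longrightarrow> b k = 0" "\<not> in_range \<epsilon> \<eta> (s + 1) k"
  shows "Hs b k = 0"
proof -
  have "bec k * (if in_range \<epsilon> \<eta> s k then 1 else 0) = 0"
    using assms(2) by (auto simp: in_range_def)
  then have "of_real (bec k) * b k = 0" using assms(1)[of k] by (auto split: if_splits)
  moreover have "of_real (alc (k + 1)) * b (k + 1) = 0"
  proof (cases "in_range \<epsilon> \<eta> s (k + 1)")
    case True
    then have "\<epsilon> = -1" "k = 0" using assms(2) \<epsilon> by (auto simp: in_range_def)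
    then have "1 + \<epsilon> * q powi (2 * (k + 1 - 1)) = 0" by simp
    then have "alc (k + 1) = 0" by (simp add: alc_def sq1_def)
    then show ?thesis by simp
  qed (simp add: assms(1))
  ultimately show ?thesis by (simp only: Hs_def diff_self)
qed

lemma idx_cases: obtains p t where "idx n k = (- n, p, t)" "p \<in> I_q q \<and> t \<in> I_q q \<longleftrightarrow> in_range \<epsilon> \<eta> (n + a) k"
  using idx_I[of n k] by (metis idx_def)

lemma E_apply_idx:
  assumes v: "v \<in> hspace q"
  shows "E_apply q v (idx (m + 1) k) = Hs (\<lambda>k. v (idx m k)) k"
proof -
  have out: "v (idx m k) = 0" if "\<not> in_range \<epsilon> \<eta> s k" for k
  proof -
    obtain p t where "idx m k = (- m, p, t)" "p \<in> I_q q \<and> t \<in> I_q q \<longleftrightarrow> in_range \<epsilon> \<eta> (m + a) k" by (rule idx_cases)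
    then show ?thesis using v that by (auto simp: hspace_def s_def)
  qed
  define p t where "p = \<eta> * q powi (m + 1 + a + k)" and "t = \<epsilon> * q powi k"
  have i: "idx (m + 1) k = (- m - 1, p, t)" by (simp add: idx_def p_def t_def)
  have i1: "(- m - 1 + 1, p, q * t) = idx m (k + 1)" "(- m - 1 + 1, p / q, t) = idx m k"
    by (auto simp: idx_def p_def t_def powi_add)
  have "p \<in> I_q q \<and> t \<in> I_q q \<longleftrightarrow> in_range \<epsilon> \<eta> (s + 1) k"
    using idx_I[OF i] by (simp add: s_def add_ac)
  then show ?thesis
    unfolding i E_apply_apply i1 E_coeff_t_idx E_coeff_p_idx using Hs_outside[of "\<lambda>k. v (idx m k)" k] out by (auto simp: Hs_def)
qed

lemma adj_idx:
  assumes "(h, z) \<in> op_adjoint q (E_op q)" "in_range \<epsilon> \<eta> s k"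
  shows "z (idx m k) = of_real (alc k) * h (idx (m + 1) (k - 1)) - of_real (bec k) * h (idx (m + 1) k)"
proof -
  obtain p t where i: "idx m k = (- m, p, t)" "p \<in> I_q q \<and> t \<in> I_q q \<longleftrightarrow> in_range \<epsilon> \<eta> (m + a) k" by (rule idx_cases)
  then have I: "p \<in> I_q q" "t \<in> I_q q" using assms(2) by (auto simp: s_def)
  show ?thesis
    using adjoint_pointwise[OF assms(1) I, of "- m"] idx_shift[OF i(1)] unfolding i(1)[symmetric] E_coeff_t_idx E_coeff_p_idx by simp
qed

text \<open>The identity holds for the approximants, which lie in the domain of the unclosed
  operator. Both sides involve finitely many coordinates and are bounded functionals of the vector,
  so it passes to v although v may lie outside that domain.\<close>

lemma eigen_pointwise:
  assumes cas: "(v, hscale c v) \<in> Casimir q" and k: "in_range \<epsilon> \<eta> s k"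
  shows "2 * c * v (idx m k) = of_real ((q - inverse q)\<^sup>2) *
     (of_real (alc k) * Hs (\<lambda>k. v (idx m k)) (k - 1) - of_real (bec k) * Hs (\<lambda>k. v (idx m k)) k) - of_real \<kappa> * v (idx m k)"
proof -
  define \<Phi> where "\<Phi> u = of_real ((q - inverse q)\<^sup>2) *
     (of_real (alc k) * E_apply q u (idx (m + 1) (k - 1)) - of_real (bec k) * E_apply q u (idx (m + 1) k)) - of_real \<kappa> * u (idx m k)" for u
  obtain M1 M2 where M: "M1 \<ge> 0" "\<And>u. l2 u \<Longrightarrow> cmod (E_apply q u (idx (m + 1) (k - 1))) \<le> M1 * hnorm u"
    "M2 \<ge> 0" "\<And>u. l2 u \<Longrightarrow> cmod (E_apply q u (idx (m + 1) k)) \<le> M2 * hnorm u"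
    using E_apply_bound by metis
  define M where "M = (q - inverse q)\<^sup>2 * (\<bar>alc k\<bar> * M1 + \<bar>bec k\<bar> * M2) + \<bar>\<kappa>\<bar>"
  have M0: "M \<ge> 0" using M by (simp add: M_def)
  have bd: "cmod (\<Phi> u) \<le> M * hnorm u" if u: "l2 u" for u
  proof -
    have "cmod (\<Phi> u) \<le> (q - inverse q)\<^sup>2 * cmod (of_real (alc k) * E_apply q u (idx (m + 1) (k - 1)) - of_real (bec k) * E_apply q u (idx (m + 1) k)) + \<bar>\<kappa>\<bar> * cmod (u (idx m k))"
      unfolding \<Phi>_def by (rule order_trans[OF norm_triangle_ineq4]) (simp only: norm_mult norm_of_real abs_power2)
    also have "\<dots> \<le> (q - inverse q)\<^sup>2 * (\<bar>alc k\<bar> * (M1 * hnorm u) + \<bar>bec k\<bar> * (M2 * hnorm u)) + \<bar>\<kappa>\<bar> * hnorm u"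
    proof (intro add_mono mult_left_mono cmod_le_hnorm u)
      show "cmod (of_real (alc k) * E_apply q u (idx (m + 1) (k - 1)) - of_real (bec k) * E_apply q u (idx (m + 1) k)) \<le> \<bar>alc k\<bar> * (M1 * hnorm u) + \<bar>bec k\<bar> * (M2 * hnorm u)"
        by (rule order_trans[OF norm_triangle_ineq4]) (simp only: norm_mult norm_of_real, intro add_mono mult_left_mono M u, auto)
    qed auto
    also have "\<dots> = M * hnorm u" by (simp add: M_def algebra_simps)
    finally show ?thesis .
  qed
  have lin: "\<Phi> u - \<Phi> w = \<Phi> (u - w)" for u w
    by (simp add: \<Phi>_def E_apply_diff algebra_simps)
  have hv: "v \<in> hspace q" "hscale c v \<in> hspace q" using cas by (auto simp: Casimir_alt op_closure_def)
  have "2 * c * v (idx m k) = \<Phi> v"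
  proof (rule tendsto_zero_imp_eq[where M = "2 + M"])
    show "0 \<le> 2 + M" using M0 by simp
    fix r :: real assume r: "r > 0"
    obtain v' w' where 1: "(v', w') \<in> Casimir0" "hnorm (v - v') < r" "hnorm (hscale c v - w') < r"
      using cas r unfolding Casimir_alt op_closure_def by blast
    obtain h z where 2: "(v', h) \<in> E_op q" "(h, z) \<in> op_adjoint q (E_op q)" "w' \<in> hspace q"
      "\<And>i. K_coeff q i \<noteq> 0 \<Longrightarrow> 2 * w' i = of_real ((q - inverse q)\<^sup>2) * z i - of_real (q * (K_coeff q i)\<^sup>2 + inverse (q * (K_coeff q i)\<^sup>2)) * v' i"
      by (rule Casimir0D[OF 1(1)]) blast
    have v': "v' \<in> hspace q" using E_op_hspace[OF 2(1)] by simp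
    have nz: "K_coeff q (idx m k) \<noteq> 0" using K_coeff_S[OF idx_S] q_pos by simp
    have "2 * w' (idx m k) = \<Phi> v'"
      using 2(4)[OF nz] unfolding K_coeff_S[OF idx_S] K_coeff_const adj_idx[OF 2(2) k] E_op_pointwise[OF 2(1)] \<Phi>_def .
    then have e: "2 * c * v (idx m k) - \<Phi> v = 2 * (hscale c v (idx m k) - w' (idx m k)) - \<Phi> (v - v')"
      unfolding lin[symmetric] by (simp add: hscale_def algebra_simps)
    have "cmod (2 * c * v (idx m k) - \<Phi> v) \<le> 2 * cmod (hscale c v (idx m k) - w' (idx m k)) + cmod (\<Phi> (v - v'))"
      unfolding e by (rule order_trans[OF norm_triangle_ineq4]) (simp only: norm_mult norm_numeral order_refl)
    also have "\<dots> \<le> 2 * r + M * r"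
    proof (intro add_mono mult_left_mono)
      show "cmod (hscale c v (idx m k) - w' (idx m k)) \<le> r"
        using hnorm_small_0[OF hv(2) 2(3), of "idx m k"] 1(3) by linarith
      have "cmod (\<Phi> (v - v')) \<le> M * hnorm (v - v')" by (rule bd[OF hnorm_diff(1)[OF hspace_l2[OF hv(1)] hspace_l2[OF v']]])
      also have "\<dots> \<le> M * r" using 1(2) M0 by (intro mult_left_mono) auto
      finally show "cmod (\<Phi> (v - v')) \<le> M * r" .
    qed simp
    finally show "cmod (2 * c * v (idx m k) - \<Phi> v) \<le> (2 + M) * r" by (simp add: algebra_simps)
  qed
  then show ?thesis unfolding \<Phi>_def E_apply_idx[OF hv(1)] .
qed

text \<open>Formally (q - 1/q)^2 |Ev|^2 = (2 \<gamma> + \<kappa>) |v|^2 <= 0, so Ev = 0. As v is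
  only a limit, the computation is done for an approximant at distance r, projected to the block:
  its image under E has squared norm at most a multiple of r, and the coordinates of Ev differ from
  those of this image by at most a multiple of r.\<close>

lemma energy:
  assumes cas: "(v, hscale (of_real \<gamma>) v) \<in> Casimir q" and supp: "\<And>i. v i \<noteq> 0 \<Longrightarrow> i \<in> S m"
    and neg: "2 * \<gamma> + \<kappa> \<le> 0"
  shows "Hs (\<lambda>k. v (idx m k)) k = 0"
proof -
  define c2 where "c2 = (q - inverse q)\<^sup>2"
  have c2: "c2 > 0" using cc_nz by (auto simp: c2_def)
  have hv: "v \<in> hspace q" using cas by (auto simp: Casimir_alt op_closure_def)
  have lv: "l2 v" by (rule hspace_l2[OF hv])
  have rv: "restr (S m) v = v" using supp by (auto simp: restr_def fun_eq_iff)
  define N where "N = hnorm v"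
  have N0: "N \<ge> 0" by (simp add: N_def)
  \<comment> \<open>Collects the errors below, where u is the projected approximant: |u - v| <= r,
    |u| <= N + 1 since r <= 1, and the norm of the defect \<open>\<delta>\<close> is at most (2 +
    |\<kappa>|) r.\<close>
  define M where "M = \<bar>2 * \<gamma> + \<kappa>\<bar> * N + (N + 1) * (2 + \<bar>\<kappa>\<bar>)"
  have M0: "M \<ge> 0" using N0 by (simp add: M_def)
  obtain M1 where M1: "M1 \<ge> 0" "\<And>u. l2 u \<Longrightarrow> cmod (E_apply q u (idx (m + 1) k)) \<le> M1 * hnorm u"
    using E_apply_bound by metis
  have main: "cmod (E_apply q v (idx (m + 1) k)) \<le> M1 * r + sqrt (M * r / c2)" if r: "0 < r" "r \<le> 1" for r
  proof -
    obtain v' w' where 1: "(v', w') \<in> Casimir0" "hnorm (v - v') < r" "hnorm (hscale (of_real \<gamma>) v - w') < r"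
      using cas r(1) unfolding Casimir_alt op_closure_def by blast
    obtain h z where 2: "(v', h) \<in> E_op q" "(h, z) \<in> op_adjoint q (E_op q)" "w' \<in> hspace q"
      "\<And>i. K_coeff q i \<noteq> 0 \<Longrightarrow> 2 * w' i = of_real ((q - inverse q)\<^sup>2) * z i - of_real (q * (K_coeff q i)\<^sup>2 + inverse (q * (K_coeff q i)\<^sup>2)) * v' i"
      by (rule Casimir0D[OF 1(1)]) blast
    have lv': "l2 v'" using E_op_hspace[OF 2(1)] hspace_l2 by blast
    have lh: "l2 h" using E_op_hspace[OF 2(1)] hspace_l2 by blast
    have lw': "l2 w'" by (rule hspace_l2[OF 2(3)])
    have lz: "l2 z" using adj_hspace[OF 2(2)] hspace_l2 by blast
    define u h' where "u = restr (S m) v'" and "h' = restr (S (m + 1)) h"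
    have lu: "l2 u" and lh': "l2 h'" by (simp_all add: u_def h'_def restr_l2 lv' lh)
    \<comment> \<open>The defect in (q - 1/q)^2 z = (2 \<gamma> + \<kappa>) v on the block, where z
      is the image of h under the adjoint.\<close>
    define \<delta> where "\<delta> = hscale 2 (restr (S m) w' - hscale (of_real \<gamma>) v) + hscale (of_real \<kappa>) (u - v)"
    have d1: "l2 (u - v)" "hnorm (u - v) \<le> r"
    proof -
      show "l2 (u - v)" by (rule hnorm_diff(1)[OF lu lv])
      have "u - v = - restr (S m) (v - v')" unfolding u_def by (subst rv[symmetric]) (simp add: restr_diff[symmetric])
      then show "hnorm (u - v) \<le> r"
        using hnorm_restr[OF hnorm_diff(1)[OF lv lv'], of "S m"] 1(2) by (simp add: hnorm_uminus)
    qed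
    have d2: "l2 (restr (S m) w' - hscale (of_real \<gamma>) v)" "hnorm (restr (S m) w' - hscale (of_real \<gamma>) v) \<le> r"
    proof -
      show "l2 (restr (S m) w' - hscale (of_real \<gamma>) v)" by (rule hnorm_diff(1)[OF restr_l2[OF lw'] l2_scale[OF lv]])
      have "hscale (of_real \<gamma>) v = restr (S m) (hscale (of_real \<gamma>) v)" using supp by (auto simp: restr_def fun_eq_iff hscale_def)
      then have "restr (S m) w' - hscale (of_real \<gamma>) v = - restr (S m) (hscale (of_real \<gamma>) v - w')"
        by (simp add: restr_diff[symmetric])
      then show "hnorm (restr (S m) w' - hscale (of_real \<gamma>) v) \<le> r"
        using hnorm_restr[OF hnorm_diff(1)[OF l2_scale[OF lv, of "of_real \<gamma>"] lw'], of "S m"] 1(3) by (simp add: hnorm_uminus)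
    qed
    have l\<delta>: "l2 \<delta>" unfolding \<delta>_def by (intro hnorm_add(1) l2_scale d1 d2)
    have n\<delta>: "hnorm \<delta> \<le> (2 + \<bar>\<kappa>\<bar>) * r"
    proof -
      have "hnorm \<delta> \<le> 2 * hnorm (restr (S m) w' - hscale (of_real \<gamma>) v) + \<bar>\<kappa>\<bar> * hnorm (u - v)"
        unfolding \<delta>_def using hnorm_add(2)[OF l2_scale[OF d2(1), of 2] l2_scale[OF d1(1), of "of_real \<kappa>"]] by (simp add: hnorm_scale)
      also have "\<dots> \<le> 2 * r + \<bar>\<kappa>\<bar> * r" by (intro add_mono mult_left_mono d1 d2) auto
      finally show ?thesis by (simp add: distrib_right)
    qed
    have zz: "hscale (of_real c2) (restr (S m) z) = hscale (of_real (2 * \<gamma> + \<kappa>)) v + \<delta>"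
    proof
      fix i
      show "hscale (of_real c2) (restr (S m) z) i = (hscale (of_real (2 * \<gamma> + \<kappa>)) v + \<delta>) i"
      proof (cases "i \<in> S m")
        case True
        have nz: "K_coeff q i \<noteq> 0" using K_coeff_S[OF True] q_pos by simp
        have "2 * w' i = of_real c2 * z i - of_real \<kappa> * v' i"
          using 2(4)[OF nz] unfolding K_coeff_S[OF True] K_coeff_const c2_def .
        then show ?thesis using True by (simp add: hscale_def \<delta>_def u_def restr_def algebra_simps)
      next
        case False
        then have "v i = 0" using supp by blast
        then show ?thesis using False by (simp add: hscale_def \<delta>_def u_def restr_def)
      qed
    qed
    have "(u, h') \<in> E_op q" unfolding u_def h'_def by (rule E_op_restr[OF 2(1)])
    then have "hinner h' h = hinner u z" using 2(2) by (auto simp: op_adjoint_def)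
    moreover have "hinner h' h = hinner h' h'" unfolding h'_def by (rule hinner_restr)
    moreover have "hinner u z = hinner u (restr (S m) z)" unfolding u_def by (rule hinner_restr)
    ultimately have "of_real ((hnorm h')\<^sup>2) = hinner u (restr (S m) z)" by (simp add: hinner_self[OF lh'])
    then have "of_real (c2 * (hnorm h')\<^sup>2) = hinner u (hscale (of_real c2) (restr (S m) z))"
      by (simp add: hinner_scale_right)
    also have "\<dots> = of_real (2 * \<gamma> + \<kappa>) * hinner u v + hinner u \<delta>"
      unfolding zz by (simp add: hinner_add_right l2_scale lv l\<delta> lu hinner_scale_right)
    also have "hinner u v = hinner (u - v) v + of_real (N\<^sup>2)"
      by (simp add: hinner_diff_left lu lv hinner_self N_def)
    finally have eq: "of_real (c2 * (hnorm h')\<^sup>2) = of_real (2 * \<gamma> + \<kappa>) * (hinner (u - v) v + of_real (N\<^sup>2)) + hinner u \<delta>" .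
    have "c2 * (hnorm h')\<^sup>2 = (2 * \<gamma> + \<kappa>) * N\<^sup>2 + ((2 * \<gamma> + \<kappa>) * Re (hinner (u - v) v) + Re (hinner u \<delta>))"
      using arg_cong[OF eq, of Re] by (simp add: algebra_simps)
    also have "\<dots> \<le> 0 + (\<bar>2 * \<gamma> + \<kappa>\<bar> * (r * N) + (N + 1) * ((2 + \<bar>\<kappa>\<bar>) * r))"
    proof (intro add_mono)
      show "(2 * \<gamma> + \<kappa>) * N\<^sup>2 \<le> 0" using neg by (simp add: mult_nonpos_nonneg)
      have "\<bar>Re (hinner (u - v) v)\<bar> \<le> r * N"
        using abs_Re_le_cmod[of "hinner (u - v) v"] l2_prod(2)[OF d1(1) lv] mult_right_mono[OF d1(2) N0] by (simp add: N_def)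
      then have "\<bar>2 * \<gamma> + \<kappa>\<bar> * \<bar>Re (hinner (u - v) v)\<bar> \<le> \<bar>2 * \<gamma> + \<kappa>\<bar> * (r * N)" by (intro mult_left_mono) auto
      then show "(2 * \<gamma> + \<kappa>) * Re (hinner (u - v) v) \<le> \<bar>2 * \<gamma> + \<kappa>\<bar> * (r * N)"
        unfolding abs_mult[symmetric] by linarith
      have "hnorm u \<le> N + 1" using hnorm_add(2)[OF d1(1) lv] d1(2) r(2) by (simp add: N_def)
      then have "hnorm u * hnorm \<delta> \<le> (N + 1) * ((2 + \<bar>\<kappa>\<bar>) * r)"
        using N0 by (intro mult_mono n\<delta>) auto
      then show "Re (hinner u \<delta>) \<le> (N + 1) * ((2 + \<bar>\<kappa>\<bar>) * r)"
        using abs_Re_le_cmod[of "hinner u \<delta>"] l2_prod(2)[OF lu l\<delta>] by linarith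
    qed
    also have "\<dots> = M * r" by (simp add: M_def algebra_simps)
    finally have "(hnorm h')\<^sup>2 \<le> M * r / c2" using c2 by (simp add: pos_le_divide_eq mult.commute)
    then have n: "hnorm h' \<le> sqrt (M * r / c2)" by (rule real_le_rsqrt)
    have "h' (idx (m + 1) k) = E_apply q v' (idx (m + 1) k)"
      using idx_S[of "m + 1" k] by (simp add: h'_def restr_def E_op_pointwise[OF 2(1)])
    then have "E_apply q v (idx (m + 1) k) = E_apply q (v - v') (idx (m + 1) k) + h' (idx (m + 1) k)"
      by (simp add: E_apply_diff)
    then have "cmod (E_apply q v (idx (m + 1) k)) \<le> cmod (E_apply q (v - v') (idx (m + 1) k)) + cmod (h' (idx (m + 1) k))"
      by (simp only: norm_triangle_ineq)
    also have "\<dots> \<le> M1 * hnorm (v - v') + hnorm h'"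
      by (intro add_mono M1 cmod_le_hnorm lh' hnorm_diff lv lv')
    also have "\<dots> \<le> M1 * r + sqrt (M * r / c2)"
      using 1(2) M1(1) n by (intro add_mono mult_left_mono) auto
    finally show ?thesis .
  qed
  have "E_apply q v (idx (m + 1) k) = 0"
  proof (rule tendsto_zero_imp_eq[where M = "M1 + sqrt (M / c2)"])
    show K0: "0 \<le> M1 + sqrt (M / c2)" using M1 M0 c2 by simp
    fix \<rho> :: real assume \<rho>: "\<rho> > 0"
    \<comment> \<open>Taking r = \<sigma>^2 makes the square-root error linear in \<sigma>, and
      \<sigma> <= 1 keeps r <= 1.\<close>
    define \<sigma> where "\<sigma> = min \<rho> 1"
    have \<sigma>: "0 < \<sigma>" "\<sigma> \<le> 1" "\<sigma> \<le> \<rho>" using \<rho> by (auto simp: \<sigma>_def)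
    have "\<sigma>\<^sup>2 \<le> \<sigma>" using \<sigma> by (simp add: power2_eq_square mult_left_le)
    then have "cmod (E_apply q v (idx (m + 1) k)) \<le> M1 * \<sigma>\<^sup>2 + sqrt (M * \<sigma>\<^sup>2 / c2)" using \<sigma> by (intro main) auto
    also have "sqrt (M * \<sigma>\<^sup>2 / c2) = sqrt (M / c2) * \<sigma>"
      using \<sigma> by (simp add: real_sqrt_mult real_sqrt_divide)
    also have "M1 * \<sigma>\<^sup>2 \<le> M1 * \<sigma>" using \<open>\<sigma>\<^sup>2 \<le> \<sigma>\<close> M1(1) by (rule mult_left_mono)
    also have "M1 * \<sigma> + sqrt (M / c2) * \<sigma> = (M1 + sqrt (M / c2)) * \<sigma>" by (simp add: distrib_right)
    also have "\<dots> \<le> (M1 + sqrt (M / c2)) * \<rho>" using \<sigma>(3) K0 by (rule mult_left_mono)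
    finally show "cmod (E_apply q v (idx (m + 1) k) - 0) \<le> (M1 + sqrt (M / c2)) * \<rho>" by simp
  qed
  then show ?thesis unfolding E_apply_idx[OF hv] .
qed

lemma eigen_recurrence:
  assumes cas: "(v, hscale (of_real (\<epsilon> * \<eta> * x)) v) \<in> Casimir q" and k: "in_range \<epsilon> \<eta> s k"
  shows "of_real (jac_off \<epsilon> \<eta> s k) * v (idx m (k + 1)) + of_real (jac_off \<epsilon> \<eta> s (k - 1)) * v (idx m (k - 1)) = of_real (jac_diag \<epsilon> \<eta> s m k - 2 * x) * v (idx m k)"
proof -
  define D where "D = of_real (jac_diag \<epsilon> \<eta> s m k) * v (idx m k) - of_real (jac_off \<epsilon> \<eta> s k) * v (idx m (k + 1)) - of_real (jac_off \<epsilon> \<eta> s (k - 1)) * v (idx m (k - 1))"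
  have "2 * of_real (\<epsilon> * \<eta> * x) * v (idx m k) = of_real ((q - inverse q)\<^sup>2) * (of_real (cc\<^sup>2) * (of_real \<kappa> * v (idx m k) + of_real (\<epsilon> * \<eta>) * D)) - of_real \<kappa> * v (idx m k)"
    using eigen_pointwise[OF cas k] unfolding EE_identity[OF k] D_def .
  also have "\<dots> = of_real ((q - inverse q)\<^sup>2 * cc\<^sup>2) * (of_real \<kappa> * v (idx m k) + of_real (\<epsilon> * \<eta>) * D) - of_real \<kappa> * v (idx m k)"
    by (simp only: of_real_mult mult.assoc)
  also have "\<dots> = of_real (\<epsilon> * \<eta>) * D" unfolding cc_nz(2) by simp
  finally have "of_real (\<epsilon> * \<eta>) * (of_real (2 * x) * v (idx m k)) = of_real (\<epsilon> * \<eta>) * D" by (simp add: mult_ac)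
  then have "of_real (2 * x) * v (idx m k) = D" by simp
  then show ?thesis unfolding D_def by (simp add: algebra_simps)
qed

lemma l2_tendsto_0:
  assumes "l2 v" "inj f" shows "(\<lambda>n :: nat. v (f n)) \<longlonglongrightarrow> 0"
proof -
  have "(\<lambda>i. (cmod (v i))\<^sup>2) summable_on range f"
    using assms(1) unfolding l2_def by (rule summable_on_subset_banach) simp
  then have "(\<lambda>n. (cmod (v (f n)))\<^sup>2) summable_on UNIV"
    using summable_on_reindex[OF assms(2), of "\<lambda>i. (cmod (v i))\<^sup>2"] by (simp add: o_def)
  then have "(\<lambda>n. (cmod (v (f n)))\<^sup>2) \<longlonglongrightarrow> 0"
    by (intro summable_LIMSEQ_zero summable_on_imp_summable)
  then have "(\<lambda>n. sqrt ((cmod (v (f n)))\<^sup>2)) \<longlonglongrightarrow> sqrt 0"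
    by (rule tendsto_real_sqrt)
  then show ?thesis by (simp add: tendsto_norm_zero_iff)
qed

lemma K_sub_zeroI:
  assumes "v \<in> K_sub q (q powi a) m \<epsilon> \<eta>" "\<And>k. v (idx m k) = 0"
  shows "v = 0"
proof
  fix i :: "int \<times> real \<times> real"
  obtain n p t where i: "i = (n, p, t)" by (cases i)
  show "v i = 0 i"
  proof (rule ccontr)
    assume "v i \<noteq> 0 i"
    then have "v i \<noteq> 0" by simp
    then have "i \<in> S m" "t \<in> I_q q" using assms(1) unfolding K_sub_iff by (auto simp: hspace_def i)
    then obtain k where "i = idx m k" using S_idx[of n p t m] i by auto
    then show False using assms(2) \<open>v i \<noteq> 0\<close> by simp
  qed
qed

lemma K_sub_outside:
  assumes "v \<in> K_sub q (q powi a) m \<epsilon> \<eta>" "\<not> in_range \<epsilon> \<eta> s k"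
  shows "v (idx m k) = 0"
proof -
  obtain p t where "idx m k = (- m, p, t)" "p \<in> I_q q \<and> t \<in> I_q q \<longleftrightarrow> in_range \<epsilon> \<eta> (m + a) k" by (rule idx_cases)
  then show ?thesis using assms unfolding K_sub_iff by (auto simp: hspace_def s_def)
qed

text \<open>The uniqueness results concern real sequences. As the recurrence is real, they apply to
  the real and imaginary parts of the coordinates, treated together through a real-linear functional
  \<open>l\<close>.\<close>

lemma no_eigenvalue:
  assumes only: "only_zero_sol \<epsilon> \<eta> s m (2 * x)"
  shows "\<not> is_eigenvalue (op_restrict (Casimir q) (K_sub q (q powi a) m \<epsilon> \<eta>)) (of_real (\<epsilon> * \<eta> * x))"
proof
  assume "is_eigenvalue (op_restrict (Casimir q) (K_sub q (q powi a) m \<epsilon> \<eta>)) (of_real (\<epsilon> * \<eta> * x))"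
  then obtain v where v: "v \<noteq> 0" "(v, hscale (of_real (\<epsilon> * \<eta> * x)) v) \<in> Casimir q" "v \<in> K_sub q (q powi a) m \<epsilon> \<eta>"
    by (auto simp: is_eigenvalue_def is_eigenvector_def op_restrict_def)
  have lv: "l2 v" using v(3) hspace_l2 unfolding K_sub_iff by blast
  have z: "l (v (idx m k)) = 0"
    if l: "l 0 = 0" "\<And>y z. l (y + z) = l y + l z" "\<And>(c::real) y. l (of_real c * y) = c * l y" "\<And>y. \<bar>l y\<bar> \<le> cmod y" for l :: "complex \<Rightarrow> real" and k
  proof -
    have "jacobi_sol \<epsilon> \<eta> s m (2 * x) (\<lambda>k. l (v (idx m k)))"
      unfolding jacobi_sol_def
    proof (intro conjI allI impI)
      fix k
      show "l (v (idx m k)) = 0" if "\<not> in_range \<epsilon> \<eta> s k" using K_sub_outside[OF v(3) that] l(1) by simp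
      show "jac_off \<epsilon> \<eta> s k * l (v (idx m (k + 1))) + jac_off \<epsilon> \<eta> s (k - 1) * l (v (idx m (k - 1))) = (jac_diag \<epsilon> \<eta> s m k - 2 * x) * l (v (idx m k))"
        if "in_range \<epsilon> \<eta> s k"
        using arg_cong[OF eigen_recurrence[OF v(2) that], of l] unfolding l(2,3) .
    qed
    moreover have lim: "(\<lambda>n. l (v (f n))) \<longlonglongrightarrow> 0" if "inj f" for f :: "nat \<Rightarrow> _"
      by (rule Lim_null_comparison[OF always_eventually tendsto_norm_zero[OF l2_tendsto_0[OF lv that]]]) (simp add: l(4))
    have "(\<lambda>n. l (v (idx m (int n)))) \<longlonglongrightarrow> 0" "(\<lambda>n. l (v (idx m (- int n)))) \<longlonglongrightarrow> 0"
      by (rule lim, simp add: inj_def)+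
    ultimately show ?thesis using only unfolding only_zero_sol_def by blast
  qed
  have "v (idx m k) = 0" for k
    using z[of Re k] z[of Im k] by (simp add: complex_eq_iff abs_Re_le_cmod abs_Im_le_cmod)
  then show False using K_sub_zeroI[OF v(3)] v(1) by blast
qed

text \<open>Decay alone does not suffice here: for \<open>m = 0\<close> the recurrence is in the limit circle case, so
  that all its solutions are square-summable at \<open>-\<infinity>\<close>.\<close>

lemma no_eigenvalue_energy:
  assumes pp: "\<epsilon> = 1" "\<eta> = 1" and neg: "2 * x + \<kappa> < 0 \<or> 2 * x + \<kappa> = 0 \<and> s + m + 1 > 0"
  shows "\<not> is_eigenvalue (op_restrict (Casimir q) (K_sub q (q powi a) m \<epsilon> \<eta>)) (of_real (\<epsilon> * \<eta> * x))"
proof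
  assume "is_eigenvalue (op_restrict (Casimir q) (K_sub q (q powi a) m \<epsilon> \<eta>)) (of_real (\<epsilon> * \<eta> * x))"
  then obtain v where v: "v \<noteq> 0" "(v, hscale (of_real (\<epsilon> * \<eta> * x)) v) \<in> Casimir q" "v \<in> K_sub q (q powi a) m \<epsilon> \<eta>"
    by (auto simp: is_eigenvalue_def is_eigenvector_def op_restrict_def)
  have xx: "\<epsilon> * \<eta> * x = x" using pp by simp
  have lv: "l2 v" using v(3) hspace_l2 unfolding K_sub_iff by blast
  define b where "b k = v (idx m k)" for k
  have in_range: "in_range \<epsilon> \<eta> s k" for k using pp by (simp add: in_range_def)
  have H: "Hs b k = 0" for k
    unfolding b_def by (rule energy[OF v(2)]) (use v(3) neg xx in \<open>auto simp: K_sub_iff\<close>)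
  have "b k = 0" for k
  proof (cases "2 * x + \<kappa> = 0")
    case False
    \<comment> \<open>With Ev = 0 the eigenvalue equation leaves only (2x + \<kappa>) b = 0.\<close>
    have "2 * of_real (\<epsilon> * \<eta> * x) * b k = - of_real \<kappa> * b k"
      using eigen_pointwise[OF v(2) in_range[of k]] H unfolding b_def by simp
    then have "of_real (2 * x + \<kappa>) * b k = 0" unfolding xx by (simp add: algebra_simps)
    then have "complex_of_real (2 * x + \<kappa>) = 0 \<or> b k = 0" by (simp only: mult_eq_0_iff)
    then show ?thesis using False of_real_eq_0_iff[of "2 * x + \<kappa>", where 'a = complex] by blast
  next
    case True
    \<comment> \<open>In the case of equality Ev = 0 is a first-order recurrence. The ratio of
      consecutive moduli tends to 1/g^2 = q^(-(s+m+1)) > 1, so the moduli eventually increase; as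
      they also tend to 0, one value vanishes, and then all do.\<close>
    then have pos: "s + m + 1 > 0" using neg by simp
    have g1: "g\<^sup>2 < 1" unfolding g_sq using pos by (simp add: powi_less_1_iff)
    have sqp: "sq1 k > 0" "sq2 k > 0" for k
      unfolding sq1_def sq2_def by (intro real_sqrt_gt_zero one_plus_sign_pos \<epsilon> \<eta>; simp add: pp)+
    have ab: "alc k \<noteq> 0" "bec k \<noteq> 0" for k
      unfolding alc_def bec_def using cc_nz(1) g_pos sqp[of k] sqp[of "k - 1"] by auto
    have rec: "of_real (alc (k + 1)) * b (k + 1) = of_real (bec k) * b k" for k
      using H[of k] by (simp add: Hs_def)
    have nrm: "cmod (b (k + 1)) = (1 / g\<^sup>2 * (sq2 k / sq1 k)) * cmod (b k)" for k
    proof -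
      have "\<bar>alc (k + 1)\<bar> * cmod (b (k + 1)) = \<bar>bec k\<bar> * cmod (b k)"
        using arg_cong[OF rec[of k], of cmod] by (simp add: norm_mult)
      moreover have "\<bar>alc (k + 1)\<bar> = \<bar>cc\<bar> * (g * sq1 k)" "\<bar>bec k\<bar> = \<bar>cc\<bar> * (1 / g * sq2 k)"
        using g_pos sqp[of k] by (simp_all add: alc_def bec_def abs_mult)
      ultimately show ?thesis using cc_nz(1) g_pos sqp(1)[of k] by (simp add: field_simps power2_eq_square)
    qed
    have "(\<lambda>n. 1 / g\<^sup>2 * (sqrt (1 + (\<eta> * q powi (2 * (s + 0))) * q ^ (2 * n)) / sqrt (1 + (\<epsilon> * q powi (2 * 0)) * q ^ (2 * n)))) \<longlonglongrightarrow> 1 / g\<^sup>2 * (sqrt (1 + 0) / sqrt (1 + 0))"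
      by (intro tendsto_intros q_power_tendsto_0) simp
    then have "(\<lambda>n. 1 / g\<^sup>2 * (sq2 (int n) / sq1 (int n))) \<longlonglongrightarrow> 1 / g\<^sup>2"
      unfolding sq1_def sq2_def using powi_shift[of s] powi_shift[of 0] by (simp add: mult.assoc)
    moreover have "1 / g\<^sup>2 > 1" using g1 g_pos by simp
    ultimately have "eventually (\<lambda>n. 1 / g\<^sup>2 * (sq2 (int n) / sq1 (int n)) > 1) sequentially"
      by (rule order_tendstoD(1))
    then obtain n0 where n0: "\<And>n. n \<ge> n0 \<Longrightarrow> 1 / g\<^sup>2 * (sq2 (int n) / sq1 (int n)) > 1"
      by (auto simp: eventually_sequentially)
    have "incseq (\<lambda>n. cmod (b (int (n + n0))))"
    proof (rule incseq_SucI)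
      fix n
      have "1 * cmod (b (int (n + n0))) \<le> cmod (b (int (n + n0) + 1))"
        unfolding nrm using n0[of "n + n0"] by (intro mult_right_mono) auto
      then show "cmod (b (int (n + n0))) \<le> cmod (b (int (Suc n + n0)))" by (simp add: add.commute add.left_commute)
    qed
    moreover have "(\<lambda>n. cmod (b (int (n + n0)))) \<longlonglongrightarrow> 0"
    proof -
      have "(\<lambda>n. b (int n)) \<longlonglongrightarrow> 0"
        unfolding b_def by (rule l2_tendsto_0[OF lv]) (simp add: inj_def)
      then show ?thesis
        using LIMSEQ_ignore_initial_segment[OF tendsto_norm_zero] by blast
    qed
    ultimately have "cmod (b (int (0 + n0))) \<le> 0" by (rule incseq_le)
    then have b0: "b (int n0) = 0" by simp
    show ?thesis
    proof (induction k rule: int_induct[where k = "int n0"])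
      case base
      show ?case by (rule b0)
    next
      case (step1 i)
      then show ?case using rec[of i] ab(1)[of "i + 1"] by simp
    next
      case (step2 i)
      then show ?case using rec[of "i - 1"] ab(2)[of "i - 1"] by simp
    qed
  qed
  then have "v (idx m k) = 0" for k by (simp add: b_def)
  then show False using K_sub_zeroI[OF v(3)] v(1) by blast
qed

end

text \<open>Dominated convergence for multipliers: off a finite set the family is small in norm
  whatever the multiplier, and on that set the multipliers are uniformly small for large L.\<close>

lemma dominated_cutoff:
  assumes v: "l2 v" and \<mu>: "\<And>L i. \<bar>\<mu> L i\<bar> \<le> (1::real)" and lim: "\<And>i. (\<lambda>L::nat. \<mu> L i) \<longlonglongrightarrow> 0" and r: "r > 0"
  shows "eventually (\<lambda>L. hnorm (\<lambda>i. of_real (\<mu> L i) * v i) < r) sequentially"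
proof -
  define \<rho> where "\<rho> = r / (2 * (hnorm v + 1))"
  have n1: "hnorm v + 1 > 0" using hnorm_nonneg[of v] by linarith
  have \<rho>: "\<rho> > 0" using r n1 by (simp add: \<rho>_def)
  obtain F where F: "finite F" "hnorm (v - restr F v) < r / 2"
    using truncation[OF v, of "r / 2"] r by auto
  have "eventually (\<lambda>L. \<forall>i\<in>F. \<bar>\<mu> L i\<bar> < \<rho>) sequentially"
    using F(1) \<rho> by (intro eventually_ball_finite ballI order_tendstoD(2)[OF tendsto_rabs_zero[OF lim]]) auto
  then show ?thesis
  proof eventually_elim
    case (elim L)
    have 1: "(\<lambda>i. of_real (\<mu> L i) * v i) = (\<lambda>i. of_real (\<mu> L i) * restr F v i) + (\<lambda>i. of_real (\<mu> L i) * (v - restr F v) i)"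
      by (simp add: fun_eq_iff algebra_simps)
    have le1: "cmod (of_real (\<mu> L i) * restr F v i) \<le> cmod (hscale (of_real \<rho>) v i)" for i
      using elim \<rho> by (auto simp: restr_def hscale_def norm_mult intro!: mult_right_mono)
    have le2: "cmod (of_real (\<mu> L i) * (v - restr F v) i) \<le> cmod ((v - restr F v) i)" for i
      using \<mu>[of L i] by (simp add: norm_mult mult_left_le_one_le del: minus_apply)
    have l2': "l2 (v - restr F v)" by (rule hnorm_diff(1)[OF v restr_l2[OF v]])
    have "hnorm (\<lambda>i. of_real (\<mu> L i) * v i) \<le> hnorm (\<lambda>i. of_real (\<mu> L i) * restr F v i) + hnorm (\<lambda>i. of_real (\<mu> L i) * (v - restr F v) i)"
      unfolding 1 by (intro hnorm_add(2) l2_le[OF l2_scale[OF v] le1] l2_le[OF l2' le2])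
    also have "\<dots> \<le> \<rho> * hnorm v + hnorm (v - restr F v)"
    proof (rule add_mono)
      show "hnorm (\<lambda>i. of_real (\<mu> L i) * restr F v i) \<le> \<rho> * hnorm v"
        using hnorm_mono[OF l2_scale[OF v] le1] \<rho> by (simp add: hnorm_scale)
    qed (rule hnorm_mono[OF l2' le2])
    also have "\<dots> < r / 2 + r / 2"
    proof (rule add_le_less_mono)
      have "\<rho> * hnorm v \<le> \<rho> * (hnorm v + 1)" using \<rho> by simp
      also have "\<dots> = r / 2"
      proof -
        have "r / (2 * x) * x = r / 2" if "x > 0" for x using that by simp
        then show ?thesis unfolding \<rho>_def using n1 by blast
      qed
      finally show "\<rho> * hnorm v \<le> r / 2" .
    qed (rule F(2))
    finally show ?case by simp
  qed
qed

lemma summable_on_int: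
  fixes f :: "int \<Rightarrow> real"
  assumes "summable (\<lambda>n. f (int n))" "summable (\<lambda>n. f (- int n))" "\<And>k. f k \<ge> 0"
  shows "f summable_on UNIV"
proof -
  have "(\<lambda>n. f (int n)) summable_on UNIV" "(\<lambda>n. f (- int n)) summable_on UNIV"
    using assms by (auto intro: summable_nonneg_imp_summable_on)
  then have 1: "f summable_on range int" "f summable_on range (\<lambda>n. - int n)"
    by (subst summable_on_reindex; simp add: o_def inj_def)+
  have "f summable_on (range (\<lambda>n. - int n) - range int)"
    by (rule summable_on_subset_banach[OF 1(2)]) auto
  then have "f summable_on (range int \<union> (range (\<lambda>n. - int n) - range int))"
    by (intro summable_on_Un_disjoint 1) auto
  moreover have "range int \<union> (range (\<lambda>n. - int n) - range int) = (UNIV :: int set)"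
  proof -
    have "k \<in> range int \<or> k \<in> range (\<lambda>n. - int n)" for k :: int
      by (cases k rule: int_cases2) auto
    then show ?thesis by blast
  qed
  ultimately show ?thesis by simp
qed

lemma (in unit_q) decays_summable:
  assumes "decays b" shows "(\<lambda>k. (b k)\<^sup>2) summable_on UNIV"
proof -
  obtain C where C: "\<And>k. \<bar>b k\<bar> \<le> C * q powi \<bar>k\<bar>" using assms by (auto simp: decays_def)
  have le: "(b k)\<^sup>2 \<le> C\<^sup>2 * (q\<^sup>2) ^ nat \<bar>k\<bar>" for k
  proof -
    have "(b k)\<^sup>2 \<le> (C * q powi \<bar>k\<bar>)\<^sup>2" using C[of k] by (metis abs_ge_zero power2_abs power_mono)
    also have "\<dots> = C\<^sup>2 * (q\<^sup>2) ^ nat \<bar>k\<bar>"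
      using power_int_of_nat[of q "nat \<bar>k\<bar>"] by (simp add: power_mult_distrib power_commutes flip: power_mult) (simp add: mult.commute)
    finally show ?thesis .
  qed
  have g: "summable (\<lambda>n. C\<^sup>2 * (q\<^sup>2) ^ n)"
    using q_sq_less_1 by (intro summable_mult summable_geometric) simp
  show ?thesis
    by (intro summable_on_int summable_comparison_test'[OF g]) (use le[of "int _"] le[of "- int _"] in auto)
qed

section \<open>From decaying solutions to eigenvectors\<close>

context block begin

definition vec :: "int \<Rightarrow> (int \<Rightarrow> complex) \<Rightarrow> hvec" where
  "vec n f = (\<lambda>i. if i \<in> range (idx n) then f (inv (idx n) i) else 0)"

lemma inj_idx: "inj (idx n)"
  by (simp add: inj_def)

lemma vec_idx [simp]: "vec n f (idx n k) = f k"
  by (simp add: vec_def inv_f_f[OF inj_idx])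

lemma vec_outside: "i \<notin> range (idx n) \<Longrightarrow> vec n f i = 0"
  by (simp add: vec_def)

lemma vec_supp: "vec n f i \<noteq> 0 \<Longrightarrow> \<exists>k. i = idx n k \<and> f k \<noteq> 0"
  by (auto simp: vec_def inv_f_f[OF inj_idx] split: if_splits)

lemma vec_l2:
  assumes "(\<lambda>k. (cmod (f k))\<^sup>2) summable_on UNIV"
  shows "l2 (vec n f)"
proof -
  have "(\<lambda>i. (cmod (vec n f i))\<^sup>2) summable_on range (idx n)"
    using assms by (subst summable_on_reindex[OF inj_idx]) (simp add: o_def)
  then show ?thesis
    unfolding l2_def by (rule summable_on_cong_neutral[THEN iffD1, rotated -1]) (auto simp: vec_outside)
qed

lemma vec_hspace:
  assumes "(\<lambda>k. (cmod (f k))\<^sup>2) summable_on UNIV" "\<And>k. \<not> in_range \<epsilon> \<eta> (n + a) k \<Longrightarrow> f k = 0"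
  shows "vec n f \<in> hspace q"
proof -
  have "p \<in> I_q q \<and> t \<in> I_q q" if nz: "vec n f (n', p, t) \<noteq> 0" for n' p t
  proof -
    obtain k where k: "(n', p, t) = idx n k" "f k \<noteq> 0" using vec_supp[OF nz] by auto
    then show ?thesis using assms(2)[of k] idx_I[OF k(1)[symmetric]] by auto
  qed
  then show ?thesis using vec_l2[OF assms(1), of n] by (auto simp: hspace_def l2_def)
qed

lemma vec_fin_supp:
  assumes "finite {k. f k \<noteq> 0}" "\<And>k. \<not> in_range \<epsilon> \<eta> (n + a) k \<Longrightarrow> f k = 0"
  shows "fin_supp q (vec n f)"
proof -
  have "{i. vec n f i \<noteq> 0} \<subseteq> idx n ` {k. f k \<noteq> 0}" using vec_supp[of n f] by blast
  then have "finite {i. vec n f i \<noteq> 0}" using assms(1) finite_surj by blast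
  moreover have "p \<in> I_q q \<and> t \<in> I_q q" if nz: "vec n f (n', p, t) \<noteq> 0" for n' p t
  proof -
    obtain k where k: "(n', p, t) = idx n k" "f k \<noteq> 0" using vec_supp[OF nz] by auto
    then show ?thesis using assms(2)[of k] idx_I[OF k(1)[symmetric]] by auto
  qed
  ultimately show ?thesis by (auto simp: fin_supp_def)
qed

lemma E_apply_vec:
  assumes v: "vec m f \<in> hspace q"
  shows "E_apply q (vec m f) = vec (m + 1) (Hs f)"
proof
  fix j :: "int \<times> real \<times> real"
  show "E_apply q (vec m f) j = vec (m + 1) (Hs f) j"
  proof (cases "j \<in> range (idx (m + 1))")
    case True
    then show ?thesis using E_apply_idx[OF v] by auto
  next
    case False
    obtain n p t where j: "j = (n, p, t)" by (cases j)
    have "E_apply q (vec m f) j = 0"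
    proof (cases "t \<in> I_q q")
      case True
      then have "j \<notin> S (m + 1)" using S_idx[of n p t "m + 1"] False unfolding j by auto
      then have "(n + 1, p, q * t) \<notin> S m" "(n + 1, p / q, t) \<notin> S m" by (simp_all add: S_shift j)
      then have "(n + 1, p, q * t) \<notin> range (idx m)" "(n + 1, p / q, t) \<notin> range (idx m)" using idx_S[of m] by auto
      then show ?thesis by (simp add: j E_apply_apply vec_outside)
    qed (simp add: j E_apply_apply)
    then show ?thesis using False by (simp add: vec_outside)
  qed
qed

lemma vec_diff: "vec n f - vec n f' = vec n (\<lambda>k. f k - f' k)"
  by (auto simp: vec_def fun_eq_iff)

text \<open>A sharp truncation of a solution decaying like \<open>q^|k|\<close> need not converge in the graph norm
  of \<open>E\<close>, whose coefficients may grow like \<open>q^-|k|\<close>; the slope of this cutoff gains a factor \<open>1 / L\<close>.\<close>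

definition chi :: "nat \<Rightarrow> int \<Rightarrow> real" where
  "chi L k = max 0 (1 - \<bar>of_int k\<bar> / of_nat L)"

lemma chi_bounds: "0 \<le> chi L k" "chi L k \<le> 1"
  by (auto simp: chi_def)

lemma chi_tendsto: "(\<lambda>L. 1 - chi L k) \<longlonglongrightarrow> 0"
proof -
  have "(\<lambda>L. 1 - max 0 (1 - \<bar>real_of_int k\<bar> * (1 / real L))) \<longlonglongrightarrow> 1 - max 0 (1 - \<bar>real_of_int k\<bar> * 0)"
    by (intro tendsto_intros lim_1_over_n)
  then show ?thesis by (simp add: chi_def)
qed

lemma chi_finite: "L > 0 \<Longrightarrow> finite {k. chi L k \<noteq> 0}"
proof (rule finite_subset)
  assume L: "L > 0"
  show "{k. chi L k \<noteq> 0} \<subseteq> {- int L..int L}"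
  proof
    fix k assume "k \<in> {k. chi L k \<noteq> 0}"
    then have "max 0 (1 - \<bar>of_int k\<bar> / real L) \<noteq> 0" unfolding chi_def by blast
    then have "\<bar>of_int k\<bar> / real L < 1" by linarith
    then have "\<bar>of_int k :: real\<bar> < of_int (int L)" using L by (simp add: divide_less_eq)
    then have "\<bar>k\<bar> < int L" by linarith
    then show "k \<in> {- int L..int L}" by auto
  qed
qed simp

lemma chi_step: "L > 0 \<Longrightarrow> \<bar>chi L (k + 1) - chi L k\<bar> \<le> 1 / real L"
proof -
  assume L: "L > 0"
  have "\<bar>chi L (k + 1) - chi L k\<bar> \<le> \<bar>(1 - \<bar>of_int (k + 1)\<bar> / real L) - (1 - \<bar>of_int k\<bar> / real L)\<bar>"
    unfolding chi_def by (simp add: max_def abs_if) 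
  also have "\<dots> = \<bar>\<bar>of_int k\<bar> - \<bar>of_int (k + 1)\<bar>\<bar> / real L"
    using L by (simp add: diff_divide_distrib[symmetric] abs_divide)
  also have "\<dots> \<le> 1 / real L" by (intro divide_right_mono) auto
  finally show ?thesis .
qed

lemma chi_step_support: "L > 0 \<Longrightarrow> chi L (k + 1) - chi L k \<noteq> 0 \<Longrightarrow> k \<in> {- int L..int L}"
proof -
  assume L: "L > 0" "chi L (k + 1) - chi L k \<noteq> 0"
  have z: "chi L k = 0" if "\<bar>k\<bar> \<ge> int L" for k
  proof -
    have "real L \<le> \<bar>of_int k\<bar>" using that by linarith
    then show ?thesis using L(1) by (simp add: chi_def)
  qed
  have "\<bar>k + 1\<bar> < int L \<or> \<bar>k\<bar> < int L"
    using z[of k] z[of "k + 1"] L(2) by force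
  then show ?thesis by auto
qed

text \<open>By the product rule, E of the cut-off family is chi times Ev plus an error in which the
  increments of chi multiply the bounded products of \<open>alc\<close> and b. The error is at most
  D/L on the 2L + 1 indices that matter, so its squared norm is at most 3 D^2 / L.\<close>

lemma E_op_by_cutoff:
  fixes b :: "int \<Rightarrow> real"
  assumes out: "\<And>k. \<not> in_range \<epsilon> \<eta> s k \<Longrightarrow> b k = 0" and sb: "(\<lambda>k. (b k)\<^sup>2) summable_on UNIV"
    and X: "\<And>k. \<bar>alc (k + 1) * b (k + 1)\<bar> \<le> D"
    and sH: "(\<lambda>k. (cmod (Hs (\<lambda>k. of_real (b k)) k))\<^sup>2) summable_on UNIV"
  shows "(vec m (\<lambda>k. of_real (b k)), vec (m + 1) (Hs (\<lambda>k. of_real (b k)))) \<in> E_op q"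
proof -
  define f where "f k = complex_of_real (b k)" for k
  have fout: "f k = 0" if "\<not> in_range \<epsilon> \<eta> s k" for k using out[OF that] by (simp add: f_def)
  have s1: "s + 1 = m + 1 + a" by (simp add: s_def)
  have Hout: "Hs f k = 0" if "\<not> in_range \<epsilon> \<eta> (m + 1 + a) k" for k
    using Hs_outside[of f k] fout that unfolding s1 by blast
  have sf: "(\<lambda>k. (cmod (f k))\<^sup>2) summable_on UNIV" using sb by (simp add: f_def)
  have sH': "(\<lambda>k. (cmod (Hs f k))\<^sup>2) summable_on UNIV" using sH by (simp add: f_def[abs_def])
  have hf: "vec m f \<in> hspace q" by (rule vec_hspace[OF sf]) (use fout s_def in auto)
  have hH: "vec (m + 1) (Hs f) \<in> hspace q" by (rule vec_hspace[OF sH' Hout])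
  have D0: "D \<ge> 0" using X[of 0] by linarith
  have "\<exists>(v', w')\<in>E0_op q. hnorm (vec m f - v') < r \<and> hnorm (vec (m + 1) (Hs f) - w') < r" if r: "r > 0" for r
  proof -
    define \<mu> where "\<mu> n L i = (if i \<in> range (idx n) then 1 - chi L (inv (idx n) i) else 0)" for n L and i :: "int \<times> real \<times> real"
    have \<mu>b: "\<bar>\<mu> n L i\<bar> \<le> 1" for n L i
      using chi_bounds[of L "inv (idx n) i"] by (simp add: \<mu>_def)
    have \<mu>l: "(\<lambda>L. \<mu> n L i) \<longlonglongrightarrow> 0" for n i
      using chi_tendsto[of "inv (idx n) i"] by (cases "i \<in> range (idx n)") (simp_all only: \<mu>_def if_True if_False tendsto_const)
    have \<mu>v: "(\<lambda>i. of_real (\<mu> n L i) * vec n f' i) = vec n (\<lambda>k. of_real (1 - chi L k) * f' k)" for n L f'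
      by (auto simp: \<mu>_def vec_def fun_eq_iff)
    have ev1: "eventually (\<lambda>L. hnorm (vec m (\<lambda>k. of_real (1 - chi L k) * f k)) < r) sequentially"
      unfolding \<mu>v[symmetric] by (rule dominated_cutoff[OF vec_l2[OF sf] \<mu>b \<mu>l r])
    have ev2: "eventually (\<lambda>L. hnorm (vec (m + 1) (\<lambda>k. of_real (1 - chi L k) * Hs f k)) < r / 2) sequentially"
      unfolding \<mu>v[symmetric] by (rule dominated_cutoff[OF vec_l2[OF sH'] \<mu>b \<mu>l]) (use r in simp)
    have "(\<lambda>L. sqrt (3 * D\<^sup>2 * (1 / real L))) \<longlonglongrightarrow> sqrt (3 * D\<^sup>2 * 0)"
      by (intro tendsto_intros lim_1_over_n)
    then have ev3: "eventually (\<lambda>L. sqrt (3 * D\<^sup>2 * (1 / real L)) < r / 2) sequentially"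
      using r by (intro order_tendstoD(2)[of _ 0]) auto
    obtain L where L: "L > 0" "hnorm (vec m (\<lambda>k. of_real (1 - chi L k) * f k)) < r"
      "hnorm (vec (m + 1) (\<lambda>k. of_real (1 - chi L k) * Hs f k)) < r / 2" "sqrt (3 * D\<^sup>2 * (1 / real L)) < r / 2"
      using eventually_happens[OF eventually_conj[OF eventually_gt_at_top[of 0] eventually_conj[OF ev1 eventually_conj[OF ev2 ev3]]]] by auto
    define fL where "fL k = of_real (chi L k) * f k" for k
    have "{k. fL k \<noteq> 0} \<subseteq> {k. chi L k \<noteq> 0}" by (auto simp: fL_def)
    then have fin: "finite {k. fL k \<noteq> 0}" using chi_finite[OF L(1)] finite_subset by blast
    have fs: "fin_supp q (vec m fL)" by (rule vec_fin_supp[OF fin]) (use fout s_def in \<open>auto simp: fL_def\<close>)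
    have E0: "(vec m fL, vec (m + 1) (Hs fL)) \<in> E0_op q"
      using fs E_apply_vec[OF fin_supp_hspace[OF fs]] by (simp add: E0_iff)
    have d1: "vec m f - vec m fL = vec m (\<lambda>k. of_real (1 - chi L k) * f k)"
      unfolding vec_diff by (rule arg_cong[where f = "vec m"]) (simp add: fL_def algebra_simps)
    define Y where "Y k = complex_of_real ((chi L (k + 1) - chi L k) * (alc (k + 1) * b (k + 1)))" for k
    have d2: "vec (m + 1) (Hs f) - vec (m + 1) (Hs fL) = vec (m + 1) (\<lambda>k. of_real (1 - chi L k) * Hs f k) - vec (m + 1) Y"
      unfolding vec_diff by (rule arg_cong[where f = "vec (m + 1)"]) (simp add: fL_def Hs_def Y_def f_def algebra_simps)
    have Yb: "cmod (Y k) \<le> D / real L" for k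
    proof -
      have "cmod (Y k) = \<bar>chi L (k + 1) - chi L k\<bar> * \<bar>alc (k + 1) * b (k + 1)\<bar>"
        by (simp only: Y_def norm_of_real abs_mult)
      also have "\<dots> \<le> 1 / real L * D" by (intro mult_mono chi_step[OF L(1)] X) auto
      finally show ?thesis by simp
    qed
    have Ys: "Y k = 0" if "k \<notin> {- int L..int L}" for k
      using chi_step_support[OF L(1), of k] that by (auto simp: Y_def)
    have nY: "l2 (vec (m + 1) Y)" "hnorm (vec (m + 1) Y) \<le> sqrt (3 * D\<^sup>2 * (1 / real L))"
    proof -
      have "L2_set (\<lambda>i. cmod (vec (m + 1) Y i)) F \<le> sqrt (3 * D\<^sup>2 * (1 / real L))" if F: "finite F" for F
      proof -
        let ?A = "idx (m + 1) ` {- int L..int L}"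
        have z: "vec (m + 1) Y i = 0" if "i \<notin> ?A" for i
          using vec_supp[of "m + 1" Y i] Ys that by blast
        have "(\<Sum>i\<in>F. (cmod (vec (m + 1) Y i))\<^sup>2) \<le> (\<Sum>i\<in>F \<union> ?A. (cmod (vec (m + 1) Y i))\<^sup>2)"
          using F by (intro sum_mono2) auto
        also have "\<dots> = (\<Sum>i\<in>?A. (cmod (vec (m + 1) Y i))\<^sup>2)"
          using F z by (intro sum.mono_neutral_right) auto
        also have "\<dots> = (\<Sum>k\<in>{- int L..int L}. (cmod (Y k))\<^sup>2)"
          by (subst sum.reindex) (auto simp: inj_on_def)
        also have "\<dots> \<le> (\<Sum>k\<in>{- int L..int L}. (D / real L)\<^sup>2)"
          by (intro sum_mono power_mono Yb) auto
        also have "\<dots> = (2 * real L + 1) * (D / real L)\<^sup>2" using L(1) by simp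
        also have "\<dots> \<le> (3 * real L) * (D / real L)\<^sup>2" using L(1) by (intro mult_right_mono) auto
        also have "\<dots> = 3 * D\<^sup>2 * (1 / real L)" using L(1) by (simp add: power2_eq_square)
        finally show ?thesis unfolding L2_set_def by (rule real_sqrt_le_mono)
      qed
      from hnorm_le[OF _ this] show "l2 (vec (m + 1) Y)" "hnorm (vec (m + 1) Y) \<le> sqrt (3 * D\<^sup>2 * (1 / real L))"
        by simp_all
    qed
    have lz: "l2 (vec (m + 1) (\<lambda>k. of_real (1 - chi L k) * Hs f k))"
      unfolding \<mu>v[symmetric] by (rule l2_le[OF vec_l2[OF sH', of "m + 1"]]) (use \<mu>b in \<open>simp add: norm_mult mult_left_le_one_le\<close>)
    have "hnorm (vec (m + 1) (Hs f) - vec (m + 1) (Hs fL)) < r"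
      unfolding d2 using hnorm_diff(2)[OF lz nY(1)] nY(2) L(3,4) by linarith
    then show ?thesis using E0 L(2) unfolding d1[symmetric] by blast
  qed
  then show ?thesis using hf hH unfolding E_op_def op_closure_def f_def[abs_def] by blast
qed

text \<open>Decay yields at once only that both halves of H = Ev are bounded. Square-summability of
  H comes from summation by parts against the eigenvalue equation; after that the cutoff lemma puts
  v into the domain of E, and \<open>adjointI\<close> puts H into the domain of the adjoint.\<close>

lemma has_eigenvalue:
  assumes "has_decaying_sol \<epsilon> \<eta> s m (2 * x)"
  shows "is_eigenvalue (op_restrict (Casimir q) (K_sub q (q powi a) m \<epsilon> \<eta>)) (of_real (\<epsilon> * \<eta> * x))"
proof -
  obtain b k0 where jacobi_sol: "jacobi_sol \<epsilon> \<eta> s m (2 * x) b" and dec: "decays b" and nz: "b k0 \<noteq> 0"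
    using assms unfolding has_decaying_sol_def by blast
  have out: "b k = 0" if "\<not> in_range \<epsilon> \<eta> s k" for k using jacobi_sol that by (simp add: jacobi_sol_def)
  have sb: "(\<lambda>k. (b k)\<^sup>2) summable_on UNIV" by (rule decays_summable[OF dec])
  obtain C where C: "\<And>k. \<bar>b k\<bar> \<le> C * q powi \<bar>k\<bar>" using dec by (auto simp: decays_def)
  have C0: "C \<ge> 0" using C[of 0] by simp
  \<comment> \<open>Outside the range the radicand can be negative; the real square root is odd
    there, so the bound is stated for absolute values.\<close>
  have sqrt_le: "\<bar>sqrt (1 + \<theta> * q powi (2 * j))\<bar> \<le> 1 + q powi j" if "\<theta> \<in> {-1, 1}" for \<theta> j
  proof -
    have "\<bar>1 + \<theta> * q powi (2 * j)\<bar> \<le> 1 + (q powi j)\<^sup>2"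
      using that by (auto simp: powi_double abs_le_iff)
    also have "\<dots> \<le> (1 + q powi j)\<^sup>2" by (simp add: power2_sum)
    finally have "sqrt \<bar>1 + \<theta> * q powi (2 * j)\<bar> \<le> 1 + q powi j"
      by (intro real_le_lsqrt) auto
    moreover have "\<bar>sqrt y\<bar> = sqrt \<bar>y\<bar>" for y
      by (cases "y \<ge> 0") (auto simp: abs_if real_sqrt_minus)
    ultimately show ?thesis by simp
  qed
  \<comment> \<open>The place where the rate q^|k| is just enough: for negative k the coefficient
    has order q^(-|k|).\<close>
  have bnd: "(1 + q powi (c + k)) * q powi \<bar>k\<bar> \<le> 1 + q powi c" for c k
  proof -
    have "q powi \<bar>k\<bar> \<le> 1" "q powi (c + k + \<bar>k\<bar>) \<le> q powi c" by (simp_all add: powi_le_1_iff powi_le_iff)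
    moreover have "(1 + q powi (c + k)) * q powi \<bar>k\<bar> = q powi \<bar>k\<bar> + q powi (c + k + \<bar>k\<bar>)"
      by (simp only: distrib_right mult_1 powi_add)
    ultimately show ?thesis by linarith
  qed
  define D where "D = \<bar>cc\<bar> * (g + 1 / g) * C * (2 + q powi (-1) + q powi s)"
  have gp: "g + 1 / g > 0" using g_pos by (simp add: add_pos_pos)
  have XD: "\<bar>alc (k + 1) * b (k + 1)\<bar> \<le> D" for k
  proof -
    have "\<bar>sq1 k\<bar> * \<bar>b (k + 1)\<bar> \<le> (1 + q powi k) * (C * q powi \<bar>k + 1\<bar>)"
      unfolding sq1_def by (intro mult_mono sqrt_le[OF \<epsilon>] C) (auto simp: add_nonneg_nonneg)
    also have "\<dots> = C * ((1 + q powi (-1 + (k + 1))) * q powi \<bar>k + 1\<bar>)" by simp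
    also have "\<dots> \<le> C * (1 + q powi (-1))" by (intro mult_left_mono bnd C0)
    also have "\<dots> \<le> C * (2 + q powi (-1) + q powi s)" using C0 by (intro mult_left_mono) auto
    finally have 1: "\<bar>sq1 k\<bar> * \<bar>b (k + 1)\<bar> \<le> C * (2 + q powi (-1) + q powi s)" .
    have "\<bar>alc (k + 1) * b (k + 1)\<bar> = \<bar>cc\<bar> * g * (\<bar>sq1 k\<bar> * \<bar>b (k + 1)\<bar>)"
      using g_pos by (simp add: alc_def abs_mult)
    also have "\<dots> \<le> \<bar>cc\<bar> * (g + 1 / g) * (C * (2 + q powi (-1) + q powi s))"
      using g_pos gp by (intro mult_mono 1 mult_left_mono) auto
    finally show ?thesis by (simp add: D_def mult.assoc)
  qed
  have YD: "\<bar>bec k * b k\<bar> \<le> D" for k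
  proof -
    have "\<bar>sq2 k\<bar> * \<bar>b k\<bar> \<le> (1 + q powi (s + k)) * (C * q powi \<bar>k\<bar>)"
      unfolding sq2_def by (intro mult_mono sqrt_le[OF \<eta>] C) (auto simp: add_nonneg_nonneg)
    also have "\<dots> = C * ((1 + q powi (s + k)) * q powi \<bar>k\<bar>)" by simp
    also have "\<dots> \<le> C * (1 + q powi s)" by (intro mult_left_mono bnd C0)
    also have "\<dots> \<le> C * (2 + q powi (-1) + q powi s)"
      using q_pos by (intro mult_left_mono C0) (simp add: add_nonneg_nonneg)
    finally have 1: "\<bar>sq2 k\<bar> * \<bar>b k\<bar> \<le> C * (2 + q powi (-1) + q powi s)" .
    have "\<bar>bec k * b k\<bar> = \<bar>cc\<bar> * (1 / g) * (\<bar>sq2 k\<bar> * \<bar>b k\<bar>)"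
      using g_pos by (simp add: bec_def abs_mult)
    also have "\<dots> \<le> \<bar>cc\<bar> * (g + 1 / g) * (C * (2 + q powi (-1) + q powi s))"
      using g_pos gp by (intro mult_mono 1 mult_left_mono) auto
    finally show ?thesis by (simp add: D_def mult.assoc)
  qed
  have D0: "D \<ge> 0" using YD[of 0] by linarith
  define f where "f k = complex_of_real (b k)" for k
  define H where "H k = alc (k + 1) * b (k + 1) - bec k * b k" for k
  have HsH: "Hs f k = of_real (H k)" for k by (simp add: Hs_def H_def f_def)
  \<comment> \<open>The eigenvalue of the adjoint of E times E, found by solving 2 eps eta x = (q -
    1/q)^2 \<zeta> - \<kappa>.\<close>
  define \<zeta> where "\<zeta> = cc\<^sup>2 * (\<kappa> + 2 * (\<epsilon> * \<eta> * x))"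
  have EE: "alc k * H (k - 1) - bec k * H k = \<zeta> * b k" for k
  proof (cases "in_range \<epsilon> \<eta> s k")
    case True
    have "complex_of_real (alc k * H (k - 1) - bec k * H k) = of_real (cc\<^sup>2 * (\<kappa> * b k + \<epsilon> * \<eta> * (jac_diag \<epsilon> \<eta> s m k * b k
      - (jac_off \<epsilon> \<eta> s k * b (k + 1) + jac_off \<epsilon> \<eta> s (k - 1) * b (k - 1)))))"
      using EE_identity[OF True, of f] unfolding HsH f_def by (simp add: algebra_simps)
    then have "alc k * H (k - 1) - bec k * H k = cc\<^sup>2 * (\<kappa> * b k + \<epsilon> * \<eta> * (jac_diag \<epsilon> \<eta> s m k * b k
      - (jac_off \<epsilon> \<eta> s k * b (k + 1) + jac_off \<epsilon> \<eta> s (k - 1) * b (k - 1))))"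
      by (simp only: of_real_eq_iff)
    also have "jac_off \<epsilon> \<eta> s k * b (k + 1) + jac_off \<epsilon> \<eta> s (k - 1) * b (k - 1) = (jac_diag \<epsilon> \<eta> s m k - 2 * x) * b k"
      using jacobi_sol True by (simp add: jacobi_sol_def)
    finally show ?thesis by (simp add: \<zeta>_def algebra_simps)
  next
    \<comment> \<open>Outside the range the equation must still hold as 0 = 0. Just left of the
      range either the coefficient of b (k + 1) in H k or \<open>bec k\<close> is the square root of
      0.\<close>
    case False
    then have bk: "b k = 0" "b (k - 1) = 0" by (auto intro!: out simp: in_range_def)
    then have "H (k - 1) = 0" by (simp add: H_def)
    moreover have "bec k * H k = 0"
    proof (cases "in_range \<epsilon> \<eta> s (k + 1)")
      case True
      show ?thesis
      proof (cases "\<epsilon> = -1 \<and> k = 0")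
        case True
        then have "1 + \<epsilon> * q powi (2 * (k + 1 - 1)) = 0" by simp
        then have "alc (k + 1) = 0" by (simp add: alc_def sq1_def)
        then show ?thesis using bk by (simp add: H_def)
      next
        case f2: False
        then have "\<eta> = -1 \<and> s + k = 0" using False True \<epsilon> \<eta> by (auto simp: in_range_def)
        then have "1 + \<eta> * q powi (2 * (s + k)) = 0" by simp
        then have "bec k = 0" by (simp add: bec_def sq2_def)
        then show ?thesis by simp
      qed
    next
      case False
      then show ?thesis using out[OF False] bk by (simp add: H_def)
    qed
    ultimately show ?thesis using bk by simp
  qed
  have HD: "\<bar>H k\<bar> \<le> 2 * D" for k using XD[of k] YD[of k] unfolding H_def by linarith
  have sH: "(\<lambda>k. (H k)\<^sup>2) summable_on UNIV"
  proof -
    \<comment> \<open>The boundary term of the summation by parts: H(k)^2 differs from \<zeta>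
      b(k)^2 by an increment of G. As G is bounded, the sums of H^2 over symmetric intervals stay
      bounded.\<close>
    define G where "G k = H (k - 1) * (alc k * b k)" for k
    have GD: "\<bar>G k\<bar> \<le> 2 * D * D" for k
      unfolding G_def abs_mult[of "H (k - 1)"] using XD[of "k - 1"] by (intro mult_mono HD) (auto simp: D0)
    have step: "(H k)\<^sup>2 = (G (k + 1) - G k) + \<zeta> * (b k)\<^sup>2" for k
    proof -
      have "(H k)\<^sup>2 = (G (k + 1) - G k) + (alc k * H (k - 1) - bec k * H k) * b k"
        by (simp add: G_def power2_eq_square) (simp add: H_def algebra_simps)
      then show ?thesis unfolding EE by (simp add: power2_eq_square)
    qed
    define B where "B = (\<Sum>\<^sub>\<infinity>k. (b k)\<^sup>2)"
    have part: "(\<Sum>k\<in>{- int N..<int N}. (H k)\<^sup>2) = G (int N) - G (- int N) + \<zeta> * (\<Sum>k\<in>{- int N..<int N}. (b k)\<^sup>2)" for N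
    proof (induction N)
      case 0
      then show ?case by simp
    next
      case (Suc N)
      have e: "{- int (Suc N)..<int (Suc N)} = insert (- int N - 1) (insert (int N) {- int N..<int N})"
        by auto
      have sm: "(\<Sum>k\<in>{- int (Suc N)..<int (Suc N)}. F k) = F (- int N - 1) + (F (int N) + (\<Sum>k\<in>{- int N..<int N}. F k))" for F :: "int \<Rightarrow> real"
        unfolding e by simp
      have i: "- int (Suc N) = - int N - 1" "int (Suc N) = int N + 1" by simp_all
      have 1: "(H (- int N - 1))\<^sup>2 = G (- int N) - G (- int N - 1) + \<zeta> * (b (- int N - 1))\<^sup>2"
        using step[of "- int N - 1"] by simp
      show ?case
        unfolding sm unfolding i 1 step[of "int N"] Suc.IH by (simp add: distrib_left)
    qed
    have le: "sum (\<lambda>k. (H k)\<^sup>2) F \<le> 4 * D * D + \<bar>\<zeta>\<bar> * B" if F: "finite F" for F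
    proof -
      obtain N where N: "F \<subseteq> {- int N..<int N}"
      proof
        define N where "N = Suc (nat (\<Sum>k\<in>F. \<bar>k\<bar>))"
        show "F \<subseteq> {- int N..<int N}"
        proof
          fix k assume "k \<in> F"
          then have "\<bar>k\<bar> \<le> (\<Sum>k\<in>F. \<bar>k\<bar>)" using F by (intro member_le_sum) auto
          then show "k \<in> {- int N..<int N}" by (auto simp: N_def)
        qed
      qed
      have "sum (\<lambda>k. (H k)\<^sup>2) F \<le> (\<Sum>k\<in>{- int N..<int N}. (H k)\<^sup>2)" by (intro sum_mono2 N) auto
      also have "\<dots> \<le> 4 * D * D + \<bar>\<zeta>\<bar> * B"
      proof -
        have "(\<Sum>k\<in>{- int N..<int N}. (b k)\<^sup>2) \<le> B" unfolding B_def using sb by (intro finite_sum_le_infsum) auto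
        then have "\<bar>\<zeta>\<bar> * (\<Sum>k\<in>{- int N..<int N}. (b k)\<^sup>2) \<le> \<bar>\<zeta>\<bar> * B" by (intro mult_left_mono) auto
        moreover have "\<zeta> * (\<Sum>k\<in>{- int N..<int N}. (b k)\<^sup>2) \<le> \<bar>\<zeta>\<bar> * (\<Sum>k\<in>{- int N..<int N}. (b k)\<^sup>2)"
          by (intro mult_right_mono) (auto intro: sum_nonneg)
        ultimately show ?thesis unfolding part using GD[of "int N"] GD[of "- int N"] by linarith
      qed
      finally show ?thesis .
    qed
    show ?thesis
      by (rule nonneg_bdd_above_summable_on) (use le in \<open>auto intro!: bdd_aboveI2\<close>)
  qed
  define v h where "v = vec m f" and "h = vec (m + 1) (Hs f)"
  have sf: "(\<lambda>k. (cmod (f k))\<^sup>2) summable_on UNIV" using sb by (simp add: f_def)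
  have sHf: "(\<lambda>k. (cmod (Hs f k))\<^sup>2) summable_on UNIV" using sH by (simp add: HsH)
  have hv: "v \<in> hspace q" unfolding v_def by (rule vec_hspace[OF sf]) (use out s_def in \<open>auto simp: f_def\<close>)
  have E: "(v, h) \<in> E_op q"
    unfolding v_def h_def f_def[abs_def] by (rule E_op_by_cutoff[OF out sb XD]) (use sHf in \<open>simp_all add: f_def[abs_def]\<close>)
  have hh: "h \<in> hspace q" using E_op_hspace[OF E] by simp
  have A: "(h, hscale (of_real \<zeta>) v) \<in> op_adjoint q (E_op q)"
  proof (rule adjointI[OF hh hspace_scale[OF hv]])
    fix n p t assume I: "p \<in> I_q q" "t \<in> I_q q"
    show "hscale (of_real \<zeta>) v (n, p, t) = of_real (E_coeff_t q (n, p, t)) * h (n - 1, p, t / q) - of_real (E_coeff_p q (n, p, t)) * h (n - 1, q * p, t)"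
    proof (cases "(n, p, t) \<in> S m")
      case True
      then obtain k where k: "(n, p, t) = idx m k" using S_idx I by blast
      then have n: "n = - m" by (simp add: idx_def)
      have "hscale (of_real \<zeta>) v (n, p, t) = of_real (\<zeta> * b k)" by (simp add: hscale_def v_def k f_def)
      also have "\<dots> = of_real (alc k) * h (idx (m + 1) (k - 1)) - of_real (bec k) * h (idx (m + 1) k)"
        unfolding EE[symmetric] by (simp add: h_def HsH)
      finally show ?thesis
        using idx_shift[of m k p t] k n by (simp add: E_coeff_t_idx E_coeff_p_idx)
    next
      case False
      then have "(n - 1, p, t / q) \<notin> S (m + 1)" "(n - 1, q * p, t) \<notin> S (m + 1)" by (simp_all add: S_shift')
      then have "(n - 1, p, t / q) \<notin> range (idx (m + 1))" "(n - 1, q * p, t) \<notin> range (idx (m + 1))" "(n, p, t) \<notin> range (idx m)"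
        using idx_S[of "m + 1"] idx_S[of m] False by auto
      then show ?thesis by (simp add: h_def v_def hscale_def vec_outside)
    qed
  qed
  have vS: "v i \<noteq> 0 \<Longrightarrow> i \<in> S m" for i using vec_supp[of m f i] idx_S by (auto simp: v_def)
  have c: "q powr (of_int (s + m) / 2) > 0" using q_pos by simp
  have "(v, hscale ((of_real ((q - inverse q)\<^sup>2) * of_real \<zeta> - of_real (q * (q powr (of_int (s + m) / 2))\<^sup>2 + inverse (q * (q powr (of_int (s + m) / 2))\<^sup>2))) / 2) v) \<in> Casimir0"
    by (rule Casimir0I[OF hv _ c E A]) (use vS K_coeff_S in blast)
  moreover have "(of_real ((q - inverse q)\<^sup>2) * of_real \<zeta> - of_real (q * (q powr (of_int (s + m) / 2))\<^sup>2 + inverse (q * (q powr (of_int (s + m) / 2))\<^sup>2))) / 2 = complex_of_real (\<epsilon> * \<eta> * x)"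
  proof -
    have "(q - inverse q)\<^sup>2 * \<zeta> = ((q - inverse q)\<^sup>2 * cc\<^sup>2) * (\<kappa> + 2 * (\<epsilon> * \<eta> * x))" by (simp only: \<zeta>_def mult.assoc)
    then have "(q - inverse q)\<^sup>2 * \<zeta> = \<kappa> + 2 * (\<epsilon> * \<eta> * x)" unfolding cc_nz(2) by simp
    then have "complex_of_real ((q - inverse q)\<^sup>2) * of_real \<zeta> = of_real (\<kappa> + 2 * (\<epsilon> * \<eta> * x))"
      unfolding of_real_mult[symmetric] by (simp only:)
    then show ?thesis unfolding K_coeff_const by simp
  qed
  ultimately have "(v, hscale (of_real (\<epsilon> * \<eta> * x)) v) \<in> Casimir q" using Casimir0_sub by simp
  moreover have "v \<in> K_sub q (q powi a) m \<epsilon> \<eta>" "hscale (of_real (\<epsilon> * \<eta> * x)) v \<in> K_sub q (q powi a) m \<epsilon> \<eta>"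
    unfolding K_sub_iff using hv hspace_scale[OF hv] vS by (auto simp: hscale_def)
  moreover have "v \<noteq> 0"
  proof
    assume "v = 0"
    then have "v (idx m k0) = 0" by simp
    then show False using nz by (simp add: v_def f_def)
  qed
  ultimately show ?thesis unfolding is_eigenvalue_def is_eigenvector_def op_restrict_def by blast
qed

end

text \<open>For 0 <= c < d the difference factors as (q^(-d) - q^(-c)) (1 - q^(c+d)); both sides are
  even in c.\<close>

lemma (in unit_q) powi_plus_inverse_less:
  assumes "\<bar>c\<bar> < d" shows "q powi c + q powi (- c) < q powi d + q powi (- d)"
proof -
  have main: "q powi c + q powi (- c) < q powi d + q powi (- d)" if "0 \<le> c" "c < d" for c
  proof -
    have "0 < (q powi (- d) - q powi (- c)) * (1 - q powi (c + d))"
      using that by (intro mult_pos_pos) (simp_all add: powi_less_iff powi_less_1_iff)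
    also have "\<dots> = q powi d + q powi (- d) - (q powi c + q powi (- c))"
      by (simp add: powi_add powi_uminus field_simps)
    finally show ?thesis by simp
  qed
  show ?thesis using main[of c] main[of "- c"] assms by (cases "c \<ge> 0") (simp_all add: add.commute)
qed

section \<open>The eigenvalue table of a block\<close>

context block begin

definition ev :: "real \<Rightarrow> bool" where
  "ev x \<longleftrightarrow> is_eigenvalue (op_restrict (Casimir q) (K_sub q (q powi a) m \<epsilon> \<eta>)) (of_real (\<epsilon> * \<eta> * x))"

text \<open>For eps = eta = 1 and \<delta> = -1 there are three regimes: if |s| >= |m| + d + 1 the
  series terminates and decays; if |s| is smaller but |s| + |m| >= d + 1 it terminates without
  decaying on the left; if |s| + |m| <= d the energy argument applies. All other cases are half
  lines, possibly flipped, or \<delta> = 1 on the full line.\<close>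

lemma ev_iff:
  assumes d: "d \<ge> 1" and \<delta>: "\<delta> \<in> {-1, 1}" and par: "odd (a + d)" and x: "2 * x = \<delta> * q powi (- d) + 1 / (\<delta> * q powi (- d))"
  shows "ev x \<longleftrightarrow>
    (if \<epsilon> = 1 then (if \<eta> = 1 then \<delta> = 1 \<or> \<bar>s\<bar> \<ge> \<bar>m\<bar> + d + 1
                    else (\<delta> = -1 \<and> s - m \<ge> d + 1) \<or> (\<delta> = 1 \<and> s + m \<ge> d + 1))
     else (if \<eta> = 1 then (\<delta> = -1 \<and> - s + m \<ge> d + 1) \<or> (\<delta> = 1 \<and> - s - m \<ge> d + 1)
           else \<delta> = -1 \<and> \<bar>m\<bar> \<ge> \<bar>s\<bar> + d + 1))"
proof -
  have odd: "odd (s + m + d)" "odd (- s + (- m) + d)" using par by (auto simp: s_def)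
  have yes: "has_decaying_sol \<epsilon> \<eta> s m (\<delta> * q powi (- d) + 1 / (\<delta> * q powi (- d))) \<Longrightarrow> ev x"
    unfolding x[symmetric] ev_def by (rule has_eigenvalue)
  have no: "only_zero_sol \<epsilon> \<eta> s m (\<delta> * q powi (- d) + 1 / (\<delta> * q powi (- d))) \<Longrightarrow> \<not> ev x"
    unfolding x[symmetric] ev_def by (rule no_eigenvalue)
  have dich: "ev x \<longleftrightarrow> P" if "P \<Longrightarrow> has_decaying_sol \<epsilon> \<eta> s m (\<delta> * q powi (- d) + 1 / (\<delta> * q powi (- d)))"
    "\<not> P \<Longrightarrow> only_zero_sol \<epsilon> \<eta> s m (\<delta> * q powi (- d) + 1 / (\<delta> * q powi (- d)))" for P
    using yes no that by blast
  consider "\<epsilon> = 1" "\<eta> = 1" | "\<epsilon> = 1" "\<eta> = -1" | "\<epsilon> = -1" "\<eta> = 1" | "\<epsilon> = -1" "\<eta> = -1" using \<epsilon> \<eta> by auto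
  then show ?thesis
  proof cases
    case 1
    have "ev x" if "\<delta> = 1"
      using yes plus_plus_pos_existence[OF d odd(1)] 1 that by simp
    moreover have "ev x" if a: "\<delta> = -1" "\<bar>s\<bar> \<ge> \<bar>m\<bar> + d + 1"
    proof (rule yes)
      show "has_decaying_sol \<epsilon> \<eta> s m (\<delta> * q powi (- d) + 1 / (\<delta> * q powi (- d)))"
      proof (cases "s \<ge> 0")
        case True
        then show ?thesis using plus_plus_neg_existence[OF d odd(1)] a unfolding 1 a(1) by simp
      next
        case False
        have "has_decaying_sol 1 1 (- s) (- m) (- (q powi (- d)) + 1 / (- (q powi (- d))))"
          by (rule plus_plus_neg_existence[OF d odd(2)]) (use a False in simp)
        then show ?thesis unfolding 1 a(1) using has_decaying_sol_flip by simp
      qed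
    qed
    moreover have "\<not> ev x" if a: "\<delta> = -1" "\<bar>s\<bar> < \<bar>m\<bar> + d + 1"
    proof (cases "\<bar>s\<bar> + \<bar>m\<bar> \<ge> d + 1")
      case ge: True
      show ?thesis
      proof (rule no, cases "s \<ge> 0")
        case True
        then show "only_zero_sol \<epsilon> \<eta> s m (\<delta> * q powi (- d) + 1 / (\<delta> * q powi (- d)))"
          using plus_plus_neg_nonexistence[OF d odd(1)] a ge unfolding 1 a(1) by simp
      next
        case False
        have "only_zero_sol 1 1 (- s) (- m) (- (q powi (- d)) + 1 / (- (q powi (- d))))"
          by (rule plus_plus_neg_nonexistence[OF d odd(2)]) (use a ge False in simp_all)
        then show "only_zero_sol \<epsilon> \<eta> s m (\<delta> * q powi (- d) + 1 / (\<delta> * q powi (- d)))"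
          unfolding 1 a(1) using only_zero_sol_flip by simp
      qed
    next
      case False
      \<comment> \<open>With |s + m| <= d, parity leaves |s + m + 1| < d or s + m + 1 = d. Since 2x
        = -(q^d + q^(-d)), these are exactly the strict and the equality case of the energy
        criterion.\<close>
      have "s + m \<noteq> d" using odd(1) by auto
      then have c: "\<bar>s + m + 1\<bar> < d \<or> s + m + 1 = d" using False d by linarith
      have x2: "2 * x = - (q powi d + q powi (- d))" unfolding x a(1) by (simp add: powi_uminus)
      have "2 * x + \<kappa> < 0 \<or> 2 * x + \<kappa> = 0 \<and> s + m + 1 > 0"
        using c
      proof
        assume "\<bar>s + m + 1\<bar> < d"
        then show ?thesis unfolding x2 \<kappa>_def using powi_plus_inverse_less by fastforce
      next
        assume "s + m + 1 = d"
        then show ?thesis unfolding x2 \<kappa>_def using d by simp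
      qed
      then show ?thesis unfolding ev_def by (rule no_eigenvalue_energy[OF 1])
    qed
    ultimately show ?thesis using 1 \<delta> by fastforce
  next
    case 2
    have lr: "left_reg 1 (-1) s" by (simp add: left_reg_def)
    show ?thesis
      using dich[of "(\<delta> = -1 \<and> s - m \<ge> d + 1) \<or> (1 * \<delta> = 1 \<and> s + m \<ge> d + 1)"] half_line_dichotomy[OF lr d \<delta> odd(1)] unfolding 2 by simp
  next
    case 3
    have lr: "left_reg 1 (-1) (- s)" by (simp add: left_reg_def)
    have "ev x \<longleftrightarrow> (\<delta> = -1 \<and> - s - (- m) \<ge> d + 1) \<or> (1 * \<delta> = 1 \<and> - s + (- m) \<ge> d + 1)"
      by (rule dich; unfold 3)
        (rule has_decaying_sol_flip[OF half_line_dichotomy(1)[OF lr d \<delta> odd(2)]], assumption,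
         rule only_zero_sol_flip[OF half_line_dichotomy(2)[OF lr d \<delta> odd(2)]], assumption)
    then show ?thesis using 3 by simp
  next
    case 4
    have "ev x \<longleftrightarrow> \<delta> = -1 \<and> \<bar>m\<bar> \<ge> \<bar>s\<bar> + d + 1"
    proof (cases "s \<le> 0")
      case True
      have lr: "left_reg (-1) (-1) s" using True by (simp add: left_reg_def)
      have "ev x \<longleftrightarrow> (\<delta> = -1 \<and> s - m \<ge> d + 1) \<or> (-1 * \<delta> = 1 \<and> s + m \<ge> d + 1)"
        using dich[of "(\<delta> = -1 \<and> s - m \<ge> d + 1) \<or> (-1 * \<delta> = 1 \<and> s + m \<ge> d + 1)"] half_line_dichotomy[OF lr d \<delta> odd(1)] unfolding 4 by simp
      then show ?thesis using True \<delta> by auto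
    next
      case False
      have lr: "left_reg (-1) (-1) (- s)" using False by (simp add: left_reg_def)
      have "ev x \<longleftrightarrow> (\<delta> = -1 \<and> - s - (- m) \<ge> d + 1) \<or> (-1 * \<delta> = 1 \<and> - s + (- m) \<ge> d + 1)"
        by (rule dich; unfold 4)
          (rule has_decaying_sol_flip[OF half_line_dichotomy(1)[OF lr d \<delta> odd(2)]], assumption,
           rule only_zero_sol_flip[OF half_line_dichotomy(2)[OF lr d \<delta> odd(2)]], assumption)
      then show ?thesis using False \<delta> by auto
    qed
    then show ?thesis using 4 by simp
  qed
qed

end
section \<open>The discrete series\<close>

lemma closed_span_zero: "closed_span q {0} = {0}"
proof -
  have sp: "hvec.span {0} = {0}"
    using hvec.span_insert_0[of "{}"] by simp
  have "v = 0" if v: "v \<in> hspace q" "\<And>r. r > 0 \<Longrightarrow> hnorm v < r" for v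
  proof -
    have "hnorm v \<le> 0" using v(2)[of "hnorm v"] by fastforce
    then show ?thesis using hnorm_eq_0[OF hspace_l2[OF v(1)]] hnorm_nonneg[of v] by linarith
  qed
  then show ?thesis
    unfolding closed_span_def hclosure_def sp by (auto simp: hspace_0)
qed

lemma closed_span_superset: "v \<in> B \<Longrightarrow> v \<in> hspace q \<Longrightarrow> v \<in> closed_span q B"
  unfolding closed_span_def hclosure_def using hvec.span_base[of v B] by (auto intro!: bexI[of _ v])

lemma disjoint_supp_hinner: "(\<And>i. v i = 0 \<or> w i = 0) \<Longrightarrow> hinner v w = 0"
proof -
  assume "\<And>i. v i = 0 \<or> w i = 0"
  then have "v i * cnj (w i) = 0" for i by (metis complex_cnj_zero mult_eq_0_iff)
  then show ?thesis unfolding hinner_def by (intro infsum_0)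
qed

theorem proposition5p2:
  fixes q p x lam :: real and j l :: int and e :: "int \<Rightarrow> real \<Rightarrow> real \<Rightarrow> hvec"
  assumes "0 < q" and "q < 1"
    and "p \<in> q_ints q"
    and "lam \<in> {- (q powi (2 * k + 1)) * p | k :: int. True} \<union> {q powi (2 * k + 1) * p | k :: int. True}"
    and "\<bar>lam\<bar> > 1"
    and "x = mu lam"
    and "\<bar>lam\<bar> = q powi (1 - 2 * j) * inverse p"
    and "\<bar>lam\<bar> = q powi (1 + 2 * l) * p"
    and "is_e_family q p x e"
  shows "l < j \<and>
    (determines_discrete_series q e \<longleftrightarrow>
       x > 0 \<or> (x < 0 \<and> l \<ge> 0 \<and> j > 0) \<or> (x < 0 \<and> l < 0 \<and> j \<le> 0)) \<and>
    (x > 0 \<longrightarrow>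
       orthonormal_basis q
         ({e m 1 1 | m. True} \<union> {e m (-1) 1 | m. m \<le> l} \<union> {e m 1 (-1) | m. m \<ge> j})
         (L_space q e)) \<and>
    (x < 0 \<and> l \<ge> 0 \<and> j > 0 \<longrightarrow>
       orthonormal_basis q
         ({e m (-1) 1 | m. True} \<union> {e m 1 1 | m. m \<le> l} \<union> {e m (-1) (-1) | m. m \<ge> j})
         (L_space q e)) \<and>
    (x < 0 \<and> l < 0 \<and> j \<le> 0 \<longrightarrow>
       orthonormal_basis q
         ({e m 1 (-1) | m. True} \<union> {e m (-1) (-1) | m. m \<le> l} \<union> {e m 1 1 | m. m \<ge> j})
         (L_space q e))"
proof -
  interpret unit_q q by unfold_locales (use assms in auto)
  obtain a where p: "p = q powi a" using assms(3) by (auto simp: q_ints_def)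
  have "q powi (1 - 2 * j - a) = q powi (1 + 2 * l + a)"
    using assms(7,8) by (simp add: p powi_add powi_diff divide_inverse)
  \<comment> \<open>Comparing the two expressions for |lambda| fixes a; then d = j - l - 1 is the
    exponent of 1/|lambda|, and |lambda| > 1 gives d >= 1, hence l < j.\<close>
  then have a: "a = - (l + j)" by (simp add: powi_eq_iff)
  define d where "d = j - l - 1"
  have "\<bar>lam\<bar> = q powi (1 + 2 * l + a)" using assms(8) by (simp add: p powi_add)
  also have "1 + 2 * l + a = - d" by (simp add: a d_def)
  finally have lam_abs: "\<bar>lam\<bar> = q powi (- d)" .
  have d: "d \<ge> 1"
    using assms(5) powi_le_1_iff[of "- d"] unfolding lam_abs by linarith
  define \<delta> where "\<delta> = sgn lam"
  have "lam \<noteq> 0" using assms(5) by auto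
  then have \<delta>: "\<delta> \<in> {-1, 1}" by (auto simp: \<delta>_def sgn_if)
  have lam: "lam = \<delta> * q powi (- d)" unfolding \<delta>_def lam_abs[symmetric] by (simp add: sgn_mult_abs)
  have x2: "2 * x = \<delta> * q powi (- d) + 1 / (\<delta> * q powi (- d))"
    unfolding assms(6) mu_def lam by (simp add: inverse_eq_divide)
  have xs: "x > 0 \<longleftrightarrow> \<delta> = 1" "x < 0 \<longleftrightarrow> \<delta> = -1"
  proof -
    have pos: "q powi (- d) + 1 / q powi (- d) > 0" by (simp add: add_pos_pos)
    have "2 * x = \<delta> * (q powi (- d) + 1 / q powi (- d))" using \<delta> unfolding x2 by auto
    then show "x > 0 \<longleftrightarrow> \<delta> = 1" "x < 0 \<longleftrightarrow> \<delta> = -1" using \<delta> pos by auto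
  qed
  have par: "odd (a + d)" by (simp add: a d_def)
  define ev where ev_eq: "ev m \<epsilon> \<eta> \<longleftrightarrow> is_eigenvalue (op_restrict (Casimir q) (K_sub q p m \<epsilon> \<eta>)) (of_real (\<epsilon> * \<eta> * x))" for m \<epsilon> \<eta>
  \<comment> \<open>Substitution of s = m - l - j and d + 1 = j - l. For instance s - m >= d + 1
    becomes j <= 0, s + m >= d + 1 becomes m >= j, and -s - m >= d + 1 becomes m <= l.\<close>
  have ev: "ev m 1 1 \<longleftrightarrow> \<delta> = 1 \<or> m \<ge> j \<and> j \<le> 0 \<or> m \<le> l \<and> l \<ge> 0"
    "ev m 1 (-1) \<longleftrightarrow> \<delta> = -1 \<and> j \<le> 0 \<or> \<delta> = 1 \<and> m \<ge> j"
    "ev m (-1) 1 \<longleftrightarrow> \<delta> = -1 \<and> l \<ge> 0 \<or> \<delta> = 1 \<and> m \<le> l"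
    "ev m (-1) (-1) \<longleftrightarrow> \<delta> = -1 \<and> (m \<ge> j \<and> l \<ge> 0 \<or> m \<le> l \<and> j \<le> 0)" for m
  proof -
    have E: "ev m \<epsilon> \<eta> \<longleftrightarrow>
      (if \<epsilon> = 1 then (if \<eta> = 1 then \<delta> = 1 \<or> \<bar>m + a\<bar> \<ge> \<bar>m\<bar> + d + 1
                    else (\<delta> = -1 \<and> m + a - m \<ge> d + 1) \<or> (\<delta> = 1 \<and> m + a + m \<ge> d + 1))
       else (if \<eta> = 1 then (\<delta> = -1 \<and> - (m + a) + m \<ge> d + 1) \<or> (\<delta> = 1 \<and> - (m + a) - m \<ge> d + 1)
           else \<delta> = -1 \<and> \<bar>m\<bar> \<ge> \<bar>m + a\<bar> + d + 1))" if s: "\<epsilon> \<in> {-1, 1}" "\<eta> \<in> {-1, 1}" for \<epsilon> \<eta>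
    proof -
      interpret block q a m \<epsilon> \<eta> by unfold_locales (use s in auto)
      show ?thesis using ev_iff[OF d \<delta> par x2] unfolding block.ev_def[OF block_axioms] s_def ev_eq p .
    qed
    show "ev m 1 1 \<longleftrightarrow> \<delta> = 1 \<or> m \<ge> j \<and> j \<le> 0 \<or> m \<le> l \<and> l \<ge> 0"
      by (subst E) (auto simp: a d_def)
    show "ev m 1 (-1) \<longleftrightarrow> \<delta> = -1 \<and> j \<le> 0 \<or> \<delta> = 1 \<and> m \<ge> j"
      by (subst E) (auto simp: a d_def)
    show "ev m (-1) 1 \<longleftrightarrow> \<delta> = -1 \<and> l \<ge> 0 \<or> \<delta> = 1 \<and> m \<le> l"
      by (subst E) (auto simp: a d_def)
    show "ev m (-1) (-1) \<longleftrightarrow> \<delta> = -1 \<and> (m \<ge> j \<and> l \<ge> 0 \<or> m \<le> l \<and> j \<le> 0)"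
      by (subst E) (auto simp: a d_def)
  qed
  have efam: "if ev m \<epsilon> \<eta> then is_eigenvector (op_restrict (Casimir q) (K_sub q p m \<epsilon> \<eta>)) (of_real (\<epsilon> * \<eta> * x)) (e m \<epsilon> \<eta>) \<and> hnorm (e m \<epsilon> \<eta>) = 1 else e m \<epsilon> \<eta> = 0"
    if "\<epsilon> \<in> {-1, 1}" "\<eta> \<in> {-1, 1}" for m \<epsilon> \<eta>
    using assms(9) that unfolding is_e_family_def Let_def ev_eq by blast
  have e0: "e m \<epsilon> \<eta> = 0" if "\<epsilon> \<in> {-1, 1}" "\<eta> \<in> {-1, 1}" "\<not> ev m \<epsilon> \<eta>" for m \<epsilon> \<eta>
    using efam[OF that(1,2)] that(3) by presburger
  have e1: "hnorm (e m \<epsilon> \<eta>) = 1" "e m \<epsilon> \<eta> \<noteq> 0" "e m \<epsilon> \<eta> \<in> hspace q"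
    \<comment> \<open>A single index in the support reveals m and both signs. Different nonzero
      vectors of the family therefore have disjoint supports, and orthogonality follows from this
      alone.\<close>
    "e m \<epsilon> \<eta> (n, P, T) \<noteq> 0 \<Longrightarrow> m = - n \<and> \<epsilon> = sgn T \<and> \<eta> = sgn P"
    if s: "\<epsilon> \<in> {-1, 1}" "\<eta> \<in> {-1, 1}" "ev m \<epsilon> \<eta>" for m \<epsilon> \<eta> n P T
  proof -
    interpret block q a m \<epsilon> \<eta> by unfold_locales (use s in auto)
    have v: "is_eigenvector (op_restrict (Casimir q) (K_sub q p m \<epsilon> \<eta>)) (of_real (\<epsilon> * \<eta> * x)) (e m \<epsilon> \<eta>)" "hnorm (e m \<epsilon> \<eta>) = 1"
      using efam[OF s(1,2)] s(3) by presburger+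
    then have K: "e m \<epsilon> \<eta> \<in> K_sub q (q powi a) m \<epsilon> \<eta>" "e m \<epsilon> \<eta> \<noteq> 0"
      by (auto simp: is_eigenvector_def op_restrict_def p)
    show "hnorm (e m \<epsilon> \<eta>) = 1" "e m \<epsilon> \<eta> \<noteq> 0" "e m \<epsilon> \<eta> \<in> hspace q" using v K by (auto simp: K_sub_iff)
    assume "e m \<epsilon> \<eta> (n, P, T) \<noteq> 0"
    then have "(n, P, T) \<in> S m" using K(1) unfolding K_sub_iff by blast
    then have S: "n = - m" "P = \<epsilon> * \<eta> * q powi m * q powi a * T" "sgn T = \<epsilon>" by (auto simp: S_def)
    have "sgn P = \<eta>" unfolding S(2) by (simp add: sgn_mult S(3) mult_ac)
    then show "m = - n \<and> \<epsilon> = sgn T \<and> \<eta> = sgn P" using S by simp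
  qed
  \<comment> \<open>Only the nonzero members are kept: the zero vectors of the family do not affect
    the span, but they are not unit vectors.\<close>
  define B where "B = {e m \<epsilon> \<eta> | m \<epsilon> \<eta>. \<epsilon> \<in> {-1, 1} \<and> \<eta> \<in> {-1, 1} \<and> ev m \<epsilon> \<eta>}"
  define E where "E = {e m \<epsilon> \<eta> | m \<epsilon> \<eta>. \<epsilon> \<in> {-1, 1} \<and> \<eta> \<in> {-1, 1}}"
  have BE: "B \<subseteq> E" "E \<subseteq> insert 0 B"
    unfolding B_def E_def using e0 by blast+
  have "hvec.span E = hvec.span B"
  proof
    show "hvec.span E \<subseteq> hvec.span B"
      using hvec.span_mono[OF BE(2)] by (simp add: hvec.span_insert_0)
    show "hvec.span B \<subseteq> hvec.span E" by (rule hvec.span_mono[OF BE(1)])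
  qed
  then have L: "L_space q e = closed_span q B"
    unfolding L_space_def closed_span_def E_def by simp
  have onb: "orthonormal_basis q B (L_space q e)"
    unfolding orthonormal_basis_def
  proof (intro conjI ballI impI)
    show "B \<subseteq> hspace q" unfolding B_def using e1(3) by blast
    show "hnorm v = 1" if "v \<in> B" for v using that e1(1) unfolding B_def by blast
    show "closed_span q B = L_space q e" using L ..
    fix v w assume vw: "v \<in> B" "w \<in> B" "v \<noteq> w"
    then obtain m \<epsilon> \<eta> m' \<epsilon>' \<eta>' where v: "v = e m \<epsilon> \<eta>" "\<epsilon> \<in> {-1, 1}" "\<eta> \<in> {-1, 1}" "ev m \<epsilon> \<eta>"
      and w: "w = e m' \<epsilon>' \<eta>'" "\<epsilon>' \<in> {-1, 1}" "\<eta>' \<in> {-1, 1}" "ev m' \<epsilon>' \<eta>'" unfolding B_def by blast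
    show "hinner v w = 0"
    proof (rule disjoint_supp_hinner, rule ccontr)
      fix i assume "\<not> (v i = 0 \<or> w i = 0)"
      then have nz: "v i \<noteq> 0" "w i \<noteq> 0" by auto
      obtain n P T where i: "i = (n, P, T)" by (cases i)
      have "m = m' \<and> \<epsilon> = \<epsilon>' \<and> \<eta> = \<eta>'"
        using e1(4)[OF v(2-4), of n P T] e1(4)[OF w(2-4), of n P T] nz unfolding v(1) w(1) i by simp
      then show False using vw(3) v(1) w(1) by simp
    qed
  qed
  have det: "determines_discrete_series q e \<longleftrightarrow> (\<exists>m \<epsilon> \<eta>. \<epsilon> \<in> {-1, 1} \<and> \<eta> \<in> {-1, 1} \<and> ev m \<epsilon> \<eta>)"
  proof
    assume "\<exists>m \<epsilon> \<eta>. \<epsilon> \<in> {-1, 1} \<and> \<eta> \<in> {-1, 1} \<and> ev m \<epsilon> \<eta>"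
    then obtain m \<epsilon> \<eta> where s: "\<epsilon> \<in> {-1, 1}" "\<eta> \<in> {-1, 1}" "ev m \<epsilon> \<eta>" by blast
    then have "e m \<epsilon> \<eta> \<in> B" unfolding B_def by blast
    then have "e m \<epsilon> \<eta> \<in> L_space q e" unfolding L by (rule closed_span_superset) (rule e1(3)[OF s])
    then show "determines_discrete_series q e" using e1(2)[OF s] unfolding determines_discrete_series_def by blast
  next
    assume dd: "determines_discrete_series q e"
    show "\<exists>m \<epsilon> \<eta>. \<epsilon> \<in> {-1, 1} \<and> \<eta> \<in> {-1, 1} \<and> ev m \<epsilon> \<eta>"
    proof (rule ccontr)
      assume "\<not> ?thesis"
      then have "B = {}" unfolding B_def by blast
      then have "closed_span q B = closed_span q {0}"
        unfolding closed_span_def using hvec.span_insert_0[of "{}"] by simp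
      then show False using dd closed_span_zero unfolding determines_discrete_series_def L by simp
    qed
  qed
  have ex: "(\<exists>m \<epsilon> \<eta>. \<epsilon> \<in> {-1, 1} \<and> \<eta> \<in> {-1, 1} \<and> ev m \<epsilon> \<eta>) \<longleftrightarrow>
      (\<exists>m. ev m 1 1) \<or> (\<exists>m. ev m 1 (-1)) \<or> (\<exists>m. ev m (-1) 1) \<or> (\<exists>m. ev m (-1) (-1))" by blast
  have Bu: "B = {e m 1 1 | m. ev m 1 1} \<union> {e m 1 (-1) | m. ev m 1 (-1)} \<union> {e m (-1) 1 | m. ev m (-1) 1} \<union> {e m (-1) (-1) | m. ev m (-1) (-1)}"
    unfolding B_def by blast
  have lj: "l < j" using d by (simp add: d_def)
  show ?thesis
  proof (intro conjI impI)
    show "l < j" by (rule lj)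
    show "determines_discrete_series q e \<longleftrightarrow> x > 0 \<or> (x < 0 \<and> l \<ge> 0 \<and> j > 0) \<or> (x < 0 \<and> l < 0 \<and> j \<le> 0)"
      unfolding det ex xs ev using \<delta> lj by force
  next
    assume "x > 0"
    then have "\<delta> = 1" using xs by simp
    then have "{e m 1 1 | m. True} \<union> {e m (-1) 1 | m. m \<le> l} \<union> {e m 1 (-1) | m. m \<ge> j} = B"
      unfolding Bu ev by auto
    then show "orthonormal_basis q ({e m 1 1 | m. True} \<union> {e m (-1) 1 | m. m \<le> l} \<union> {e m 1 (-1) | m. m \<ge> j}) (L_space q e)"
      using onb by simp
  next
    assume c: "x < 0 \<and> l \<ge> 0 \<and> j > 0"
    then have "\<delta> = -1" using xs by simp
    then have "{e m (-1) 1 | m. True} \<union> {e m 1 1 | m. m \<le> l} \<union> {e m (-1) (-1) | m. m \<ge> j} = B"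
      unfolding Bu ev using c by auto
    then show "orthonormal_basis q ({e m (-1) 1 | m. True} \<union> {e m 1 1 | m. m \<le> l} \<union> {e m (-1) (-1) | m. m \<ge> j}) (L_space q e)"
      using onb by simp
  next
    assume c: "x < 0 \<and> l < 0 \<and> j \<le> 0"
    then have "\<delta> = -1" using xs by simp
    then have "{e m 1 (-1) | m. True} \<union> {e m (-1) (-1) | m. m \<le> l} \<union> {e m 1 1 | m. m \<ge> j} = B"
      unfolding Bu ev using c by auto
    then show "orthonormal_basis q ({e m 1 (-1) | m. True} \<union> {e m (-1) (-1) | m. m \<le> l} \<union> {e m 1 1 | m. m \<ge> j}) (L_space q e)"
      using onb by simp
  qed
qed

end
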